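(* Let $n\ge 2$, let $D$ be a domain in $\mathbb{R}^n$, let $k$ be an integer with $1\le k\le n-1$, and let $p\ge k$ be real. Let $f:D\to\mathbb{R}^n$ be a continuous, orientation preserving, open and discrete mapping of finite metric distortion which has the $(A^{(2,p)}_k)$-property. Let $\Gamma$ be a family of $k$-dimensional surfaces in $D$, let $\Gamma'$ be a family of $k$-dimensional surfaces $\beta:\omega\to f(D)$ (where $\omega$ may depend on $\beta$), and let $m$ be a positive integer such that the following holds: for every surface $\beta:\omega\to f(D)$ in $\Gamma'$ there are surfaces $\alpha_1:\omega_1\to D,\ \ldots,\ \alpha_m:\omega_m\to D$ in $\Gamma$ such that $f\circ\alpha_j\subset\beta$ for all $j=1,\ldots,m$ (that is, $\omega_j$ is an open subset of $\omega$ and $\beta|_{\omega_j}=f\circ\alpha_j$), and such that for every $x\in D$ and every $z\in\omega$ there are at most $i(x,f)$ indices $j\in\{1,\ldots,m\}$ with $z\in\omega_j$ and $\alpha_j(z)=x$. Then $$M_p(\Gamma')\ \le\ \frac{1}{m}\int_D K_{I,p}(x,f)\,\rho^p(x)\,dm(x)\qquad\text{for every }\rho\in\mathrm{adm}\,\Gamma,$$ where $dm(x)$ denotes integration with respect to Lebesgue measure on $\mathbb{R}^n$.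
   Context: **Surfaces and area.** Let $\overline{\mathbb{R}^k}=\mathbb{R}^k\cup\{\infty\}$. A $k$-dimensional surface $S$ in a set $A\subset\mathbb{R}^n$ ($1\le k\le n-1$) is a continuous mapping $S:\omega\to A$, where $\omega$ is an open set in $\overline{\mathbb{R}^k}$; the image $S(\omega)$ is sometimes also denoted by $S$. Its multiplicity function is $N(S,y)=\mathrm{card}\,S^{-1}(y)$, $y\in\mathbb{R}^n$. With $\mathcal{H}^k$ the $k$-dimensional Hausdorff measure, the area of an $\mathcal H^k$-measurable set $B\subset\mathbb{R}^n$ associated with $S$ is $\mathcal{A}_S(B)=\int_B N(S,y)\,d\mathcal{H}^k y$. For a Borel function $\rho:\mathbb{R}^n\to[0,\infty]$ set $\int_S\rho\,d\mathcal{A}:=\int_{\mathbb{R}^n}\rho(y)N(S,y)\,d\mathcal{H}^k y$. **Modulus.** For a family $\Gamma$ of $k$-dimensional surfaces in $\mathbb{R}^n$, a Borel function $\rho:\mathbb{R}^n\to[0,\infty]$ is admissible for $\Gamma$, written $\rho\in\mathrm{adm}\,\Gamma$, if $\int_S\rho^k\,d\mathcal{A}\ge 1$ for every $S\in\Gamma$. For $p\ge1$, the $p$-modulus is $M_p(\Gamma)=\inf_{\rho\in\mathrm{adm}\,\Gamma}\int_{\mathbb{R}^n}\rho^p(x)\,dm(x)$. A property holds for $p$-a.e. $k$-dimensional surface if it holds for all of them except for a family of zero $p$-modulus. **Finite metric distortion.** For $x\in D$ put $L(x,f)=\limsup_{y\to x}\frac{|f(x)-f(y)|}{|x-y|}$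 and $l(x,f)=\liminf_{y\to x}\frac{|f(x)-f(y)|}{|x-y|}$ ($y\in D$). The mapping $f$ is of finite metric distortion if it has the Luzin $N$-property (it maps Lebesgue null sets to Lebesgue null sets) and $0<l(x,f)\le L(x,f)<\infty$ for almost all $x\in D$. **$(A^{(2,p)}_k)$-property.** A surface $S$ in $D$ is a lifting of a surface $S_*$ under $f$ if $S_*=f\circ S$. The mapping $f$ has the $(A^{(2,p)}_k)$-property if for $p$-a.e. $k$-dimensional surface $S_*$ in $f(D)$ and for each lifting $S$ of $S_*$, the restriction $f|_S$ has the $N^{-1}$-property with respect to area: for every subset $B$ of the image of $S$, $\mathcal{A}_{S_*}(f(B))=0$ implies $\mathcal{A}_S(B)=0$ (equivalently, $\mathcal{H}^k(f(B))=0$ implies $\mathcal{H}^k(B)=0$). **Topological notions.** $f$ is discrete if $f^{-1}(y)$ consists of isolated points for each $y\in\mathbb{R}^n$, and open if it maps open sets onto open sets. $f$ is orientation preserving if the topological index (topological degree) satisfies $\mu(y,f,G)>0$ for every domain $G$ with compact closure $\overline{G}\subset D$ and every $y\in f(G)\setminus f(\partial G)$. The local topological index $i(x,f)$ is $\mu(f(x),f,G)$ for any domain $G\ni x$ with compact closure $\overline{G}\subset D$ and $\overline{G}\cap f^{-1}(f(x))=\{x\}$; it does not depend on the choice of $G$. **Inner dilatation.** At points $x$ of differentiability of $f$ put $l(f'(x))=\min_{h\ne0}|f'(x)h|/|h|$ and $J(x,f)=\det f'(x)$. Then $K_{I,p}(x,f)=|J(x,f)|/l(f'(x))^p$ if $J(x,f)\ne0$;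 $K_{I,p}(x,f)=1$ if $f'(x)=0$; and $K_{I,p}(x,f)=\infty$ otherwise. *)

theory Defs
  imports "HOL-Analysis.Analysis" "HOL-Homology.Homology"
begin

section \<open>Hausdorff measure\<close>

text \<open>The diameter as an extended real; unlike \<^const>\<open>diameter\<close> it is infinite for unbounded sets.\<close>

definition ediameter :: "'a::metric_space set \<Rightarrow> ennreal" where
  "ediameter E = (SUP x\<in>E. SUP y\<in>E. ennreal (dist x y))"

definition hausdorff_premeasure :: "nat \<Rightarrow> real \<Rightarrow> 'a::metric_space set \<Rightarrow> ennreal" where
  "hausdorff_premeasure k \<delta> A =
     (INF E\<in>{E :: nat \<Rightarrow> 'a set. A \<subseteq> (\<Union>i. E i) \<and> (\<forall>i. ediameter (E i) \<le> ennreal \<delta>)}.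
        suminf (\<lambda>i. ennreal (unit_ball_vol (real k) / 2 ^ k) * ediameter (E i) ^ k))"

definition hausdorff_outer_measure :: "nat \<Rightarrow> 'a::metric_space set \<Rightarrow> ennreal" where
  "hausdorff_outer_measure k A = (SUP \<delta>\<in>{0<..}. hausdorff_premeasure k \<delta> A)"

text \<open>The Hausdorff measure lives on the sigma-algebra of all Caratheodory measurable sets, so in
  particular every set of outer measure zero is measurable. Only \<open>k \<ge> 1\<close> is meant: for \<open>k = 0\<close>
  the empty covering sets would be counted.\<close>

definition hausdorff_measure :: "nat \<Rightarrow> 'a::metric_space measure" where
  "hausdorff_measure k =
     measure_of UNIV (lambda_system UNIV UNIV (hausdorff_outer_measure k)) (hausdorff_outer_measure k)"

lemma ediameter_empty [simp]: "ediameter {} = 0"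
  by (simp add: ediameter_def bot_ennreal)

lemma hausdorff_premeasure_mono:
  "A \<subseteq> B \<Longrightarrow> hausdorff_premeasure k \<delta> A \<le> hausdorff_premeasure k \<delta> B"
  unfolding hausdorff_premeasure_def by (rule INF_superset_mono) auto

lemma hausdorff_premeasure_empty:
  assumes "0 < k"
  shows "hausdorff_premeasure k \<delta> {} = 0"
proof -
  have "hausdorff_premeasure k \<delta> ({} :: 'a set)
          \<le> suminf (\<lambda>i::nat. ennreal (unit_ball_vol (real k) / 2 ^ k) * ediameter ({} :: 'a set) ^ k)"
    unfolding hausdorff_premeasure_def by (rule INF_lower2[of "\<lambda>_. {}"]) auto
  then show ?thesis using assms by (simp add: power_0_left)
qed

lemma hausdorff_premeasure_countably_subadditive:
  fixes A :: "nat \<Rightarrow> 'a::metric_space set"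
  shows "hausdorff_premeasure k \<delta> (\<Union>i. A i) \<le> suminf (\<lambda>i. hausdorff_premeasure k \<delta> (A i))"
proof -
  define c where "c E = ennreal (unit_ball_vol (real k) / 2 ^ k) * ediameter E ^ k" for E :: "'a set"
  define C where "C X = {E :: nat \<Rightarrow> 'a set. X \<subseteq> (\<Union>i. E i) \<and> (\<forall>i. ediameter (E i) \<le> ennreal \<delta>)}" for X
  define h where "h X = (INF E\<in>C X. suminf (\<lambda>i. c (E i)))" for X
  have h_eq: "hausdorff_premeasure k \<delta> X = h X" for X
    by (simp add: h_def c_def C_def hausdorff_premeasure_def)
  show ?thesis
    unfolding h_eq
  proof (rule ennreal_le_epsilon)
    fix e :: real
    assume e: "0 < e" and fin: "suminf (\<lambda>i. h (A i)) < top_class.top"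
    have "\<forall>n. \<exists>E. E \<in> C (A n) \<and> suminf (\<lambda>i. c (E i)) < h (A n) + ennreal (e * (1/2) ^ Suc n)"
    proof
      fix n
      have "h (A n) < h (A n) + ennreal (e * (1/2) ^ Suc n)"
        using e ennreal_suminf_lessD[OF fin, of n] by auto
      then show "\<exists>E. E \<in> C (A n) \<and> suminf (\<lambda>i. c (E i)) < h (A n) + ennreal (e * (1/2) ^ Suc n)"
        by (subst (asm) (1) h_def) (auto simp only: INF_less_iff)
    qed
    from choice[OF this] obtain E where E: "\<And>n. E n \<in> C (A n)"
      and Es: "\<And>n. suminf (\<lambda>i. c (E n i)) < h (A n) + ennreal (e * (1/2) ^ Suc n)"
      by blast
    define F where "F j = case_prod E (prod_decode j)" for j
    have "F \<in> C (\<Union>i. A i)"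
    proof -
      have "\<exists>j. x \<in> F j" if x: "x \<in> A n" for x n
      proof -
        obtain i where "x \<in> E n i" using E[of n] x by (auto simp: C_def)
        then show ?thesis by (intro exI[of _ "prod_encode (n, i)"]) (simp add: F_def)
      qed
      moreover have "ediameter (F j) \<le> ennreal \<delta>" for j
        using E unfolding C_def by (simp add: F_def split_beta)
      ultimately show ?thesis unfolding C_def by blast
    qed
    then have "h (\<Union>i. A i) \<le> suminf (\<lambda>j. c (F j))"
      unfolding h_def by (rule INF_lower)
    also have "\<dots> = suminf (\<lambda>n. suminf (\<lambda>i. c (E n i)))"
      using suminf_ennreal_2dimen[of "\<lambda>n. suminf (\<lambda>i. c (E n i))" "\<lambda>(n, i). c (E n i)"]
      by (simp add: F_def split_beta comp_def)
    also have "\<dots> \<le> suminf (\<lambda>n. h (A n) + ennreal (e * (1/2) ^ Suc n))"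
      using Es by (intro suminf_le) (auto intro: less_imp_le)
    also have "\<dots> = suminf (\<lambda>n. h (A n)) + suminf (\<lambda>n. ennreal (e * (1/2) ^ Suc n))"
      by (rule suminf_add[symmetric]) auto
    also have "suminf (\<lambda>n. ennreal (e * (1/2) ^ Suc n)) = ennreal e"
      using sums_mult[OF power_half_series, of e] e by (intro suminf_ennreal_eq) auto
    finally show "h (\<Union>i. A i) \<le> suminf (\<lambda>i. h (A i)) + ennreal e" .
  qed
qed

lemma outer_measure_space_hausdorff:
  assumes "0 < k"
  shows "outer_measure_space UNIV (hausdorff_outer_measure k :: 'a::metric_space set \<Rightarrow> ennreal)"
proof -
  let ?H = "hausdorff_outer_measure k :: 'a set \<Rightarrow> ennreal"
  have "?H {} = 0"
    unfolding hausdorff_outer_measure_def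
    using hausdorff_premeasure_empty[OF assms, where ?'a = 'a] by simp
  moreover have "?H A \<le> ?H B" if "A \<subseteq> B" for A B
    unfolding hausdorff_outer_measure_def by (rule SUP_subset_mono) (simp_all add: hausdorff_premeasure_mono that)
  moreover have "?H (\<Union>i. A i) \<le> suminf (\<lambda>i. ?H (A i))" for A :: "nat \<Rightarrow> 'a set"
    unfolding hausdorff_outer_measure_def[of k "\<Union>i. A i"]
  proof (rule SUP_least)
    fix \<delta> :: real
    assume "\<delta> \<in> {0<..}"
    then have "suminf (\<lambda>i. hausdorff_premeasure k \<delta> (A i)) \<le> suminf (\<lambda>i. ?H (A i))"
      unfolding hausdorff_outer_measure_def by (intro suminf_le SUP_upper) auto
    then show "hausdorff_premeasure k \<delta> (\<Union>i. A i) \<le> suminf (\<lambda>i. ?H (A i))"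
      using hausdorff_premeasure_countably_subadditive order_trans by blast
  qed
  ultimately show ?thesis
    unfolding outer_measure_space_def positive_def increasing_def countably_subadditive_def by auto
qed

lemma
  assumes "0 < k"
  shows sets_hausdorff_measure:
      "sets (hausdorff_measure k) = lambda_system UNIV UNIV (hausdorff_outer_measure k :: 'a::metric_space set \<Rightarrow> ennreal)"
    and emeasure_hausdorff_measure:
      "A \<in> sets (hausdorff_measure k :: 'a measure) \<Longrightarrow>
         emeasure (hausdorff_measure k) A = hausdorff_outer_measure k A"
proof -
  let ?L = "lambda_system UNIV UNIV (hausdorff_outer_measure k :: 'a set \<Rightarrow> ennreal)"
  have ms: "measure_space UNIV ?L (hausdorff_outer_measure k)"
    using sigma_algebra.caratheodory_lemma[OF sigma_algebra_Pow, of UNIV]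
      outer_measure_space_hausdorff[OF assms] by simp
  then have "sigma_algebra UNIV ?L" by (simp add: measure_space_def)
  then show *: "sets (hausdorff_measure k) = ?L"
    by (simp add: hausdorff_measure_def sigma_algebra.sigma_sets_eq)
  show "emeasure (hausdorff_measure k) A = hausdorff_outer_measure k A"
    if "A \<in> sets (hausdorff_measure k :: 'a measure)"
  proof (rule emeasure_measure_of[OF hausdorff_measure_def])
    show "A \<in> sets (hausdorff_measure k)" by (rule that)
  qed (use ms * in \<open>auto simp: measure_space_def\<close>)
qed


section \<open>Surfaces, area and modulus\<close>

text \<open>A surface is a pair of its parameter domain and the map; the values of the map off the domain
  are irrelevant. The domain is an open subset of the one-point compactification of
  \<open>real ^ 'k\<close>, in which \<^const>\<open>None\<close> is the point at infinity. The dimension \<open>k\<close> is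
  \<open>CARD('k)\<close>.\<close>

type_synonym ('k, 'n) surface = "(real ^ 'k) option set \<times> ((real ^ 'k) option \<Rightarrow> real ^ 'n)"

definition surface_in :: "(real ^ 'n) set \<Rightarrow> ('k::finite, 'n::finite) surface \<Rightarrow> bool" where
  "surface_in A S \<longleftrightarrow>
     openin (Alexandroff_compactification euclidean) (fst S) \<and>
     continuous_map (subtopology (Alexandroff_compactification euclidean) (fst S)) euclidean (snd S) \<and>
     snd S ` fst S \<subseteq> A"

definition multiplicity_fun :: "('k::finite, 'n::finite) surface \<Rightarrow> real ^ 'n \<Rightarrow> ennreal" where
  "multiplicity_fun S y = emeasure (count_space UNIV) {z \<in> fst S. snd S z = y}"

definition area :: "('k::finite, 'n::finite) surface \<Rightarrow> (real ^ 'n) set \<Rightarrow> ennreal" where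
  "area S B = (\<integral>\<^sup>+ y \<in> B. multiplicity_fun S y \<partial>hausdorff_measure CARD('k))"

definition surface_integral ::
  "('k::finite, 'n::finite) surface \<Rightarrow> (real ^ 'n \<Rightarrow> ennreal) \<Rightarrow> ennreal" where
  "surface_integral S \<rho> = (\<integral>\<^sup>+ y. \<rho> y * multiplicity_fun S y \<partial>hausdorff_measure CARD('k))"

text \<open>Real powers on \<open>[0, \<infinity>]\<close>, for exponents \<open>p > 0\<close>.\<close>

definition ennpowr :: "ennreal \<Rightarrow> real \<Rightarrow> ennreal" where
  "ennpowr x p = (if x = \<infinity> then \<infinity> else ennreal (enn2real x powr p))"

definition adm :: "('k::finite, 'n::finite) surface set \<Rightarrow> (real ^ 'n \<Rightarrow> ennreal) set" where
  "adm \<Gamma> = {\<rho> \<in> borel_measurable borel. \<forall>S\<in>\<Gamma>. 1 \<le> surface_integral S (\<lambda>y. \<rho> y ^ CARD('k))}"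

definition modulus :: "real \<Rightarrow> ('k::finite, 'n::finite) surface set \<Rightarrow> ennreal" where
  "modulus p \<Gamma> = (INF \<rho>\<in>adm \<Gamma>. \<integral>\<^sup>+ x. ennpowr (\<rho> x) p \<partial>lebesgue)"

definition p_ae_surface_in ::
  "real \<Rightarrow> (real ^ 'n) set \<Rightarrow> (('k::finite, 'n::finite) surface \<Rightarrow> bool) \<Rightarrow> bool" where
  "p_ae_surface_in p A P \<longleftrightarrow> modulus p {S. surface_in A S \<and> \<not> P S} = 0"


section \<open>Finite metric distortion and the \<open>A\<close>-property\<close>

definition upper_stretch :: "(real ^ 'n) set \<Rightarrow> (real ^ 'n \<Rightarrow> real ^ 'n) \<Rightarrow> real ^ 'n::finite \<Rightarrow> ennreal" where
  "upper_stretch D f x = Limsup (at x within D) (\<lambda>y. ennreal (norm (f x - f y) / norm (x - y)))"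

definition lower_stretch :: "(real ^ 'n) set \<Rightarrow> (real ^ 'n \<Rightarrow> real ^ 'n) \<Rightarrow> real ^ 'n::finite \<Rightarrow> ennreal" where
  "lower_stretch D f x = Liminf (at x within D) (\<lambda>y. ennreal (norm (f x - f y) / norm (x - y)))"

definition finite_metric_distortion :: "(real ^ 'n) set \<Rightarrow> (real ^ 'n \<Rightarrow> real ^ 'n::finite) \<Rightarrow> bool" where
  "finite_metric_distortion D f \<longleftrightarrow>
     (\<forall>E \<subseteq> D. E \<in> null_sets lebesgue \<longrightarrow> f ` E \<in> null_sets lebesgue) \<and>
     (AE x in lebesgue. x \<in> D \<longrightarrow>
        0 < lower_stretch D f x \<and> lower_stretch D f x \<le> upper_stretch D f x \<and> upper_stretch D f x < \<infinity>)"

definition lifting ::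
  "(real ^ 'n) set \<Rightarrow> (real ^ 'n \<Rightarrow> real ^ 'n) \<Rightarrow> ('k::finite, 'n::finite) surface \<Rightarrow> ('k, 'n) surface \<Rightarrow> bool" where
  "lifting D f S S' \<longleftrightarrow>
     surface_in D S \<and> fst S = fst S' \<and> (\<forall>z \<in> fst S'. snd S' z = f (snd S z))"

text \<open>Vanishing area of an arbitrary set includes its measurability; since the multiplicity is at
  least one on the image of the surface, for subsets of the image this says that the Hausdorff
  (outer) measure vanishes.\<close>

definition area_null :: "('k::finite, 'n::finite) surface \<Rightarrow> (real ^ 'n) set \<Rightarrow> bool" where
  "area_null S B \<longleftrightarrow> B \<in> sets (hausdorff_measure CARD('k)) \<and> area S B = 0"

definition A2_property ::
  "'k::finite itself \<Rightarrow> real \<Rightarrow> (real ^ 'n) set \<Rightarrow> (real ^ 'n \<Rightarrow> real ^ 'n::finite) \<Rightarrow> bool" where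
  "A2_property _ p D f \<longleftrightarrow>
     p_ae_surface_in p (f ` D) (\<lambda>S' :: ('k, 'n) surface.
       \<forall>S. lifting D f S S' \<longrightarrow>
         (\<forall>B \<subseteq> snd S ` fst S. area_null S' (f ` B) \<longrightarrow> area_null S B))"


section \<open>Topological index\<close>

text \<open>The degree \<open>\<mu>(y, f, G)\<close>, for \<open>f\<close> continuous on the compact closure of the open set \<open>G\<close> and \<open>y\<close>
  not in \<open>f (\<partial>G)\<close>, as in Dold's Lectures on Algebraic Topology. Put \<open>K = {x \<in> G. f x = y}\<close>, which is compact, and let
  \<open>B\<close> be a closed ball containing \<open>K\<close> and \<open>y\<close>. A class \<open>c\<close> of \<open>H\<^sub>n(\<real>\<^sup>n, \<real>\<^sup>n - B)\<close>
  (an infinite cyclic group) restricts to a class in \<open>H\<^sub>n(\<real>\<^sup>n, \<real>\<^sup>n - K)\<close>, which corresponds under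
  excision to a unique \<open>e\<close> in \<open>H\<^sub>n(G, G - K)\<close>. It also restricts to \<open>H\<^sub>n(\<real>\<^sup>n, \<real>\<^sup>n - {y})\<close>,
  isomorphically, and the degree is the factor \<open>d\<close> with \<open>f\<^sub>* e = d \<cdot> c\<close> there.
  The groups of \<^theory>\<open>HOL-Homology.Homology_Groups\<close> are written multiplicatively.\<close>

definition topological_index ::
  "real ^ 'n \<Rightarrow> (real ^ 'n \<Rightarrow> real ^ 'n) \<Rightarrow> (real ^ 'n::finite) set \<Rightarrow> int" where
  "topological_index y f G =
    (let n = int CARD('n); X = (euclidean :: (real ^ 'n) topology); K = {x \<in> G. f x = y};
         H = relative_homology_group n X (- {y})
     in THE d. \<forall>r. K \<union> {y} \<subseteq> cball 0 r \<longrightarrow>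
          (\<forall>c \<in> carrier (relative_homology_group n X (- cball 0 r)).
           \<forall>e \<in> carrier (relative_homology_group n (top_of_set G) (G - K)).
             hom_induced n (top_of_set G) (G - K) X (- K) id e =
             hom_induced n X (- cball 0 r) X (- K) id c \<longrightarrow>
             hom_induced n (top_of_set G) (G - K) X (- {y}) f e =
             hom_induced n X (- cball 0 r) X (- {y}) id c [^]\<^bsub>H\<^esub> d))"

definition compact_subdomain :: "(real ^ 'n::finite) set \<Rightarrow> (real ^ 'n) set \<Rightarrow> bool" where
  "compact_subdomain D G \<longleftrightarrow>
     open G \<and> connected G \<and> G \<noteq> {} \<and> compact (closure G) \<and> closure G \<subseteq> D"

definition orientation_preserving_map :: "(real ^ 'n) set \<Rightarrow> (real ^ 'n \<Rightarrow> real ^ 'n::finite) \<Rightarrow> bool" where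
  "orientation_preserving_map D f \<longleftrightarrow>
     (\<forall>G. compact_subdomain D G \<longrightarrow> (\<forall>y \<in> f ` G - f ` frontier G. 0 < topological_index y f G))"

definition local_index :: "(real ^ 'n) set \<Rightarrow> (real ^ 'n \<Rightarrow> real ^ 'n) \<Rightarrow> real ^ 'n::finite \<Rightarrow> int" where
  "local_index D f x =
     topological_index (f x) f
       (SOME G. compact_subdomain D G \<and> x \<in> G \<and> {z \<in> closure G. f z = f x} = {x})"


section \<open>Inner dilatation\<close>

definition min_stretch :: "(real ^ 'n \<Rightarrow> real ^ 'n::finite) \<Rightarrow> real" where
  "min_stretch A = (INF h\<in>- {0}. norm (A h) / norm h)"

definition jacobian :: "(real ^ 'n \<Rightarrow> real ^ 'n) \<Rightarrow> real ^ 'n::finite \<Rightarrow> real" where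
  "jacobian f x = det (matrix (frechet_derivative f (at x)))"

text \<open>The value at points of non-differentiability is immaterial: maps of finite metric distortion
  are differentiable almost everywhere by Stepanov's theorem.\<close>

definition inner_dilatation :: "real \<Rightarrow> (real ^ 'n \<Rightarrow> real ^ 'n) \<Rightarrow> real ^ 'n::finite \<Rightarrow> ennreal" where
  "inner_dilatation p f x =
     (if f differentiable (at x) \<and> jacobian f x \<noteq> 0
      then ennreal (\<bar>jacobian f x\<bar> / min_stretch (frechet_derivative f (at x)) powr p)
      else if f differentiable (at x) \<and> frechet_derivative f (at x) = (\<lambda>h. 0) then 1
      else \<infinity>)"

end

theory Submission
  imports Defs
begin

text \<open>
  Cut the part of \<open>D\<close> where \<open>0 < l(x,f) \<le> L(x,f) < \<infinity>\<close> into disjoint Borel pieces \<open>E i\<close> inside compact sets on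
  which \<open>f\<close> expands distances at least by a factor \<open>c i\<close>, with \<open>l(f'(x)) \<le> t * c i\<close> at points of
  differentiability, where \<open>t > 1\<close> is close to \<open>1\<close>. Given \<open>\<rho>\<close>, let \<open>\<rho>' y ^ k\<close> be \<open>1 / m\<close> times the
  supremum of the sums of \<open>(\<rho> x / c i) ^ k\<close> over at most \<open>m\<close> preimages \<open>x\<close> of \<open>y\<close> in the pieces.

  By convexity \<open>\<rho>' y ^ p\<close> is at most \<open>1 / m\<close> times the sum of \<open>(\<rho> x / c i) ^ p\<close> over all these preimages, and the
  change of variables formula bounds its integral by \<open>t ^ p / m\<close> times the integral of \<open>K \<rho> ^ p\<close>.

  For admissibility let \<open>\<alpha> j\<close> be the partial lifts of a surface \<open>\<beta>\<close>. Where \<open>f\<close> is differentiable with invertible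
  derivative its local index is at most one, so different \<open>j\<close> give different preimages and the lifts together
  contribute at most \<open>m * \<rho>' y ^ k\<close> for each parameter. As \<open>f\<close> expands on the pieces, Hausdorff
  measures there grow at least by \<open>c i ^ k\<close>, hence the area integral of \<open>\<rho> ^ k\<close> over each lift is
  recovered on the image side. The rest of \<open>D\<close> is Lebesgue null up to points where \<open>\<rho>\<close>
  vanishes; the \<open>A\<close>-property makes it negligible on the lifts outside a family of surfaces of modulus zero.
\<close>

section \<open>Topological index at points of differentiability\<close>

text \<open>The surfaces are merely continuous, so they have no tangent planes and no area formula.
  Hausdorff measure on a lift can be compared with that on its image only through metric expansion
  of \<open>f\<close>; hence the pieces are defined by distances and not by derivatives. A constant
  \<open>c i\<close> on each piece costs the factor \<open>t\<close>, which disappears as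
  \<open>t\<close> tends to 1. The bound \<open>m\<close> on the number of summands produces the
  factor \<open>1 / m\<close>: convexity is applied to a mean over \<open>m\<close> terms, while
  \<open>y\<close> may have far more preimages; and at each parameter, \<open>m\<close> lifts pass
  through at most \<open>m\<close> of them. The set off the pieces is handled on the image side. By
  the Luzin property its image lies in a Borel null set \<open>F\<close>, and a density that is
  infinite on \<open>F\<close> costs nothing. Surfaces with positive area in \<open>F\<close> then
  have infinite integral; for the others the \<open>A\<close>-property carries vanishing area back
  to the lifts. Compactness gives \<open>f\<close> a continuous inverse on each piece and keeps
  images and densities Borel, hence measurable for both Lebesgue and Hausdorff measure.\<close>

lemma automorphism_infinite_cyclic:
  assumes G: "group G" and iso: "G \<cong> integer_group" and h: "h \<in> iso G G"
  obtains d :: int where "\<bar>d\<bar> = 1" "\<And>x. x \<in> carrier G \<Longrightarrow> h x = x [^]\<^bsub>G\<^esub> d"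
proof -
  interpret G: group G by fact
  obtain \<phi> where \<phi>: "\<phi> \<in> iso G integer_group"
    using iso by (auto simp: is_iso_def)
  define \<psi> where "\<psi> = inv_into (carrier G) \<phi>"
  have \<psi>: "\<psi> \<in> iso integer_group G"
    unfolding \<psi>_def using G.iso_set_sym[OF \<phi>] by simp
  \<comment> \<open>Conjugated to the integers, \<open>h\<close> is multiplication by
    \<open>\<theta> 1\<close>, and surjectivity makes this factor a unit.\<close>
  define \<theta> where "\<theta> = \<phi> \<circ> (h \<circ> \<psi>)"
  have \<theta>: "\<theta> \<in> iso integer_group integer_group"
    unfolding \<theta>_def using iso_set_trans[OF iso_set_trans[OF \<psi> h] \<phi>] .
  define d where "d = \<theta> 1"
  have \<theta>_eq: "\<theta> k = k * d" for k
  proof -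
    have "\<theta> (pow integer_group 1 k) = pow integer_group (\<theta> 1) k"
      by (rule hom_int_pow) (use \<theta> in \<open>auto simp: iso_def\<close>)
    then show ?thesis by (simp add: d_def)
  qed
  have "\<exists>k. \<theta> k = 1"
  proof -
    have "1 \<in> \<theta> ` carrier integer_group"
      using \<theta> by (auto simp: iso_def bij_betw_def)
    then show ?thesis by auto
  qed
  then obtain k where "k * d = 1" by (auto simp: \<theta>_eq)
  then have d1: "\<bar>d\<bar> = 1"
    using abs_zmult_eq_1[of d k] by (simp add: mult.commute)
  have "h x = x [^]\<^bsub>G\<^esub> d" if x: "x \<in> carrier G" for x
  proof -
    have inj: "inj_on \<phi> (carrier G)" and hx: "h x \<in> carrier G"
      using \<phi> h x by (auto simp: iso_def bij_betw_def)
    have "\<psi> (\<phi> x) = x"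
      unfolding \<psi>_def using inj x by (rule inv_into_f_f)
    then have "\<phi> (h x) = \<phi> x * d"
      using \<theta>_eq[of "\<phi> x"] by (simp add: \<theta>_def)
    also have "\<dots> = \<phi> (x [^]\<^bsub>G\<^esub> d)"
      using hom_int_pow[of \<phi> G integer_group x d] \<phi> x G by (simp add: iso_def mult.commute)
    finally show ?thesis
      using inj hx x by (auto dest: inj_onD)
  qed
  then show thesis using d1 that by blast
qed

text \<open>Infinite cyclic groups are torsion free. This gives the uniqueness behind the
  \<open>THE\<close> in \<open>topological_index\<close>.\<close>

lemma int_pow_inj_infinite_cyclic:
  assumes G: "group G" and iso: "G \<cong> integer_group" and x: "x \<in> carrier G" "x \<noteq> \<one>\<^bsub>G\<^esub>"
    and eq: "x [^]\<^bsub>G\<^esub> (d::int) = x [^]\<^bsub>G\<^esub> e"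
  shows "d = e"
proof -
  interpret G: group G by fact
  obtain \<phi> where \<phi>: "\<phi> \<in> iso G integer_group"
    using iso by (auto simp: is_iso_def)
  then have \<phi>h: "\<phi> \<in> hom G integer_group" and inj: "inj_on \<phi> (carrier G)"
    by (auto simp: iso_def bij_betw_def)
  have "\<phi> x \<noteq> 0"
    using \<phi>h inj x hom_one[OF \<phi>h G] by (metis G.one_closed group_integer_group inj_onD one_integer_group)
  moreover have "d * \<phi> x = e * \<phi> x"
    using hom_int_pow[OF \<phi>h _ G, of x] x eq by (metis group_int_pow_integer_group group_integer_group)
  ultimately show ?thesis by simp
qed

text \<open>The ambient space is contractible, so the boundary map identifies the group with the
  reduced homology of the punctured space one dimension lower, and the punctured space is homotopy
  equivalent to a sphere.\<close>

lemma relative_homology_group_punctured_space: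
  fixes x :: "'a::euclidean_space"
  shows "relative_homology_group (int DIM('a)) euclidean (- {x}) \<cong> integer_group"
proof -
  let ?n = "DIM('a)"
  have n: "int ?n - 1 = int (?n - 1)"
    by (simp add: of_nat_diff)
  have "contractible_space (euclidean :: 'a topology)"
    using contractible_space_top_of_set[of "UNIV :: 'a set"] convex_imp_contractible[OF convex_UNIV] by simp
  moreover obtain b :: 'a where "b \<in> Basis" by (meson nonempty_Basis ex_in_conv)
  then have "x + b \<in> - {x}" by auto
  then have "topspace euclidean \<inter> (- {x}) \<noteq> {}" by (metis IntI UNIV_I empty_iff topspace_euclidean)
  ultimately have 1: "relative_homology_group (int ?n) euclidean (- {x}) \<cong>
      reduced_homology_group (int (?n - 1)) (top_of_set (- {x}))"
    using isomorphic_group_relative_homology_of_contractible[of "euclidean :: 'a topology" "- {x}" "int ?n"]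
    unfolding n by simp
  have "sphere x 1 homotopy_eqv UNIV - {x}"
    using homotopy_eqv_rel_frontier_punctured_affine_hull[of "cball x 1" x]
      affine_hull_nonempty_interior[of "cball x 1"]
    by (simp add: rel_frontier_nonempty_interior rel_interior_nonempty_interior)
  then have 2: "reduced_homology_group (int (?n - 1)) (top_of_set (- {x})) \<cong>
      reduced_homology_group (int (?n - 1)) (top_of_set (sphere x 1))"
    by (metis Compl_eq_Diff_UNIV homotopy_equivalent_space_imp_isomorphic_reduced_homology_groups homotopy_equivalent_space_sym)
  obtain f :: "(nat \<Rightarrow> real) \<Rightarrow> 'a" and g where
    fg: "homeomorphic_maps (nsphere (?n - 1)) (top_of_set (sphere 0 1 \<inter> span Basis)) f g"
    by (rule homeomorphic_maps_nsphere_euclidean_sphere[OF independent_Basis orthogonal_Basis refl, where 'n = 'a]) auto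
  then have "nsphere (?n - 1) homeomorphic_space top_of_set (sphere (0::'a) 1)"
    by (auto simp: homeomorphic_space_def)
  moreover have "top_of_set (sphere x 1) homeomorphic_space top_of_set (sphere (0::'a) 1)"
    by (simp add: homeomorphic_spheres)
  ultimately have "top_of_set (sphere x 1) homeomorphic_space nsphere (?n - 1)"
    using homeomorphic_space_trans homeomorphic_space_sym by metis
  then have 3: "reduced_homology_group (int (?n - 1)) (top_of_set (sphere x 1)) \<cong> reduced_homology_group (int (?n - 1)) (nsphere (?n - 1))"
    by (rule homeomorphic_space_imp_isomorphic_reduced_homology_groups)
  show ?thesis
    using iso_trans[OF iso_trans[OF iso_trans[OF 1 2] 3] reduced_homology_group_nsphere(1)] .
qed

text \<open>With a contractible ambient space, naturality of the boundary map reduces the claim to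
  the inclusion of the complement of the ball in the punctured space, which is a homotopy
  equivalence. This is the isomorphic restriction at \<open>y\<close> on which the definition of the
  degree rests.\<close>

lemma hom_induced_compl_cball_iso:
  fixes x :: "'a::euclidean_space"
  assumes x: "x \<in> cball a r"
  shows "hom_induced p euclidean (- cball a r) euclidean (- {x}) id
           \<in> iso (relative_homology_group p euclidean (- cball a r)) (relative_homology_group p euclidean (- {x}))"
proof -
  let ?X = "euclidean :: 'a topology" and ?A = "- cball a r" and ?B = "- {x}"
  have r: "0 \<le> r" using x by (metis cball_eq_empty empty_iff linorder_not_less)
  define R where "R = 2 * r + 1"
  have R: "R > 0" "R > 2 * r" using r by (auto simp: R_def)
  \<comment> \<open>\<open>g\<close> moves every point away from \<open>x\<close> by
    \<open>R\<close>. As \<open>R\<close> exceeds the diameter of the ball, the result lies outside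
    the ball, and \<open>g\<close> is a homotopy inverse of the inclusion.\<close>
  define g where "g z = x + (1 + R / norm (z - x)) *\<^sub>R (z - x)" for z
  have ctr: "contractible_space ?X"
    using contractible_space_top_of_set[of "UNIV :: 'a set"] convex_imp_contractible[OF convex_UNIV] by simp
  \<comment> \<open>A ray from \<open>x\<close> that has left the convex ball never enters it again,
    so the homotopy stays in the complement.\<close>
  have out: "x + c *\<^sub>R (z - x) \<notin> cball a r" if "z \<notin> cball a r" "1 \<le> c" for z c
  proof
    assume *: "x + c *\<^sub>R (z - x) \<in> cball a r"
    have "z = (1 - 1 / c) *\<^sub>R x + (1 / c) *\<^sub>R (x + c *\<^sub>R (z - x))"
      using that by (simp add: algebra_simps)
    moreover have "(1 - 1 / c) *\<^sub>R x + (1 / c) *\<^sub>R (x + c *\<^sub>R (z - x)) \<in> cball a r"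
      by (rule convexD[OF convex_cball x *]) (use that in auto)
    ultimately show False using that by metis
  qed
  have g_out: "g z \<notin> cball a r" if "z \<noteq> x" for z
  proof
    assume *: "g z \<in> cball a r"
    have "norm (g z - x) = norm (z - x) + R"
      using that R unfolding g_def by (simp add: distrib_right)
    moreover have "norm (g z - x) \<le> 2 * r"
      using * x by (smt (verit, best) dist_norm dist_triangle2 mem_cball dist_commute)
    ultimately show False using R norm_ge_zero[of "z - x"] by linarith
  qed
  have contg: "continuous_on ?B g"
    unfolding g_def by (intro continuous_intros) auto
  have hom: "homotopic_with_canon (\<lambda>x. True) S S g id"
    if S: "S \<subseteq> ?B" and st: "\<And>z c. \<lbrakk>z \<in> S; 1 \<le> c\<rbrakk> \<Longrightarrow> x + c *\<^sub>R (z - x) \<in> S" for S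
  proof (rule homotopic_with_linear)
    show "continuous_on S g" using contg S continuous_on_subset by blast
    show "closed_segment (g z) (id z) \<subseteq> S" if z: "z \<in> S" for z
    proof
      fix w assume "w \<in> closed_segment (g z) (id z)"
      then obtain u where u: "0 \<le> u" "u \<le> 1" and w: "w = (1 - u) *\<^sub>R g z + u *\<^sub>R z"
        by (auto simp: in_segment)
      have "w = x + (1 + (1 - u) * (R / norm (z - x))) *\<^sub>R (z - x)"
        unfolding w g_def by (simp add: algebra_simps)
      moreover have "1 \<le> 1 + (1 - u) * (R / norm (z - x))"
        using u R by simp
      ultimately show "w \<in> S" using st[OF z] by simp
    qed
  qed auto
  have AB: "?A \<subseteq> ?B" using x by auto
  have hB: "homotopic_with_canon (\<lambda>x. True) ?B ?B g id"
    by (rule hom) auto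
  have hA: "homotopic_with_canon (\<lambda>x. True) ?A ?A g id"
    by (rule hom) (use AB out in auto)
  have contgA: "continuous_map (top_of_set ?B) (top_of_set ?A) g"
    using contg g_out by (auto simp: )
  have red: "hom_induced (p - 1) (top_of_set ?A) {} (top_of_set ?B) {} id
      \<in> iso (reduced_homology_group (p - 1) (top_of_set ?A)) (reduced_homology_group (p - 1) (top_of_set ?B))"
    by (rule homotopy_equivalence_reduced_homology_group_isomorphism[OF _ contgA])
       (use AB hA hB in \<open>auto simp: o_def id_def\<close>)
  obtain b :: 'a where b: "b \<in> Basis" by (meson nonempty_Basis ex_in_conv)
  have "a + (r + 1) *\<^sub>R b \<notin> cball a r"
    using r b by (simp add: dist_norm)
  then have ne: "topspace ?X \<inter> ?A \<noteq> {}" "topspace ?X \<inter> ?B \<noteq> {}"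
    using AB by auto
  let ?i = "hom_induced p ?X ?A ?X ?B id" and ?j = "hom_induced (p - 1) (top_of_set ?A) {} (top_of_set ?B) {} id"
  let ?HA = "relative_homology_group p ?X ?A" and ?HB = "relative_homology_group p ?X ?B"
  have dA: "hom_boundary p ?X ?A \<in> iso ?HA (reduced_homology_group (p - 1) (top_of_set ?A))"
   and dB: "hom_boundary p ?X ?B \<in> iso ?HB (reduced_homology_group (p - 1) (top_of_set ?B))"
    using iso_relative_homology_of_contractible[OF ctr ne(1)] iso_relative_homology_of_contractible[OF ctr ne(2)] by auto
  have "id \<in> ?A \<rightarrow> ?B" using AB by (simp only: Pi_iff id_apply) blast
  then have nat: "hom_boundary p ?X ?B \<circ> ?i = ?j \<circ> hom_boundary p ?X ?A"
    using naturality_hom_induced[of ?X ?X id ?A ?B p] by simp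
  have bij: "bij_betw (hom_boundary p ?X ?B \<circ> ?i) (carrier ?HA) (carrier (reduced_homology_group (p - 1) (top_of_set ?B)))"
    unfolding nat using dA red by (auto simp: iso_def intro: bij_betw_trans)
  have "bij_betw ?i (carrier ?HA) (carrier ?HB)"
  proof (rule bij_betw_comp_iff2[THEN iffD2, OF _ _ bij])
    show "bij_betw (hom_boundary p ?X ?B) (carrier ?HB) (carrier (reduced_homology_group (p - 1) (top_of_set ?B)))"
      using dB by (auto simp: iso_def)
    show "?i ` carrier ?HA \<subseteq> carrier ?HB"
      by (auto simp: hom_induced_carrier)
  qed
  then show ?thesis by (auto simp: iso_def hom_induced_hom)
qed

lemma homotopic_with_linear_pair:
  fixes f g :: "'a::topological_space \<Rightarrow> 'b::real_normed_vector"
  assumes f: "continuous_on S f" and g: "continuous_on S g"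
    and seg: "\<And>z u. \<lbrakk>z \<in> T; 0 \<le> u; u \<le> 1\<rbrakk> \<Longrightarrow> (1 - u) *\<^sub>R f z + u *\<^sub>R g z \<in> U"
  shows "homotopic_with (\<lambda>h. h \<in> T \<rightarrow> U) (top_of_set S) euclidean f g"
proof -
  define h where "h = (\<lambda>w. (1 - fst w) *\<^sub>R f (snd w) + fst w *\<^sub>R g (snd w))"
  have "continuous_on ({0..1::real} \<times> S) h"
    unfolding h_def by (intro continuous_intros continuous_on_compose2[OF f] continuous_on_compose2[OF g]) auto
  then have "continuous_map (prod_topology (top_of_set {0..1::real}) (top_of_set S)) euclidean h"
    by (simp flip: subtopology_Times)
  then show ?thesis
    unfolding homotopic_with_def
    by (rule_tac x=h in exI) (auto simp: h_def seg)
qed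

text \<open>Excision reduces the degree to a small ball around \<open>x\<close>. There the straight
  segment from \<open>f\<close> to its affine approximation avoids \<open>y\<close>, because the
  error is at most half of what \<open>A\<close> expands, and an invertible affine map has degree 1
  or -1. The sign is left open: an upper bound for the index is all that is wanted.\<close>

lemma topological_index_differentiable:
  fixes f :: "real ^ 'n \<Rightarrow> real ^ 'n::finite"
  assumes G: "open G" "x \<in> G" and contf: "continuous_on G f" and fib: "{z \<in> G. f z = f x} = {x}"
    and der: "(f has_derivative A) (at x)" and inj: "inj A"
  shows "\<bar>topological_index (f x) f G\<bar> = 1"
proof -
  define y where "y = f x"
  define X where "X = (euclidean :: (real ^ 'n) topology)"
  define n where "n = int CARD('n)"
  define HG where "HG = relative_homology_group n (top_of_set G) (G - {x})"
  define HX where "HX = relative_homology_group n X (- {x})"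
  define HY where "HY = relative_homology_group n X (- {y})"
  define HB where "HB r = relative_homology_group n X (- cball 0 r)" for r :: real
  define iG where "iG = hom_induced n (top_of_set G) (G - {x}) X (- {x}) id"
  define fG where "fG = hom_induced n (top_of_set G) (G - {x}) X (- {y}) f"
  define iX where "iX r = hom_induced n X (- cball 0 r) X (- {x}) id" for r
  define iY where "iY r = hom_induced n X (- cball 0 r) X (- {y}) id" for r
  have grp: "group HX" "group HY" "group HG" "group (HB r)" for r
    by (auto simp: HX_def HY_def HG_def HB_def)
  have cyc: "HX \<cong> integer_group" "HY \<cong> integer_group"
    using relative_homology_group_punctured_space[of x] relative_homology_group_punctured_space[of y]
    by (simp_all add: HX_def HY_def n_def X_def)
  have linA: "linear A" and blA: "bounded_linear A"
    using der has_derivative_linear has_derivative_bounded_linear by blast+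
  obtain l where l: "0 < l" "\<And>h. l * norm h \<le> norm (A h)"
    using linear_inj_bounded_below_pos[OF linA inj] by blast
  obtain \<delta> where \<delta>: "0 < \<delta>" "ball x \<delta> \<subseteq> G"
    and app: "\<And>z. z \<in> ball x \<delta> \<Longrightarrow> norm (f z - y - A (z - x)) \<le> l / 2 * norm (z - x)"
  proof -
    obtain d where d: "d > 0" "\<And>z. norm (z - x) < d \<Longrightarrow> norm (f z - f x - A (z - x)) \<le> l / 2 * norm (z - x)"
      using der l(1) unfolding has_derivative_at_alt by (meson half_gt_zero)
    obtain d' where d': "d' > 0" "ball x d' \<subseteq> G"
      using G openE by blast
    show thesis
      by (rule that[of "min d d'"]) (use d d' in \<open>auto simp: y_def dist_norm norm_minus_commute\<close>)
  qed
  define B where "B = ball x \<delta>"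
  define a where "a z = y + A (z - x)" for z
  define a' where "a' z = x + A (z - x)" for z
  define \<tau> where "\<tau> z = z + (y - x)" for z
  have conta: "continuous_on S a" "continuous_on S a'" "continuous_on S \<tau>" for S
    unfolding a_def a'_def \<tau>_def
    by (auto intro!: continuous_intros bounded_linear.continuous_on[OF blA])
  have a_eq: "a = \<tau> \<circ> a'"
    by (auto simp: a_def a'_def \<tau>_def)
  have A0: "A 0 = 0" using linA by (rule linear_0)
  have ay: "a z \<noteq> y" if "z \<noteq> x" for z
    using inj that A0 by (metis a_def add_cancel_right_right eq_iff_diff_eq_0 injD)
  have a'x: "a' z \<noteq> x" if "z \<noteq> x" for z
    using inj that A0 by (metis a'_def add_cancel_right_right eq_iff_diff_eq_0 injD)
  have fy: "f z \<noteq> y" if "z \<in> G" "z \<noteq> x" for z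
    using fib that by (auto simp: y_def)
  have "bij A" using linA inj by (simp add: bij_def linear_injective_imp_surjective)
  obtain d :: int where d1: "\<bar>d\<bar> = 1"
    and d: "\<And>u. u \<in> carrier HX \<Longrightarrow> hom_induced n X (- {x}) X (- {x}) a' u = u [^]\<^bsub>HX\<^esub> d"
  proof (rule automorphism_infinite_cyclic[OF grp(1) cyc(1)])
    have "homeomorphic_map X X a'"
    proof -
      obtain A' where A': "linear A'" "\<And>h. A' (A h) = h" "\<And>h. A (A' h) = h"
        using linear_injective_isomorphism[OF linA inj] by blast
      have "homeomorphic_maps X X a' (\<lambda>z. x + A' (z - x))"
        unfolding homeomorphic_maps_def X_def using conta(2)[of UNIV] A'(2,3)
          bounded_linear.continuous_on[OF A'(1)[unfolded linear_conv_bounded_linear], of UNIV "\<lambda>z. z - x", OF continuous_on_diff[OF continuous_on_id continuous_on_const]]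
        by (auto simp: a'_def intro!: continuous_intros)
      then show ?thesis using homeomorphic_maps_map by blast
    qed
    moreover have "a' ` (- {x}) = - {x}"
    proof -
      have "\<exists>w. w \<noteq> x \<and> z = a' w" if "z \<noteq> x" for z
      proof -
        obtain h where h: "z - x = A h" using \<open>bij A\<close> by (meson bij_pointE)
        then have "h \<noteq> 0" using that A0 by auto
        then show ?thesis using h by (intro exI[of _ "x + h"]) (auto simp: a'_def diff_eq_eq add.commute)
      qed
      then show ?thesis using a'x by (auto simp: image_iff)
    qed
    ultimately show "hom_induced n X (- {x}) X (- {x}) a' \<in> iso HX HX"
      unfolding HX_def by (intro homeomorphic_map_relative_homology_iso) (auto simp: X_def)
  qed blast
  have iG_iso: "iG \<in> iso HG HX"
  proof -
    have "X closure_of (- G) \<subseteq> X interior_of (- {x})"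
      using G by (simp add: X_def closure_complement interior_complement interior_open)
    then show ?thesis
      using homology_excision_axiom[of X "- G" "- {x}" UNIV n] unfolding iG_def HG_def HX_def X_def
      by (simp add: Diff_eq Int_commute)
  qed
  have B_iso: "hom_induced n (top_of_set B) (B - {x}) (top_of_set G) (G - {x}) id
       \<in> iso (relative_homology_group n (top_of_set B) (B - {x})) HG"
  proof -
    have BG: "B \<subseteq> G" "x \<in> B" using \<delta> by (auto simp: B_def)
    have "closedin (top_of_set G) (G - B)"
      by (simp add: B_def open_subset BG(1)[unfolded B_def] closedin_diff)
    then have cl: "top_of_set G closure_of (G - B) = G - B"
      by (simp add: closure_of_closedin)
    have "openin (top_of_set G) (G - {x})"
      using G by (simp add: open_delete open_subset)
    then have int: "top_of_set G interior_of (G - {x}) = G - {x}"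
      by (simp add: interior_of_openin)
    have "G - (G - B) = B" "G - {x} - (G - B) = B - {x}"
      using BG by auto
    then show ?thesis
      using homology_excision_axiom[of "top_of_set G" "G - B" "G - {x}" G n] BG
      unfolding cl int HG_def by (auto simp: subtopology_subtopology Int_absorb1)
  qed
  have fG_eq: "fG e = hom_induced n X (- {x}) X (- {y}) a (iG e)" if e: "e \<in> carrier HG" for e
  proof -
    have BG: "B \<subseteq> G" "x \<in> B" using \<delta> by (auto simp: B_def)
    obtain e' where e': "e' \<in> carrier (relative_homology_group n (top_of_set B) (B - {x}))"
      and ee': "e = hom_induced n (top_of_set B) (B - {x}) (top_of_set G) (G - {x}) id e'"
      using B_iso e by (auto simp: iso_def bij_betw_def)
    have cBG: "continuous_map (top_of_set B) (top_of_set G) id"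
      using BG by auto
    have "fG e = hom_induced n (top_of_set B) (B - {x}) X (- {y}) (f \<circ> id) e'"
      unfolding fG_def ee'
      by (rule hom_induced_compose'[OF cBG]) (use BG fy contf in \<open>auto simp: X_def\<close>)
    also have "\<dots> = hom_induced n (top_of_set B) (B - {x}) X (- {y}) a e'"
    proof -
      have "homotopic_with (\<lambda>h. h \<in> (B - {x}) \<rightarrow> - {y}) (top_of_set B) euclidean f a"
      proof (rule homotopic_with_linear_pair)
        show "continuous_on B f" using contf BG continuous_on_subset by blast
        fix z and u :: real assume z: "z \<in> B - {x}" and u: "0 \<le> u" "u \<le> 1"
        have "(1 - u) *\<^sub>R f z + u *\<^sub>R a z - y = A (z - x) + (1 - u) *\<^sub>R (f z - y - A (z - x))"
          by (simp add: a_def algebra_simps)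
        moreover have "norm (A (z - x) + (1 - u) *\<^sub>R (f z - y - A (z - x))) > 0"
        proof -
          have "norm ((1 - u) *\<^sub>R (f z - y - A (z - x))) \<le> norm (f z - y - A (z - x))"
            using u by (simp add: mult_left_le_one_le)
          also have "\<dots> \<le> l / 2 * norm (z - x)"
            using app z by (auto simp: B_def)
          also have "\<dots> < l * norm (z - x)"
            using l(1) z by auto
          also have "\<dots> \<le> norm (A (z - x))" by (rule l(2))
          finally show ?thesis
            using norm_diff_ineq[of "A (z - x)" "(1 - u) *\<^sub>R (f z - y - A (z - x))"] by linarith
        qed
        ultimately show "(1 - u) *\<^sub>R f z + u *\<^sub>R a z \<in> - {y}" by auto
      qed (rule conta)
      then show ?thesis unfolding X_def by (simp add: homology_homotopy_axiom)
    qed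
    also have "\<dots> = hom_induced n (top_of_set B) (B - {x}) X (- {y}) (a \<circ> id) e'" by simp
    also have "\<dots> = hom_induced n X (- {x}) X (- {y}) a (hom_induced n (top_of_set B) (B - {x}) X (- {x}) id e')"
      by (rule hom_induced_compose'[symmetric]) (use ay conta(1)[of UNIV] in \<open>auto simp: X_def\<close>)
    also have "hom_induced n (top_of_set B) (B - {x}) X (- {x}) id e' = iG e"
    proof -
      have "id \<in> B - {x} \<rightarrow> G - {x}" using BG by (simp only: Pi_iff id_apply) blast
      then show ?thesis
        unfolding iG_def ee' using hom_induced_compose'[OF cBG, of "B - {x}" "G - {x}" X id "- {x}" n e']
        by (simp add: X_def Pi_iff)
    qed
    finally show ?thesis .
  qed
  have iY_iso: "iY r \<in> iso (HB r) HY" if "y \<in> cball 0 r" for r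
    unfolding iY_def HB_def HY_def X_def by (rule hom_induced_compl_cball_iso[OF that])
  have iX_iso: "iX r \<in> iso (HB r) HX" if "x \<in> cball 0 r" for r
    unfolding iX_def HB_def HX_def X_def by (rule hom_induced_compl_cball_iso[OF that])
  \<comment> \<open>The affine approximation \<open>a\<close> of \<open>f\<close> is the translation \<open>\<tau>\<close> after the homeomorphism \<open>a'\<close> fixing \<open>x\<close>. The latter
    acts on the infinite cyclic group \<open>H\<^sub>n(\<real>\<^sup>n, \<real>\<^sup>n - x)\<close> as multiplication by \<open>d = \<plusminus>1\<close>, and \<open>\<tau>\<close> is homotopic to
    the identity off every ball containing \<open>x\<close> and \<open>y\<close>.\<close>
  have key: "fG e = iY r c [^]\<^bsub>HY\<^esub> d"
    if r: "{x, y} \<subseteq> cball 0 r" and c: "c \<in> carrier (HB r)" and e: "e \<in> carrier HG" and ec: "iG e = iX r c" for r c e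
  proof -
    have iXc: "iX r c \<in> carrier HX"
      by (simp add: iX_def HX_def hom_induced_carrier)
    have \<tau>x: "\<tau> \<in> - {x} \<rightarrow> - {y}" by (auto simp: \<tau>_def)
    have a'm: "a' \<in> - {x} \<rightarrow> - {x}" using a'x by auto
    have cm: "continuous_map X X a'" "continuous_map X X \<tau>"
      using conta(2,3)[of UNIV] by (auto simp: X_def)
    have "fG e = hom_induced n X (- {x}) X (- {y}) a (iX r c)"
      using fG_eq[OF e] ec by simp
    also have "\<dots> = hom_induced n X (- {x}) X (- {y}) \<tau> (hom_induced n X (- {x}) X (- {x}) a' (iX r c))"
      unfolding a_eq by (rule hom_induced_compose'[OF cm(1) a'm cm(2) \<tau>x, symmetric])
    also have "\<dots> = hom_induced n X (- {x}) X (- {y}) \<tau> (iX r c [^]\<^bsub>HX\<^esub> d)"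
      using d[OF iXc] by simp
    also have "\<dots> = hom_induced n X (- {x}) X (- {y}) \<tau> (iX r c) [^]\<^bsub>HY\<^esub> d"
      using hom_induced_hom grp iXc unfolding HX_def HY_def by (intro hom_int_pow) auto
    also have "hom_induced n X (- {x}) X (- {y}) \<tau> (iX r c) = hom_induced n X (- cball 0 r) X (- {y}) (\<tau> \<circ> id) c"
      unfolding iX_def by (rule hom_induced_compose') (use r cm \<tau>x in \<open>auto simp: X_def\<close>)
    also have "\<dots> = iY r c"
    proof -
      have "homotopic_with (\<lambda>h. h \<in> (- cball 0 r) \<rightarrow> - {y}) (top_of_set UNIV) euclidean (\<tau> \<circ> id) id"
      proof (rule homotopic_with_linear_pair)
        fix z :: "real ^ 'n" and u :: real assume z: "z \<in> - cball 0 r" and u: "0 \<le> u" "u \<le> 1"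
        show "(1 - u) *\<^sub>R (\<tau> \<circ> id) z + u *\<^sub>R id z \<in> - {y}"
        proof
          assume "(1 - u) *\<^sub>R (\<tau> \<circ> id) z + u *\<^sub>R id z \<in> {y}"
          then have "z = (1 - u) *\<^sub>R x + u *\<^sub>R y"
            by (simp add: \<tau>_def algebra_simps)
          moreover have "(1 - u) *\<^sub>R x + u *\<^sub>R y \<in> cball 0 r"
            by (rule convexD[OF convex_cball]) (use r u in auto)
          ultimately show False using z by simp
        qed
      qed (use conta(3) in \<open>auto intro: continuous_intros\<close>)
      then show ?thesis unfolding iY_def X_def
        using homology_homotopy_axiom[of "- cball 0 r" "- {y}" "euclidean :: (real^'n) topology" euclidean "\<tau> \<circ> id" id n] by simp
    qed
    finally show ?thesis .
  qed
  have fib': "{z \<in> G. f z = f x} \<union> {f x} = {x, y}" by (simp add: fib y_def insert_commute)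
  have "topological_index (f x) f G =
      (THE d. \<forall>r. {x, y} \<subseteq> cball 0 r \<longrightarrow> (\<forall>c \<in> carrier (HB r). \<forall>e \<in> carrier HG.
         iG e = iX r c \<longrightarrow> fG e = iY r c [^]\<^bsub>HY\<^esub> d))"
    unfolding topological_index_def Let_def fib' unfolding fib
    unfolding HB_def HG_def iG_def iX_def fG_def iY_def HY_def X_def n_def y_def ..
  also have "\<dots> = d"
  proof (rule the_equality)
    \<comment> \<open>For uniqueness a single radius and a single class with nontrivial restriction
      at \<open>y\<close> suffice.\<close>
    fix d' :: int
    assume *: "\<forall>r. {x, y} \<subseteq> cball 0 r \<longrightarrow> (\<forall>c \<in> carrier (HB r). \<forall>e \<in> carrier HG.
         iG e = iX r c \<longrightarrow> fG e = iY r c [^]\<^bsub>HY\<^esub> d')"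
    define r where "r = max (norm x) (norm y)"
    have r: "{x, y} \<subseteq> cball 0 r" by (auto simp: r_def)
    have "\<not> trivial_group HY"
      using cyc(2) grp(2) isomorphic_group_triviality nontrivial_integer_group group_integer_group by blast
    then obtain w where w: "w \<in> carrier HY" "w \<noteq> \<one>\<^bsub>HY\<^esub>"
      using grp(2) group.trivial_group_subset[of HY] by blast
    have "iY r ` carrier (HB r) = carrier HY"
      using iY_iso[of r] r by (auto simp: iso_def bij_betw_def)
    then have "w \<in> iY r ` carrier (HB r)" using w(1) by (simp only:)
    then obtain c where c: "c \<in> carrier (HB r)" "iY r c = w" by (elim imageE) simp
    have "iX r c \<in> carrier HX"
      by (simp add: iX_def HX_def hom_induced_carrier)
    moreover have "iG ` carrier HG = carrier HX"
      using iG_iso by (auto simp: iso_def bij_betw_def)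
    ultimately have "iX r c \<in> iG ` carrier HG" by (simp only:)
    then obtain e where e: "e \<in> carrier HG" "iG e = iX r c" by (elim imageE) simp
    have "w [^]\<^bsub>HY\<^esub> d' = w [^]\<^bsub>HY\<^esub> d"
      using * key[OF r c(1) e] r c e by metis
    then show "d' = d"
      using int_pow_inj_infinite_cyclic[OF grp(2) cyc(2) w] by blast
  qed (use key in blast)
  finally show ?thesis using d1 by simp
qed

text \<open>Discreteness of the fibre supplies a ball that qualifies for the \<open>SOME\<close> in
  \<open>local_index\<close>; hence the domain actually chosen qualifies too and its degree is 1 or
  -1.\<close>

lemma local_index_differentiable_le_1:
  fixes f :: "real ^ 'n \<Rightarrow> real ^ 'n::finite"
  assumes D: "open D" "x \<in> D" and contf: "continuous_on D f" and disc: "discrete {z \<in> D. f z = f x}"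
    and der: "(f has_derivative A) (at x)" and inj: "inj A"
  shows "local_index D f x \<le> 1"
proof -
  define P where "P G \<longleftrightarrow> compact_subdomain D G \<and> x \<in> G \<and> {z \<in> closure G. f z = f x} = {x}" for G
  have "x isolated_in {z \<in> D. f z = f x}"
    using disc D by (simp add: discrete_def)
  then obtain e where e: "e > 0" "ball x e \<inter> {z \<in> D. f z = f x} = {x}"
    using D unfolding isolated_in_dist_Ex_iff by fastforce
  obtain e' where e': "e' > 0" "cball x e' \<subseteq> D"
    using D open_contains_cball by blast
  define r where "r = min (e / 2) e'"
  have r: "0 < r" "r < e" "cball x r \<subseteq> D"
    using e e' by (auto simp: r_def)
  have "{z \<in> cball x r. f z = f x} = {x}"
  proof -
    have "z \<in> ball x e \<inter> {z \<in> D. f z = f x}" if "z \<in> cball x r" "f z = f x" for z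
      using that r by auto
    then show ?thesis using e(2) r(1) by auto
  qed
  then have "P (ball x r)"
    unfolding P_def compact_subdomain_def using r by simp
  then have "P (SOME G. P G)" by (rule someI)
  then have G: "compact_subdomain D (SOME G. P G)" "x \<in> (SOME G. P G)" "{z \<in> closure (SOME G. P G). f z = f x} = {x}"
    by (simp_all add: P_def)
  then have "\<bar>topological_index (f x) f (SOME G. P G)\<bar> = 1"
    using closure_subset[of "SOME G. P G"]
    by (intro topological_index_differentiable[OF _ _ _ _ der inj] continuous_on_subset[OF contf])
       (auto simp: compact_subdomain_def)
  then show ?thesis by (simp add: local_index_def P_def)
qed

section \<open>Hausdorff measure\<close>

lemma dist_le_ediameter: "x \<in> E \<Longrightarrow> y \<in> E \<Longrightarrow> ennreal (dist x y) \<le> ediameter E"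
  unfolding ediameter_def by (rule SUP_upper2, assumption) (rule SUP_upper)

lemma ediameter_le: "(\<And>x y. x \<in> E \<Longrightarrow> y \<in> E \<Longrightarrow> ennreal (dist x y) \<le> d) \<Longrightarrow> ediameter E \<le> d"
  unfolding ediameter_def by (intro SUP_least)

lemma hausdorff_premeasure_antimono:
  assumes "\<delta> \<le> \<epsilon>"
  shows "hausdorff_premeasure k \<epsilon> A \<le> hausdorff_premeasure k \<delta> A"
  unfolding hausdorff_premeasure_def
  by (rule INF_superset_mono) (use assms in \<open>auto intro: order_trans ennreal_leI\<close>)

text \<open>A covering set of diameter at most \<open>\<delta> < d\<close> cannot meet both
  \<open>A\<close> and \<open>B\<close>, so a cover of the union splits into a cover of
  \<open>A\<close> and a cover of \<open>B\<close> without common members.\<close>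

lemma hausdorff_premeasure_separated:
  fixes A B :: "'a::metric_space set"
  assumes k: "0 < k" and sep: "\<And>a b. a \<in> A \<Longrightarrow> b \<in> B \<Longrightarrow> d \<le> dist a b" and \<delta>: "\<delta> < d" "0 < d"
  shows "hausdorff_premeasure k \<delta> A + hausdorff_premeasure k \<delta> B \<le> hausdorff_premeasure k \<delta> (A \<union> B)"
  unfolding hausdorff_premeasure_def[of k \<delta> "A \<union> B"]
proof (rule INF_greatest)
  fix E :: "nat \<Rightarrow> 'a set"
  assume "E \<in> {E. A \<union> B \<subseteq> (\<Union>i. E i) \<and> (\<forall>i. ediameter (E i) \<le> ennreal \<delta>)}"
  then have E: "A \<union> B \<subseteq> (\<Union>i. E i)" "\<And>i. ediameter (E i) \<le> ennreal \<delta>" by auto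
  define c where "c E = ennreal (unit_ball_vol (real k) / 2 ^ k) * ediameter E ^ k" for E :: "'a set"
  define F where "F C i = (if E i \<inter> C = {} then {} else E i)" for C i
  have c0: "c {} = 0" using k by (simp add: c_def power_0_left)
  have le: "hausdorff_premeasure k \<delta> C \<le> suminf (\<lambda>i. c (F C i))" if "C \<subseteq> A \<union> B" for C
  proof -
    have "C \<subseteq> (\<Union>i. F C i)"
    proof
      fix x assume "x \<in> C"
      then obtain i where "x \<in> E i" using E(1) \<open>C \<subseteq> A \<union> B\<close> by blast
      then have "x \<in> F C i" using \<open>x \<in> C\<close> by (auto simp: F_def)
      then show "x \<in> (\<Union>i. F C i)" by blast
    qed
    then show ?thesis
      unfolding hausdorff_premeasure_def c_def
      by (intro INF_lower) (use E in \<open>auto simp: F_def\<close>)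
  qed
  have "hausdorff_premeasure k \<delta> A + hausdorff_premeasure k \<delta> B \<le> suminf (\<lambda>i. c (F A i)) + suminf (\<lambda>i. c (F B i))"
    by (intro add_mono le) auto
  also have "\<dots> = suminf (\<lambda>i. c (F A i) + c (F B i))"
    by (rule suminf_add) auto
  also have "\<dots> \<le> suminf (\<lambda>i. c (E i))"
  proof (rule suminf_le)
    fix i
    have "E i \<inter> A = {} \<or> E i \<inter> B = {}"
    proof (rule ccontr)
      assume "\<not> (E i \<inter> A = {} \<or> E i \<inter> B = {})"
      then obtain a b where ab: "a \<in> E i" "a \<in> A" "b \<in> E i" "b \<in> B" by blast
      have "ennreal d \<le> ennreal (dist a b)" using sep ab by (intro ennreal_leI) auto
      also have "\<dots> \<le> ennreal \<delta>" using dist_le_ediameter[OF ab(1,3)] E(2)[of i] by (rule order_trans)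
      finally show False using \<delta> by (simp add: ennreal_le_iff2)
    qed
    then show "c (F A i) + c (F B i) \<le> c (E i)" by (auto simp: F_def c0)
  qed auto
  finally show "hausdorff_premeasure k \<delta> A + hausdorff_premeasure k \<delta> B
      \<le> suminf (\<lambda>i. ennreal (unit_ball_vol (real k) / 2 ^ k) * ediameter (E i) ^ k)"
    by (simp add: c_def)
qed

text \<open>Premeasures grow as \<open>\<delta>\<close> shrinks, so only scales below the separation
  matter, and a directed supremum commutes with the sum.\<close>

lemma hausdorff_outer_measure_separated:
  fixes A B :: "'a::metric_space set"
  assumes k: "0 < k" and d: "0 < d" and sep: "\<And>a b. a \<in> A \<Longrightarrow> b \<in> B \<Longrightarrow> d \<le> dist a b"
  shows "hausdorff_outer_measure k A + hausdorff_outer_measure k B \<le> hausdorff_outer_measure k (A \<union> B)"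
proof -
  let ?h = "hausdorff_premeasure k"
  have *: "\<exists>\<epsilon>\<in>{0<..}. ?h \<delta>1 A + ?h \<delta>2 B \<le> ?h \<epsilon> A + ?h \<epsilon> B \<and> \<epsilon> < d" if "\<delta>1 \<in> {0<..}" "\<delta>2 \<in> {0<..}" for \<delta>1 \<delta>2
    by (rule bexI[of _ "min (min \<delta>1 \<delta>2) (d / 2)"])
       (use that d in \<open>auto intro!: add_mono hausdorff_premeasure_antimono\<close>)
  have "hausdorff_outer_measure k A + hausdorff_outer_measure k B = (SUP \<delta>\<in>{0<..}. ?h \<delta> A + ?h \<delta> B)"
    unfolding hausdorff_outer_measure_def
    by (rule SUP_add_directed_ennreal[symmetric]) (use * in blast)
  also have "\<dots> \<le> hausdorff_outer_measure k (A \<union> B)"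
  proof (rule SUP_least)
    fix \<delta> :: real assume "\<delta> \<in> {0<..}"
    then obtain \<epsilon> where \<epsilon>: "\<epsilon> \<in> {0<..}" "?h \<delta> A + ?h \<delta> B \<le> ?h \<epsilon> A + ?h \<epsilon> B" "\<epsilon> < d" using * by blast
    have "?h \<epsilon> A + ?h \<epsilon> B \<le> ?h \<epsilon> (A \<union> B)"
      by (rule hausdorff_premeasure_separated[OF k sep \<epsilon>(3) d])
    also have "\<dots> \<le> hausdorff_outer_measure k (A \<union> B)"
      unfolding hausdorff_outer_measure_def by (rule SUP_upper[OF \<epsilon>(1)])
    finally show "?h \<delta> A + ?h \<delta> B \<le> hausdorff_outer_measure k (A \<union> B)" using \<epsilon>(2) by simp
  qed
  finally show ?thesis .
qed

text \<open>Makes Borel functions measurable for \<open>hausdorff_measure\<close>, whose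
  sigma-algebra is given only through Caratheodory's condition. The hypothesis \<open>sep\<close>
  says that the outer measure is a metric one.\<close>

lemma metric_outer_measure_closed_measurable:
  fixes \<mu> :: "'a::metric_space set \<Rightarrow> ennreal"
  assumes om: "outer_measure_space UNIV \<mu>"
    and sep: "\<And>A B d. \<lbrakk>0 < d; \<And>a b. a \<in> A \<Longrightarrow> b \<in> B \<Longrightarrow> d \<le> dist a b\<rbrakk> \<Longrightarrow> \<mu> A + \<mu> B \<le> \<mu> (A \<union> B)"
    and F: "closed F"
  shows "F \<in> lambda_system UNIV UNIV \<mu>"
proof -
  have mono: "\<mu> A \<le> \<mu> B" if "A \<subseteq> B" for A B
    using om that by (auto simp: outer_measure_space_def increasing_def)
  \<comment> \<open>\<open>countably_subadditive\<close> speaks of disjoint families only, hence the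
    passage through \<open>disjointed\<close>.\<close>
  have sub: "\<mu> (\<Union>i. A i) \<le> suminf (\<lambda>i. \<mu> (A i))" for A :: "nat \<Rightarrow> 'a set"
  proof -
    have "\<mu> (\<Union>i. disjointed A i) \<le> suminf (\<lambda>i. \<mu> (disjointed A i))"
      using om disjoint_family_disjointed[of A] by (auto simp: outer_measure_space_def countably_subadditive_def)
    also have "\<dots> \<le> suminf (\<lambda>i. \<mu> (A i))"
      by (intro suminf_le mono disjointed_subset) auto
    finally show ?thesis by (simp add: UN_disjointed_eq)
  qed
  have emp: "\<mu> {} = 0" using om by (auto simp: outer_measure_space_def positive_def)
  have sub2: "\<mu> (A \<union> B) \<le> \<mu> A + \<mu> B" for A B
    using sub[of "binaryset A B"] suminf_binaryset_eq[of \<mu> A B, OF emp]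
    by (simp add: UN_binaryset_eq)
  have split: "\<mu> (T \<inter> F) + \<mu> (T - F) \<le> \<mu> T" for T
  proof (cases "F = {} \<or> \<mu> T = \<infinity>")
    case True
    then show ?thesis using emp by auto
  next
    case False
    then have Fne: "F \<noteq> {}" and fin: "\<mu> T \<noteq> \<infinity>" by auto
    define g where "g x = infdist x F" for x
    have g_lip: "g x \<le> g y + dist x y" for x y
      unfolding g_def by (rule infdist_triangle)
    have g_dist: "g x \<le> dist x y" if "y \<in> F" for x y
      unfolding g_def by (rule infdist_le[OF that])
    have g_pos: "g x > 0" if "x \<notin> F" for x
      unfolding g_def using F Fne that by (metis in_closed_iff_infdist_zero infdist_nonneg order_less_le)
    \<comment> \<open>Caratheodory's criterion: the shells \<open>R n\<close> with \<open>n\<close> of equal parity are at positive distance, so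
      \<open>\<mu>\<close> is summable on them and \<open>\<mu> (Tn n)\<close> increases to \<open>\<mu> (T - F)\<close>.\<close>
    define Tn where "Tn n = {x \<in> T. inverse (real (Suc n)) \<le> g x}" for n
    define R where "R n = {x \<in> T. inverse (real (Suc (Suc n))) \<le> g x \<and> g x < inverse (real (Suc n))}" for n
    have ne: "\<exists>n. inverse (real (Suc n)) \<le> g x" if "x \<notin> F" for x
      using g_pos[OF that] by (metis less_imp_le reals_Archimedean)
    have inv_mono: "inverse (real (Suc n)) \<le> inverse (real (Suc m))" if "m \<le> n" for m n
      using that by (simp add: field_simps)
    have sepR: "inverse (real (Suc (Suc m))) - inverse (real (Suc n)) \<le> dist x y"
      if "m < n" "x \<in> R m" "y \<in> R n" for m n x y
      using that g_lip[of x y] by (auto simp: R_def)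
    have partial: "(\<Sum>i<N. \<mu> (R (2 * i + b))) \<le> \<mu> (\<Union>i<N. R (2 * i + b))" for N b
    proof (induction N)
      case (Suc N)
      \<comment> \<open>If \<open>2 * N + b = 0\<close> there is no earlier shell, and any positive
        value serves.\<close>
      define d where "d = (if 2 * N + b = 0 then 1 else inverse (real (2 * N + b)) - inverse (real (Suc (2 * N + b))))"
      have "(\<Sum>i<Suc N. \<mu> (R (2 * i + b))) \<le> \<mu> (\<Union>i<N. R (2 * i + b)) + \<mu> (R (2 * N + b))"
        using Suc by (simp add: add_right_mono)
      also have "\<dots> \<le> \<mu> ((\<Union>i<N. R (2 * i + b)) \<union> R (2 * N + b))"
      proof (rule sep[where d = d])
        show "0 < d" by (auto simp: d_def field_simps)
        fix x y assume "x \<in> (\<Union>i<N. R (2 * i + b))" and y: "y \<in> R (2 * N + b)"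
        then obtain i where i: "i < N" "x \<in> R (2 * i + b)" by auto
        then have "inverse (real (Suc (Suc (2 * i + b)))) - inverse (real (Suc (2 * N + b))) \<le> dist x y"
          by (intro sepR y) auto
        moreover have "inverse (real (2 * N + b)) \<le> inverse (real (Suc (Suc (2 * i + b))))"
          using i by (simp add: field_simps)
        moreover have "d = inverse (real (2 * N + b)) - inverse (real (Suc (2 * N + b)))"
          using i by (auto simp: d_def)
        ultimately show "d \<le> dist x y" by linarith
      qed
      also have "(\<Union>i<N. R (2 * i + b)) \<union> R (2 * N + b) = (\<Union>i<Suc N. R (2 * i + b))"
        by (auto simp: lessThan_Suc)
      finally show ?case .
    qed (simp add: emp)
    have half: "suminf (\<lambda>i. \<mu> (R (2 * i + b))) \<le> \<mu> T" for b
    proof (rule suminf_le_const)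
      fix N
      show "(\<Sum>i<N. \<mu> (R (2 * i + b))) \<le> \<mu> T"
        using partial[where N=N and b=b] mono[of "\<Union>i<N. R (2 * i + b)" T] by (fastforce simp: R_def intro: order_trans)
    qed auto
    have part: "(\<Sum>i<n. \<mu> (R i)) \<le> \<mu> T + \<mu> T" for n
    proof -
      have "(\<Sum>i<n. \<mu> (R i)) \<le> (\<Sum>i<2 * n. \<mu> (R i))"
        by (rule sum_mono2) auto
      also have "\<dots> = (\<Sum>i<n. \<mu> (R (2 * i + 0))) + (\<Sum>i<n. \<mu> (R (2 * i + 1)))"
        by (induction n) (auto simp: algebra_simps)
      also have "\<dots> \<le> suminf (\<lambda>i. \<mu> (R (2 * i + 0))) + suminf (\<lambda>i. \<mu> (R (2 * i + 1)))"
        by (intro add_mono sum_le_suminf) auto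
      also have "\<dots> \<le> \<mu> T + \<mu> T" by (intro add_mono half)
      finally show ?thesis .
    qed
    define S where "S = suminf (\<lambda>i. \<mu> (R i))"
    have "S \<le> \<mu> T + \<mu> T" unfolding S_def by (rule suminf_le_const) (auto simp: part)
    then have Sfin: "S \<noteq> \<infinity>" using fin by (metis ennreal_add_eq_top infinity_ennreal_def top.extremum_unique)
    define M where "M = (SUP n. \<mu> (Tn n))"
    \<comment> \<open>The tail of the series is estimated without subtraction: adding the first
      \<open>n\<close> terms on both sides completes it to \<open>S\<close>, and finiteness of
      \<open>S\<close> permits cancellation after the limit.\<close>
    have "\<mu> (T - F) + (\<Sum>i<n. \<mu> (R i)) \<le> M + S" for n
    proof -
      have "T - F \<subseteq> Tn n \<union> (\<Union>i. R (i + n))"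
      proof
        fix x assume x: "x \<in> T - F"
        show "x \<in> Tn n \<union> (\<Union>i. R (i + n))"
        proof (cases "x \<in> Tn n")
          case False
          define m where "m = (LEAST m. inverse (real (Suc m)) \<le> g x)"
          have m: "inverse (real (Suc m)) \<le> g x"
            unfolding m_def using LeastI_ex[OF ne, of x] x by simp
          have "n < m"
          proof (rule ccontr)
            assume "\<not> n < m"
            then have "inverse (real (Suc n)) \<le> g x" using m inv_mono[of m n] by linarith
            then show False using False x by (simp add: Tn_def)
          qed
          then obtain i where i: "m = Suc (i + n)" by (metis add.commute add_Suc_right less_imp_Suc_add)
          have "\<not> inverse (real (Suc (i + n))) \<le> g x"
            using not_less_Least[of "i + n" "\<lambda>m. inverse (real (Suc m)) \<le> g x"] i by (simp add: m_def)
          then have "x \<in> R (i + n)" using m i x by (auto simp: R_def)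
          then show ?thesis by blast
        qed auto
      qed
      then have "\<mu> (T - F) \<le> \<mu> (Tn n) + suminf (\<lambda>i. \<mu> (R (i + n)))"
        using mono sub2 sub[of "\<lambda>i. R (i + n)"] by (meson add_left_mono order_trans)
      also have "\<mu> (Tn n) \<le> M" unfolding M_def by (rule SUP_upper) simp
      finally have "\<mu> (T - F) + (\<Sum>i<n. \<mu> (R i)) \<le> M + (suminf (\<lambda>i. \<mu> (R (i + n))) + (\<Sum>i<n. \<mu> (R i)))"
        by (metis add.assoc add_right_mono)
      also have "suminf (\<lambda>i. \<mu> (R (i + n))) + (\<Sum>i<n. \<mu> (R i)) = S"
        unfolding S_def by (rule suminf_offset[symmetric]) auto
      finally show ?thesis .
    qed
    then have "\<mu> (T - F) + S \<le> M + S"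
      unfolding S_def suminf_eq_SUP by (subst ennreal_SUP_add_right) (auto intro: SUP_least)
    then have le: "\<mu> (T - F) \<le> M"
      using Sfin by (metis add.commute ennreal_add_left_cancel_le infinity_ennreal_def)
    have "\<mu> (T \<inter> F) + \<mu> (Tn n) \<le> \<mu> T" for n
    proof -
      have "\<mu> (T \<inter> F) + \<mu> (Tn n) \<le> \<mu> (T \<inter> F \<union> Tn n)"
      proof (rule sep)
        show "0 < inverse (real (Suc n))" by simp
        show "inverse (real (Suc n)) \<le> dist a b" if "a \<in> T \<inter> F" "b \<in> Tn n" for a b
          using that g_dist[of a b] by (auto simp: Tn_def dist_commute)
      qed
      also have "\<dots> \<le> \<mu> T" by (rule mono) (auto simp: Tn_def)
      finally show ?thesis .
    qed
    then have "\<mu> (T \<inter> F) + M \<le> \<mu> T"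
      unfolding M_def by (subst ennreal_SUP_add_right) (auto intro: SUP_least)
    then show ?thesis using le by (meson add_left_mono order_trans)
  qed
  have "\<mu> (F \<inter> T) + \<mu> ((UNIV - F) \<inter> T) = \<mu> T" for T
    using split[of T] sub2[of "T \<inter> F" "T - F"] 
    by (metis Int_Diff Int_UNIV_right Int_commute Un_Diff_Int antisym sup_commute)
  then show ?thesis by (simp add: lambda_system_def)
qed

lemma sets_borel_subset_hausdorff_measure:
  assumes k: "0 < k"
  shows "sets (borel :: 'a::metric_space measure) \<subseteq> sets (hausdorff_measure k)"
proof -
  have "{F :: 'a set. closed F} \<subseteq> sets (hausdorff_measure k)"
    unfolding sets_hausdorff_measure[OF k]
    by (auto intro!: metric_outer_measure_closed_measurable outer_measure_space_hausdorff k
        elim: hausdorff_outer_measure_separated[OF k])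
  moreover have "space (hausdorff_measure k :: 'a measure) = UNIV"
    by (simp add: hausdorff_measure_def)
  ultimately show ?thesis
    using sets.sigma_sets_subset[of "{F :: 'a set. closed F}" "hausdorff_measure k"]
    by (simp add: borel_eq_closed)
qed

text \<open>A cover of the image pulls back to a cover of \<open>A\<close> whose members have
  diameters at most \<open>1 / c\<close> times as large.\<close>

lemma hausdorff_outer_measure_expanding:
  fixes f :: "'a::metric_space \<Rightarrow> 'b::metric_space"
  assumes c: "0 < c" and ex: "\<And>x y. x \<in> A \<Longrightarrow> y \<in> A \<Longrightarrow> c * dist x y \<le> dist (f x) (f y)"
  shows "ennreal (c ^ k) * hausdorff_outer_measure k A \<le> hausdorff_outer_measure k (f ` A)"
proof -
  have pre: "ennreal (c ^ k) * hausdorff_premeasure k \<delta> A \<le> hausdorff_premeasure k (c * \<delta>) (f ` A)" for \<delta>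
    unfolding hausdorff_premeasure_def[of k "c * \<delta>"]
  proof (rule INF_greatest)
    fix E :: "nat \<Rightarrow> 'b set"
    assume "E \<in> {E. f ` A \<subseteq> (\<Union>i. E i) \<and> (\<forall>i. ediameter (E i) \<le> ennreal (c * \<delta>))}"
    then have E: "f ` A \<subseteq> (\<Union>i. E i)" "\<And>i. ediameter (E i) \<le> ennreal (c * \<delta>)" by auto
    define F where "F i = A \<inter> f -` E i" for i
    have F: "ediameter (F i) \<le> ennreal (1 / c) * ediameter (E i)" for i
    proof (rule ediameter_le)
      fix x y assume xy: "x \<in> F i" "y \<in> F i"
      have "dist x y \<le> (1 / c) * dist (f x) (f y)"
        using ex[of x y] xy c by (simp add: F_def field_simps)
      then have "ennreal (dist x y) \<le> ennreal (1 / c) * ennreal (dist (f x) (f y))"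
        using c by (simp add: ennreal_leI flip: ennreal_mult)
      also have "\<dots> \<le> ennreal (1 / c) * ediameter (E i)"
        by (intro mult_left_mono dist_le_ediameter) (use xy in \<open>auto simp: F_def\<close>)
      finally show "ennreal (dist x y) \<le> ennreal (1 / c) * ediameter (E i)" .
    qed
    have cF: "ennreal (c ^ k) * ediameter (F i) ^ k \<le> ediameter (E i) ^ k" for i
    proof -
      have "ennreal (c ^ k) * ediameter (F i) ^ k \<le> ennreal (c ^ k) * (ennreal (1 / c) * ediameter (E i)) ^ k"
        by (intro mult_left_mono power_mono F) auto
      also have "\<dots> = ediameter (E i) ^ k"
      proof -
        have "ennreal (c ^ k) * ennreal (1 / c) ^ k = 1"
          using c by (simp add: ennreal_power power_one_over flip: ennreal_mult)
        then show ?thesis by (simp add: power_mult_distrib flip: mult.assoc)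
      qed
      finally show ?thesis .
    qed
    have "ediameter (F i) \<le> ennreal \<delta>" for i
    proof -
      have "ediameter (F i) \<le> ennreal (1 / c) * ennreal (c * \<delta>)"
        using F[of i] E(2)[of i] by (meson mult_left_mono order_trans zero_le)
      also have "\<dots> = ennreal \<delta>"
        using c by (cases "\<delta> \<ge> 0") (auto simp: ennreal_neg mult_le_0_iff simp flip: ennreal_mult)
      finally show ?thesis .
    qed
    moreover have "A \<subseteq> (\<Union>i. F i)" unfolding F_def using E(1) by blast
    ultimately have "hausdorff_premeasure k \<delta> A \<le> suminf (\<lambda>i. ennreal (unit_ball_vol (real k) / 2 ^ k) * ediameter (F i) ^ k)"
      unfolding hausdorff_premeasure_def by (intro INF_lower) auto
    then have "ennreal (c ^ k) * hausdorff_premeasure k \<delta> A \<le>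
        ennreal (c ^ k) * suminf (\<lambda>i. ennreal (unit_ball_vol (real k) / 2 ^ k) * ediameter (F i) ^ k)"
      by (intro mult_left_mono) auto
    also have "\<dots> = suminf (\<lambda>i. ennreal (unit_ball_vol (real k) / 2 ^ k) * (ennreal (c ^ k) * ediameter (F i) ^ k))"
      by (subst ennreal_suminf_cmult[symmetric]) (simp add: mult.left_commute)
    also have "\<dots> \<le> suminf (\<lambda>i. ennreal (unit_ball_vol (real k) / 2 ^ k) * ediameter (E i) ^ k)"
      by (intro suminf_le mult_left_mono cF) auto
    finally show "ennreal (c ^ k) * hausdorff_premeasure k \<delta> A \<le>
       suminf (\<lambda>i. ennreal (unit_ball_vol (real k) / 2 ^ k) * ediameter (E i) ^ k)" .
  qed
  have "ennreal (c ^ k) * hausdorff_outer_measure k A = (SUP \<delta>\<in>{0<..}. ennreal (c ^ k) * hausdorff_premeasure k \<delta> A)"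
    unfolding hausdorff_outer_measure_def by (subst SUP_mult_left_ennreal) auto
  also have "\<dots> \<le> hausdorff_outer_measure k (f ` A)"
  proof (rule SUP_least)
    fix \<delta> :: real assume "\<delta> \<in> {0<..}"
    then show "ennreal (c ^ k) * hausdorff_premeasure k \<delta> A \<le> hausdorff_outer_measure k (f ` A)"
      unfolding hausdorff_outer_measure_def using c by (intro SUP_upper2[of "c * \<delta>"] pre) auto
  qed
  finally show ?thesis .
qed

section \<open>Multiplicity functions of surfaces\<close>

text \<open>The number of preimages of \<open>y\<close> is the supremum, over finite disjoint
  subfamilies of \<open>\<C>\<close>, of the number of members whose image contains
  \<open>y\<close>: separated preimages lie in disjoint members, and disjoint members yield distinct
  preimages. There are only countably many such subfamilies.\<close>

lemma borel_measurable_fibre_count: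
  fixes g :: "'a \<Rightarrow> 'b::topological_space"
  assumes cnt: "countable \<C>" and sub: "\<And>C. C \<in> \<C> \<Longrightarrow> C \<subseteq> \<omega>" and meas: "\<And>C. C \<in> \<C> \<Longrightarrow> g ` C \<in> sets borel"
    and sep: "\<And>Z. finite Z \<Longrightarrow> Z \<subseteq> \<omega> \<Longrightarrow> \<exists>W. (\<forall>z\<in>Z. W z \<in> \<C> \<and> z \<in> W z) \<and> disjoint_family_on W Z"
  shows "(\<lambda>y. emeasure (count_space UNIV) {z \<in> \<omega>. g z = y}) \<in> borel_measurable borel"
proof -
  define \<F> where "\<F> = {F. finite F \<and> F \<subseteq> \<C> \<and> disjoint F}"
  define s where "s F y = (\<Sum>C\<in>F. indicator (g ` C) y :: ennreal)" for F y
  have "countable \<F>"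
    by (rule countable_subset[OF _ countable_Collect_finite_subset[OF cnt]]) (auto simp: \<F>_def)
  then have "(\<lambda>y. SUP F\<in>\<F>. s F y) \<in> borel_measurable borel"
    unfolding s_def by (intro borel_measurable_SUP borel_measurable_sum borel_measurable_indicator)
      (auto simp: \<F>_def intro: meas)
  moreover have "emeasure (count_space UNIV) {z \<in> \<omega>. g z = y} = (SUP F\<in>\<F>. s F y)" for y
  proof (rule antisym)
    let ?A = "{z \<in> \<omega>. g z = y}"
    have fin: "of_nat (card Z) \<le> (SUP F\<in>\<F>. s F y)" if Z: "finite Z" "Z \<subseteq> ?A" for Z
    proof -
      obtain W where W: "\<And>z. z \<in> Z \<Longrightarrow> W z \<in> \<C>" "\<And>z. z \<in> Z \<Longrightarrow> z \<in> W z" and dis: "disjoint_family_on W Z"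
      proof -
      have "Z \<subseteq> \<omega>" using Z(2) by auto
      then show ?thesis using sep[OF Z(1)] that by blast
    qed
      have inj: "inj_on W Z"
        using dis W(2) unfolding disjoint_family_on_def inj_on_def by blast
      have "W ` Z \<in> \<F>"
        using Z(1) W(1) disjoint_family_on_disjoint_image[OF dis] by (auto simp: \<F>_def)
      moreover have "s (W ` Z) y = of_nat (card Z)"
      proof -
        have "s (W ` Z) y = (\<Sum>C\<in>W ` Z. 1)"
          unfolding s_def
        proof (rule sum.cong[OF refl])
          fix C assume "C \<in> W ` Z"
          then obtain z where "z \<in> Z" "C = W z" by auto
          then have "y \<in> g ` C" using W(2) Z(2) by blast
          then show "indicator (g ` C) y = (1::ennreal)" by simp
        qed
        then show ?thesis using inj by (simp add: card_image)
      qed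
      ultimately show ?thesis by (metis SUP_upper)
    qed
    show "emeasure (count_space UNIV) ?A \<le> (SUP F\<in>\<F>. s F y)"
    proof (cases "finite ?A")
      case True
      then show ?thesis using fin[of ?A] by simp
    next
      case False
      have "of_nat n \<le> (SUP F\<in>\<F>. s F y)" for n
        using infinite_arbitrarily_large[OF False, of n] fin by metis
      then have "(SUP n. of_nat n) \<le> (SUP F\<in>\<F>. s F y)"
        by (rule SUP_least)
      then have "(SUP F\<in>\<F>. s F y) = top_class.top"
        unfolding ennreal_SUP_of_nat_eq_top top_unique .
      then show ?thesis by (simp only: top_greatest)
    qed
    show "(SUP F\<in>\<F>. s F y) \<le> emeasure (count_space UNIV) ?A"
    proof (cases "finite ?A")
      case True
      show ?thesis
      proof (rule SUP_least)
        fix F assume F: "F \<in> \<F>"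
        define F' where "F' = {C \<in> F. y \<in> g ` C}"
        have F': "finite F'" "F' \<subseteq> F" using F by (auto simp: F'_def \<F>_def)
        have "s F y = of_nat (card F')"
          using F unfolding s_def F'_def by (simp add: \<F>_def indicator_def sum.If_cases Int_def)
        moreover have "card F' \<le> card ?A"
        proof -
          define w where "w C = (SOME z. z \<in> C \<and> g z = y)" for C
          have w: "w C \<in> C \<and> g (w C) = y" if "C \<in> F'" for C
            unfolding w_def by (rule someI_ex) (use that in \<open>auto simp: F'_def\<close>)
          have "inj_on w F'"
          proof (rule inj_onI)
            fix C C' assume *: "C \<in> F'" "C' \<in> F'" "w C = w C'"
            then have "w C \<in> C \<inter> C'" using w[of C] w[of C'] by simp
            then show "C = C'"
              using disjointD[of F C C'] F F'(2) *(1,2) by (auto simp: \<F>_def)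
          qed
          moreover have "w ` F' \<subseteq> ?A"
            using w F'(2) F sub by (fastforce simp: \<F>_def)
          ultimately show ?thesis using True by (meson card_inj_on_le)
        qed
        ultimately show "s F y \<le> emeasure (count_space UNIV) ?A"
          using True by simp
      qed
    qed simp
  qed
  ultimately show ?thesis by simp
qed

lemma surface_compact_image:
  assumes S: "surface_in A (\<omega>, g)" and K: "compact K" "Some ` K \<subseteq> \<omega>"
  shows "compact (g ` Some ` K)"
proof -
  have "continuous_map (top_of_set K) (subtopology (Alexandroff_compactification euclidean) \<omega>) Some"
    using K(2) by (auto simp: continuous_map_in_subtopology continuous_map_from_subtopology continuous_map_Some)
  then have "continuous_map (top_of_set K) euclidean (g \<circ> Some)"
    using S continuous_map_compose by (fastforce simp: surface_in_def)
  then have "compact ((g \<circ> Some) ` K)"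
    using K(1) by (intro compact_continuous_image) simp
  then show ?thesis by (simp add: image_comp)
qed

lemma surface_open_domain:
  assumes "surface_in A (\<omega>, g)"
  shows "open {v. Some v \<in> \<omega>}"
proof -
  have "openin (Alexandroff_compactification euclidean) \<omega>" using assms by (simp add: surface_in_def)
  then have "openin euclidean {v \<in> topspace euclidean. Some v \<in> \<omega>}"
    by (rule openin_continuous_map_preimage[OF continuous_map_Some])
  then show ?thesis by simp
qed

text \<open>Closed balls with centres in a countable dense set and rational radii separate finite
  points. The point at infinity gets the singleton \<open>{None}\<close>: the members need not be
  neighbourhoods, only their images must be compact.\<close>

lemma surface_separating_family:
  fixes \<omega> :: "(real ^ 'k) option set"
  assumes S: "surface_in A ((\<omega>, g) :: ('k::finite, 'n::finite) surface)"
  obtains \<C> where "countable \<C>" "\<And>C. C \<in> \<C> \<Longrightarrow> C \<subseteq> \<omega>" "\<And>C. C \<in> \<C> \<Longrightarrow> compact (g ` C)"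
    "\<And>Z. finite Z \<Longrightarrow> Z \<subseteq> \<omega> \<Longrightarrow> \<exists>W. (\<forall>z\<in>Z. W z \<in> \<C> \<and> z \<in> W z) \<and> disjoint_family_on W Z"
proof -
  obtain Q :: "(real ^ 'k) set" where Q: "countable Q" "\<And>U. open U \<Longrightarrow> U \<noteq> {} \<Longrightarrow> \<exists>q\<in>Q. q \<in> U"
    using countable_dense_setE by blast
  define \<C> where "\<C> = {C \<in> insert {None} ((\<lambda>(q, r). Some ` cball q r) ` (Q \<times> \<rat>)). C \<subseteq> \<omega>}"
  have "countable ((\<lambda>(q, r). Some ` cball q r) ` (Q \<times> \<rat>))"
    using Q(1) countable_rat by blast
  then have "countable \<C>"
    by (rule countable_subset[rotated, OF countable_insert[of _ "{None}"]]) (auto simp: \<C>_def)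
  moreover have "compact (g ` C)" if "C \<in> \<C>" for C
    using that surface_compact_image[OF S] by (auto simp: \<C>_def)
  moreover have "\<exists>W. (\<forall>z\<in>Z. W z \<in> \<C> \<and> z \<in> W z) \<and> disjoint_family_on W Z" if Z: "finite Z" "Z \<subseteq> \<omega>" for Z
  proof -
    define V where "V = {v. Some v \<in> Z}"
    have "finite V"
    proof -
      have "V \<subseteq> the ` Z" by (force simp: V_def image_iff)
      then show ?thesis using Z(1) finite_surj by blast
    qed
    then obtain d where d: "0 < d" "\<And>v w. v \<in> V \<Longrightarrow> w \<in> V \<Longrightarrow> v \<noteq> w \<Longrightarrow> d \<le> dist v w"
    proof (cases "\<exists>v\<in>V. \<exists>w\<in>V. v \<noteq> w")
      case True
      let ?D = "(\<lambda>(v, w). dist v w) ` ({(v, w) \<in> V \<times> V. v \<noteq> w})"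
      have fin: "finite ?D" using \<open>finite V\<close> by (auto intro: finite_subset[of _ "V \<times> V"])
      have ne: "?D \<noteq> {}" using True by auto
      have "0 < Min ?D" using fin ne by (subst Min_gr_iff) auto
      moreover have "Min ?D \<le> dist v w" if "v \<in> V" "w \<in> V" "v \<noteq> w" for v w
        by (rule Min_le[OF fin]) (use that in auto)
      ultimately show thesis using that by blast
    next
      case False
      then show thesis using that[of 1] by auto
    qed
    have "\<exists>C. C \<in> \<C> \<and> Some v \<in> C \<and> C \<subseteq> Some ` ball v (d / 2)" if v: "v \<in> V" for v
    proof -
      have "v \<in> {v. Some v \<in> \<omega>}" using v Z by (auto simp: V_def)
      then obtain e where e: "0 < e" "ball v e \<subseteq> {v. Some v \<in> \<omega>}"
        using surface_open_domain[OF S] openE by blast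
      \<comment> \<open>A ball of radius \<open>r\<close> whose centre is within \<open>r\<close> of
        \<open>v\<close> lies in \<open>ball v (2 * r)\<close>; so twice \<open>r\<close> has to
        stay below both \<open>d / 2\<close> and \<open>e\<close>.\<close>
      obtain r where r: "r \<in> \<rat>" "0 < r" "r < min (d / 4) (e / 2)"
        using Rats_dense_in_real[of 0 "min (d / 4) (e / 2)"] d(1) e(1) by auto
      obtain q where q: "q \<in> Q" "q \<in> ball v r"
        using Q(2)[of "ball v r"] r(2) by (metis centre_in_ball empty_iff open_ball)
      have *: "cball q r \<subseteq> ball v (2 * r)" 
      proof
        fix w assume "w \<in> cball q r"
        then show "w \<in> ball v (2 * r)" using q(2) dist_triangle[of v w q] by simp
      qed
      then have "cball q r \<subseteq> ball v e" "cball q r \<subseteq> ball v (d / 2)"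
        using r(3) by (auto dest!: subsetD)
      then have "Some ` cball q r \<in> \<C>" "Some ` cball q r \<subseteq> Some ` ball v (d / 2)"
        using e(2) q(1) r(1) by (auto simp: \<C>_def)
      moreover have "Some v \<in> Some ` cball q r" using q(2) by (auto simp: dist_commute)
      ultimately show ?thesis by blast
    qed
    then obtain B where B: "\<And>v. v \<in> V \<Longrightarrow> B v \<in> \<C> \<and> Some v \<in> B v \<and> B v \<subseteq> Some ` ball v (d / 2)"
      by metis
    define W where "W z = (case z of None \<Rightarrow> {None} | Some v \<Rightarrow> B v)" for z
    have "W z \<in> \<C> \<and> z \<in> W z" if "z \<in> Z" for z
      using that Z(2) B by (cases z) (auto simp: W_def \<C>_def V_def)
    moreover have "disjoint_family_on W Z"
      unfolding disjoint_family_on_def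
    proof (intro ballI impI)
      fix z z' assume z: "z \<in> Z" "z' \<in> Z" "z \<noteq> z'"
      have *: "B v \<inter> B v' = {}" if "v \<in> V" "v' \<in> V" "v \<noteq> v'" for v v'
      proof -
        have "ball v (d / 2) \<inter> ball v' (d / 2) = {}"
          using d(2)[OF that] by (intro disjoint_ballI) simp
        then have "Some ` ball v (d / 2) \<inter> Some ` ball v' (d / 2) = {}"
          by (simp add: image_Int[symmetric])
        then show ?thesis using B[OF that(1)] B[OF that(2)] by blast
      qed
      have **: "None \<notin> B v" if "v \<in> V" for v using B[OF that] by blast
      show "W z \<inter> W z' = {}"
        using z * ** by (cases z; cases z') (auto simp: W_def V_def)
    qed
    ultimately show ?thesis by blast
  qed
  moreover have "\<And>C. C \<in> \<C> \<Longrightarrow> C \<subseteq> \<omega>" by (simp add: \<C>_def)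
  ultimately show thesis using that[of \<C>] by blast
qed

lemma borel_measurable_multiplicity_fun:
  assumes S: "surface_in A (S :: ('k::finite, 'n::finite) surface)"
  shows "multiplicity_fun S \<in> borel_measurable borel"
proof -
  obtain \<omega> g where Sg: "S = (\<omega>, g)" by fastforce
  show ?thesis
  proof (rule surface_separating_family[OF S[unfolded Sg]])
    fix \<C>
    assume "countable \<C>" "\<And>C. C \<in> \<C> \<Longrightarrow> C \<subseteq> \<omega>" "\<And>C. C \<in> \<C> \<Longrightarrow> compact (g ` C)"
      "\<And>Z. finite Z \<Longrightarrow> Z \<subseteq> \<omega> \<Longrightarrow> \<exists>W. (\<forall>z\<in>Z. W z \<in> \<C> \<and> z \<in> W z) \<and> disjoint_family_on W Z"
    then show ?thesis
      using borel_measurable_fibre_count[of \<C> \<omega> g] unfolding multiplicity_fun_def Sg by (simp add: borel_compact)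
  qed
qed

lemma multiplicity_fun_eq_0_iff: "multiplicity_fun S y = 0 \<longleftrightarrow> y \<notin> snd S ` fst S"
  unfolding multiplicity_fun_def by (subst emeasure_count_space_eq_0) auto

lemma one_le_multiplicity_fun:
  assumes "y \<in> snd S ` fst S"
  shows "1 \<le> multiplicity_fun S y"
proof (cases "finite {z \<in> fst S. snd S z = y}")
  case True
  then have "card {z \<in> fst S. snd S z = y} \<noteq> 0" using assms by auto
  then have "1 \<le> card {z \<in> fst S. snd S z = y}" by simp
  then have "of_nat 1 \<le> (of_nat (card {z \<in> fst S. snd S z = y}) :: ennreal)"
    by (rule of_nat_mono)
  then show ?thesis using True by (simp add: multiplicity_fun_def)
qed (simp add: multiplicity_fun_def)

lemma surface_image_borel:
  assumes "surface_in A S"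
  shows "snd S ` fst S \<in> sets borel"
proof -
  have "multiplicity_fun S -` {0} \<inter> space borel \<in> sets borel"
    by (rule measurable_sets[OF borel_measurable_multiplicity_fun[OF assms]]) simp
  moreover have "snd S ` fst S = UNIV - (multiplicity_fun S -` {0} \<inter> space borel)"
    by (auto simp: multiplicity_fun_eq_0_iff)
  ultimately show ?thesis by (metis sets.compl_sets space_borel)
qed

text \<open>Completeness of the Caratheodory sigma-algebra. The \<open>A\<close>-property is applied
  to sets without any known measurability, and their images become null sets in this way.\<close>

lemma null_sets_hausdorff_subset:
  assumes k: "0 < k" and Z: "Z \<in> null_sets (hausdorff_measure k)" and B: "B \<subseteq> (Z :: 'a::metric_space set)"
  shows "B \<in> null_sets (hausdorff_measure k)"
proof -
  let ?\<mu> = "hausdorff_outer_measure k :: 'a set \<Rightarrow> ennreal"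
  note om = outer_measure_space_hausdorff[OF k, where ?'a = 'a]
  have mono: "?\<mu> C \<le> ?\<mu> D" if "C \<subseteq> D" for C D
    using om that by (auto simp: outer_measure_space_def increasing_def)
  have "?\<mu> Z = 0" using Z emeasure_hausdorff_measure[OF k, of Z] by (auto simp: null_sets_def)
  then have B0: "?\<mu> C = 0" if "C \<subseteq> B" for C using mono[of C Z] B that by auto
  have "?\<mu> (B \<inter> T) + ?\<mu> ((UNIV - B) \<inter> T) = ?\<mu> T" for T
  proof (rule antisym)
    show "?\<mu> (B \<inter> T) + ?\<mu> ((UNIV - B) \<inter> T) \<le> ?\<mu> T"
      using B0[of "B \<inter> T"] mono[of "(UNIV - B) \<inter> T" T] by simp
    have "?\<mu> T \<le> ?\<mu> (B \<inter> T) + ?\<mu> ((UNIV - B) \<inter> T)"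
    proof -
      have "?\<mu> (\<Union>i. binaryset (B \<inter> T) ((UNIV - B) \<inter> T) i) \<le> suminf (\<lambda>i. ?\<mu> (binaryset (B \<inter> T) ((UNIV - B) \<inter> T) i))"
      proof -
        have "disjoint_family (binaryset (B \<inter> T) ((UNIV - B) \<inter> T))"
          by (auto simp: disjoint_family_on_def binaryset_def)
        then show ?thesis
          using om by (auto simp: outer_measure_space_def countably_subadditive_def)
      qed
      also have "\<dots> = ?\<mu> (B \<inter> T) + ?\<mu> ((UNIV - B) \<inter> T)"
        by (rule suminf_binaryset_eq) (rule B0, simp)
      also have "(\<Union>i. binaryset (B \<inter> T) ((UNIV - B) \<inter> T) i) = T"
        by (auto simp: UN_binaryset_eq)
      finally show ?thesis .
    qed
    then show "?\<mu> T \<le> ?\<mu> (B \<inter> T) + ?\<mu> ((UNIV - B) \<inter> T)" .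
  qed
  then have "B \<in> sets (hausdorff_measure k)"
    unfolding sets_hausdorff_measure[OF k] by (simp add: lambda_system_def)
  then show ?thesis using emeasure_hausdorff_measure[OF k, of B] B0[of B] by (simp add: null_sets_def)
qed

lemma area_null_iff:
  fixes S :: "('k::finite, 'n::finite) surface"
  assumes B: "B \<subseteq> snd S ` fst S"
  shows "area_null S B \<longleftrightarrow> B \<in> null_sets (hausdorff_measure CARD('k))"
proof
  assume *: "area_null S B"
  then have B': "B \<in> sets (hausdorff_measure CARD('k))" by (simp add: area_null_def)
  have "emeasure (hausdorff_measure CARD('k)) B = (\<integral>\<^sup>+ y. indicator B y \<partial>hausdorff_measure CARD('k))"
    using B' by simp
  also have "\<dots> \<le> (\<integral>\<^sup>+ y. multiplicity_fun S y * indicator B y \<partial>hausdorff_measure CARD('k))"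
    by (rule nn_integral_mono) (use B one_le_multiplicity_fun[of _ S] in \<open>auto simp: indicator_def\<close>)
  also have "\<dots> = 0" using * by (simp add: area_null_def area_def)
  finally show "B \<in> null_sets (hausdorff_measure CARD('k))" using B' by (simp add: null_sets_def)
next
  assume "B \<in> null_sets (hausdorff_measure CARD('k))"
  then show "area_null S B"
    unfolding area_null_def area_def using nn_integral_null_set by (auto simp: null_sets_def)
qed

section \<open>Images under differentiable maps\<close>

text \<open>The change of variables theorems of the library are stated for well-ordered index types only.\<close>

typedef 'n ordered_index = "{..<CARD('n::finite)}"
  by (auto intro!: exI[of _ 0])

instance ordered_index :: (finite) finite
proof
  have "(UNIV :: 'a ordered_index set) = Abs_ordered_index ` {..<CARD('a)}"
    using type_definition.Abs_image[OF type_definition_ordered_index] by metis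
  then show "finite (UNIV :: 'a ordered_index set)" by (metis finite_imageI finite_lessThan)
qed

instantiation ordered_index :: (finite) linorder
begin

definition "a < b \<longleftrightarrow> Rep_ordered_index a < Rep_ordered_index b"
definition "a \<le> b \<longleftrightarrow> Rep_ordered_index a \<le> Rep_ordered_index b"

instance
  by intro_classes (auto simp: less_eq_ordered_index_def less_ordered_index_def Rep_ordered_index_inject)

end

instance ordered_index :: (finite) wellorder
proof -
  have "wf {(x :: 'a ordered_index, y). x < y}"
    by (auto simp: trancl_def tranclp_less intro!: finite_acyclic_wf acyclicI)
  then show "OFCLASS('a ordered_index, wellorder_class)"
    by (rule wf_wellorderI) intro_classes
qed

lemma card_ordered_index: "CARD('n::finite ordered_index) = CARD('n)"
  using type_definition.card[OF type_definition_ordered_index] by simp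

text \<open>Conjugation with \<open>\<sigma>\<close> matches the permutations in the two Leibniz
  sums and preserves their signs.\<close>

lemma det_reindex:
  fixes A :: "'a::comm_ring_1 ^ 'n::finite ^ 'n" and \<sigma> :: "'m::finite \<Rightarrow> 'n"
  assumes \<sigma>: "bij \<sigma>"
  shows "det (\<chi> i j. A $ \<sigma> i $ \<sigma> j) = det A"
  unfolding det_def
proof (rule sum.reindex_bij_witness[of _ "map_permutation UNIV (inv_into UNIV \<sigma>)" "map_permutation UNIV \<sigma>"])
  note \<sigma>' = bij_imp_bij_inv[OF \<sigma>]
  show "map_permutation UNIV (inv_into UNIV \<sigma>) (map_permutation UNIV \<sigma> p) = p" if "p \<in> {p. p permutes UNIV}" for p
    by (rule map_permutation_compose_inv[OF \<sigma>]) (use that \<sigma> in \<open>auto simp: bij_is_inj\<close>)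
  show "map_permutation UNIV \<sigma> (map_permutation UNIV (inv_into UNIV \<sigma>) p) = p" if "p \<in> {p. p permutes UNIV}" for p
    by (rule map_permutation_compose_inv[OF \<sigma>']) (use that \<sigma> in \<open>auto simp: bij_is_surj surj_f_inv_f\<close>)
  show "map_permutation UNIV \<sigma> p \<in> {p. p permutes UNIV}" if "p \<in> {p. p permutes UNIV}" for p
    using that map_permutation_permutes[OF \<sigma>] by auto
  show "map_permutation UNIV (inv_into UNIV \<sigma>) p \<in> {p. p permutes UNIV}" if "p \<in> {p. p permutes UNIV}" for p
    using that map_permutation_permutes[OF \<sigma>'] by auto
  show "of_int (sign (map_permutation UNIV \<sigma> p)) * (\<Prod>i\<in>UNIV. A $ i $ map_permutation UNIV \<sigma> p i) =
        of_int (sign p) * (\<Prod>i\<in>UNIV. (\<chi> i j. A $ \<sigma> i $ \<sigma> j) $ i $ p i)" if "p \<in> {p. p permutes UNIV}" for p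
  proof -
    have "(\<Prod>i\<in>UNIV. A $ i $ map_permutation UNIV \<sigma> p i) =
        (\<Prod>i\<in>UNIV. A $ \<sigma> i $ map_permutation UNIV \<sigma> p (\<sigma> i))"
      by (rule prod.reindex_bij_betw[OF \<sigma>, symmetric])
    also have "\<dots> = (\<Prod>i\<in>UNIV. A $ \<sigma> i $ \<sigma> (p i))"
      using \<sigma> by (simp add: map_permutation_apply bij_is_inj)
    finally show ?thesis
      using sign_map_permutation[of \<sigma> UNIV p] \<sigma> that by (simp add: bij_is_inj)
  qed
qed

text \<open>Preimages of boxes are boxes with the same side lengths in another order, and boxes
  determine Lebesgue measure.\<close>

lemma distr_lborel_reindex:
  fixes \<sigma> :: "'m::finite \<Rightarrow> 'n::finite"
  assumes \<sigma>: "bij \<sigma>"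
  shows "distr lborel borel (\<lambda>x :: real ^ 'n. \<chi> i. x $ \<sigma> i) = lborel"
proof (rule lborel_eqI[symmetric])
  let ?T = "\<lambda>x :: real ^ 'n. (\<chi> i. x $ \<sigma> i) :: real ^ 'm"
  have Tm: "?T \<in> borel_measurable borel"
    by (intro borel_measurable_continuous_onI continuous_intros)
  fix l u :: "real ^ 'm" assume le: "\<And>b. b \<in> Basis \<Longrightarrow> l \<bullet> b \<le> u \<bullet> b"
  define l' where "l' = (\<chi> j. l $ inv_into UNIV \<sigma> j)"
  define u' where "u' = (\<chi> j. u $ inv_into UNIV \<sigma> j)"
  have \<sigma>_inv: "\<sigma> (inv_into UNIV \<sigma> j) = j" "inv_into UNIV \<sigma> (\<sigma> i) = i" for i j
    using \<sigma> by (auto simp: bij_is_surj surj_f_inv_f bij_is_inj)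
  have le': "l $ i \<le> u $ i" for i using le[of "axis i 1"] by (simp add: inner_axis axis_in_Basis_iff)
  have "?T -` box l u = box l' u'"
  proof -
    have "(\<forall>i. l $ i < x $ \<sigma> i \<and> x $ \<sigma> i < u $ i) \<longleftrightarrow> (\<forall>j. l $ inv_into UNIV \<sigma> j < x $ j \<and> x $ j < u $ inv_into UNIV \<sigma> j)" for x :: "real ^ 'n"
      by (metis \<sigma>_inv)
    then show ?thesis by (auto simp: mem_box_cart l'_def u'_def)
  qed
  then have "emeasure (distr lborel borel ?T) (box l u) = emeasure lborel (box l' u')"
    using Tm by (subst emeasure_distr) auto
  also have "\<dots> = ennreal (\<Prod>b\<in>Basis. (u' - l') \<bullet> b)"
    using le' by (subst emeasure_lborel_box) (auto simp: Basis_vec_def inner_axis l'_def u'_def)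
  also have "(\<Prod>b\<in>Basis. (u' - l') \<bullet> b) = (\<Prod>j\<in>UNIV. (u' - l') $ j)"
    by (simp add: Basis_vec_def UNION_singleton_eq_range prod.reindex axis_eq_axis inj_on_def inner_axis)
  also have "\<dots> = (\<Prod>i\<in>UNIV. (u' - l') $ \<sigma> i)"
    by (rule prod.reindex_bij_betw[OF \<sigma>, symmetric])
  also have "\<dots> = (\<Prod>i\<in>UNIV. (u - l) $ i)"
    by (simp add: l'_def u'_def \<sigma>_inv)
  also have "\<dots> = (\<Prod>b\<in>Basis. (u - l) \<bullet> b)"
    by (simp add: Basis_vec_def UNION_singleton_eq_range prod.reindex axis_eq_axis inj_on_def inner_axis)
  finally show "emeasure (distr lborel borel ?T) (box l u) = (\<Prod>b\<in>Basis. (u - l) \<bullet> b)" .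
qed simp

lemma
  fixes \<sigma> :: "'m::finite \<Rightarrow> 'n::finite"
  assumes \<sigma>: "bij \<sigma>"
  shows measurable_lebesgue_reindex: "(\<lambda>x :: real ^ 'n. \<chi> i. x $ \<sigma> i) \<in> lebesgue \<rightarrow>\<^sub>M lebesgue"
    and distr_lebesgue_reindex: "distr lebesgue lebesgue (\<lambda>x :: real ^ 'n. \<chi> i. x $ \<sigma> i) = lebesgue"
proof -
  let ?T = "\<lambda>x :: real ^ 'n. (\<chi> i. x $ \<sigma> i) :: real ^ 'm"
  have Tm: "?T \<in> borel_measurable borel"
    by (intro borel_measurable_continuous_onI continuous_intros)
  then have Tm': "?T \<in> lborel \<rightarrow>\<^sub>M lborel" by simp
  have d: "distr lborel lborel ?T = lborel"
    using distr_lborel_reindex[OF \<sigma>] by (metis distr_cong sets_lborel)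
  show "?T \<in> lebesgue \<rightarrow>\<^sub>M lebesgue"
    by (rule completion.measurable_completion2[OF measurable_completion[OF Tm']]) (simp add: distr_completion[OF Tm'] d)
  show "distr lebesgue lebesgue ?T = lebesgue"
    using completion.completion_distr_eq[OF measurable_completion[OF Tm']]
    by (simp add: distr_completion[OF Tm'] d)
qed

text \<open>For a finite right side the Jacobian is integrable and
  \<open>measure_differentiable_image\<close> applies; otherwise there is nothing to prove.\<close>

lemma emeasure_differentiable_image_le_wellorder:
  fixes f :: "real ^ 'n::{finite,wellorder} \<Rightarrow> real ^ 'n::_"
  assumes S: "S \<in> sets lebesgue" and der: "\<And>x. x \<in> S \<Longrightarrow> (f has_derivative f' x) (at x within S)"
  shows "emeasure lebesgue (f ` S) \<le> (\<integral>\<^sup>+x\<in>S. ennreal \<bar>det (matrix (f' x))\<bar> \<partial>lebesgue)"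
proof (cases "(\<integral>\<^sup>+x\<in>S. ennreal \<bar>det (matrix (f' x))\<bar> \<partial>lebesgue) = \<infinity>")
  case False
  let ?J = "\<lambda>x. \<bar>det (matrix (f' x))\<bar>"
  have J: "?J \<in> borel_measurable (lebesgue_on S)"
    using borel_measurable_det_Jacobian[OF S der] by simp
  have eq: "(\<integral>\<^sup>+x. ennreal (?J x) \<partial>lebesgue_on S) = (\<integral>\<^sup>+x\<in>S. ennreal (?J x) \<partial>lebesgue)"
    using S by (simp add: nn_integral_restrict_space)
  have int: "integrable (lebesgue_on S) ?J"
    using J False by (intro integrableI_nonneg) (auto simp: eq less_top)
  then have "?J integrable_on S"
    using S by (simp add: integrable_on_lebesgue_on)
  then have le: "f ` S \<in> lmeasurable" "measure lebesgue (f ` S) \<le> integral S ?J"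
    using measurable_differentiable_image[OF S der] measure_differentiable_image[OF S der] by auto
  have "emeasure lebesgue (f ` S) = ennreal (measure lebesgue (f ` S))"
    using le(1) by (simp add: emeasure_eq_ennreal_measure fmeasurable_def less_top[symmetric])
  also have "\<dots> \<le> ennreal (integral S ?J)" using le(2) by (rule ennreal_leI)
  also have "integral S ?J = integral\<^sup>L (lebesgue_on S) ?J"
    using lebesgue_integral_eq_integral[OF int S] by simp
  also have "ennreal \<dots> = (\<integral>\<^sup>+x\<in>S. ennreal (?J x) \<partial>lebesgue)"
    using nn_integral_eq_integral[OF int] eq by simp
  finally show ?thesis .
qed simp

text \<open>Relabelling the coordinates by \<open>\<sigma>\<close> is a measure preserving linear
  isomorphism. It turns \<open>f\<close> into a map over the ordered index type and, by
  \<open>det_reindex\<close>, leaves the determinant of the derivative unchanged.\<close>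

lemma
  fixes f :: "real ^ 'n::finite \<Rightarrow> real ^ 'n"
  assumes S: "S \<in> sets borel" and fS: "f ` S \<in> sets borel"
    and der: "\<And>x. x \<in> S \<Longrightarrow> (f has_derivative f' x) (at x within S)"
  shows borel_measurable_abs_det_Jacobian:
      "(\<lambda>x. ennreal \<bar>det (matrix (f' x))\<bar> * indicator S x) \<in> borel_measurable lebesgue"
    and emeasure_differentiable_image_le:
      "emeasure lebesgue (f ` S) \<le> (\<integral>\<^sup>+x\<in>S. ennreal \<bar>det (matrix (f' x))\<bar> \<partial>lebesgue)"
proof -
  obtain \<sigma> :: "'n ordered_index \<Rightarrow> 'n" where \<sigma>: "bij \<sigma>"
    using finite_same_card_bij[of "UNIV :: 'n ordered_index set" "UNIV :: 'n set"] card_ordered_index by auto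
  note \<sigma>' = bij_imp_bij_inv[OF \<sigma>]
  have \<sigma>_inv: "\<sigma> (inv_into UNIV \<sigma> j) = j" "inv_into UNIV \<sigma> (\<sigma> i) = i" for i j
    using \<sigma> by (auto simp: bij_is_surj surj_f_inv_f bij_is_inj)
  define T where "T x = (\<chi> i. x $ \<sigma> i)" for x :: "real ^ 'n"
  define T' where "T' z = (\<chi> j. z $ inv_into UNIV \<sigma> j)" for z :: "real ^ 'n ordered_index"
  have TT: "T' (T x) = x" "T (T' z) = z" for x z
    by (auto simp: T_def T'_def vec_eq_iff \<sigma>_inv)
  have lin: "bounded_linear T" "bounded_linear T'"
    unfolding T_def T'_def by (auto intro!: linear_conv_bounded_linear[THEN iffD1] linearI simp: vec_eq_iff)
  define F where "F = T \<circ> f \<circ> T'"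
  define F' where "F' z = T \<circ> f' (T' z) \<circ> T'" for z
  have img: "T ` B = T' -` B" for B using TT by (auto simp: image_iff) metis
  have bor: "T ` B \<in> sets borel" if "B \<in> sets borel" for B
  proof -
    have "T' \<in> borel_measurable borel"
      using lin(2) by (intro borel_measurable_continuous_onI linear_continuous_on)
    then show ?thesis using measurable_sets[of T' borel borel B] that img by simp
  qed
  have Tm: "T \<in> lebesgue \<rightarrow>\<^sub>M lebesgue" and Td: "distr lebesgue lebesgue T = lebesgue"
    unfolding T_def using measurable_lebesgue_reindex[OF \<sigma>] distr_lebesgue_reindex[OF \<sigma>] by auto
  have em: "emeasure lebesgue (T ` B) = emeasure lebesgue B" if "B \<in> sets borel" for B
  proof -
    have "T -` T ` B = B" using TT by (metis inj_def inj_vimage_image_eq)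
    then show ?thesis
      using emeasure_distr[OF Tm, of "T ` B"] bor[OF that] by (simp add: Td)
  qed
  have derF: "(F has_derivative F' z) (at z within T ` S)" if "z \<in> T ` S" for z
  proof -
    have T'S: "T' ` T ` S = S" using TT by (auto simp: image_iff)
    have 1: "(T' has_derivative T') (at z within T ` S)"
      using lin(2) by (rule bounded_linear_imp_has_derivative)
    have "(f has_derivative f' (T' z)) (at (T' z) within T' ` T ` S)"
      unfolding T'S using der that TT by auto
    from has_derivative_in_compose[OF 1 this]
    have "(f \<circ> T' has_derivative f' (T' z) \<circ> T') (at z within T ` S)" by (simp add: o_def)
    from bounded_linear.has_derivative[OF lin(1) this[unfolded o_def]]
    show ?thesis by (simp add: F_def F'_def o_def)
  qed
  have detF: "det (matrix (F' (T x))) = det (matrix (f' x))" for x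
  proof -
    have axis: "T' (axis j 1) = axis (\<sigma> j) 1" for j
      by (auto simp: T'_def vec_eq_iff axis_def \<sigma>_inv)
    then have "matrix (F' (T x)) = (\<chi> i j. matrix (f' x) $ \<sigma> i $ \<sigma> j)"
      by (simp add: matrix_def F'_def TT T_def[of "f' x _"] axis)
    then show ?thesis by (simp add: det_reindex[OF \<sigma>])
  qed
  have indT: "indicator (T ` S) (T x) = (indicator S x :: ennreal)" for x
    using TT by (metis image_iff indicator_simps)
  have "(\<lambda>x. \<bar>det (matrix (F' x))\<bar>) \<in> borel_measurable (lebesgue_on (T ` S))"
    using borel_measurable_det_Jacobian[OF _ derF] bor[OF S] by simp
  then have "(\<lambda>x. ennreal \<bar>det (matrix (F' x))\<bar>) \<in> borel_measurable (lebesgue_on (T ` S))"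
    by simp
  then have J': "(\<lambda>z. ennreal \<bar>det (matrix (F' z))\<bar> * indicator (T ` S) z) \<in> borel_measurable lebesgue"
    using bor[OF S] by (subst (asm) borel_measurable_restrict_space_iff_ennreal) auto
  show "(\<lambda>x. ennreal \<bar>det (matrix (f' x))\<bar> * indicator S x) \<in> borel_measurable lebesgue"
    using measurable_compose[OF Tm J'] by (simp add: detF indT)
  have "emeasure lebesgue (f ` S) = emeasure lebesgue (F ` T ` S)"
    using em[OF fS] by (simp add: F_def image_comp o_def TT)
  also have "\<dots> \<le> (\<integral>\<^sup>+z\<in>T ` S. ennreal \<bar>det (matrix (F' z))\<bar> \<partial>lebesgue)"
    by (rule emeasure_differentiable_image_le_wellorder[OF _ derF]) (use bor[OF S] in auto)
  also have "\<dots> = (\<integral>\<^sup>+z. ennreal \<bar>det (matrix (F' z))\<bar> * indicator (T ` S) z \<partial>distr lebesgue lebesgue T)"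
    by (simp add: Td)
  also have "\<dots> = (\<integral>\<^sup>+x. ennreal \<bar>det (matrix (F' (T x)))\<bar> * indicator (T ` S) (T x) \<partial>lebesgue)"
    by (rule nn_integral_distr[OF Tm]) (use J' Td in simp)
  also have "\<dots> = (\<integral>\<^sup>+x\<in>S. ennreal \<bar>det (matrix (f' x))\<bar> \<partial>lebesgue)"
    by (simp add: detF indT)
  finally show "emeasure lebesgue (f ` S) \<le> (\<integral>\<^sup>+x\<in>S. ennreal \<bar>det (matrix (f' x))\<bar> \<partial>lebesgue)" .
qed

text \<open>The hypothesis \<open>le\<close> says that the push-forward of \<open>M\<close> under
  \<open>g\<close> is dominated by the measure with density \<open>w\<close>; monotonicity of the
  integral in the measure then covers every Borel \<open>h\<close>. It serves twice, for Lebesgue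
  measure with the Jacobian as \<open>w\<close> and for Hausdorff measure with a constant
  \<open>w\<close>.\<close>

lemma nn_integral_inverse_image_le:
  fixes g :: "'b::topological_space \<Rightarrow> 'a::topological_space"
  assumes T: "T \<in> sets M" "sets borel \<subseteq> sets M" "space M = UNIV" and E: "E \<in> sets borel" "sets borel \<subseteq> sets N" "space N = UNIV"
    and g: "g \<in> borel_measurable (restrict_space M T)"
    and w: "(\<lambda>x. w x * indicator E x) \<in> borel_measurable N"
    and le: "\<And>B. B \<in> sets borel \<Longrightarrow> B \<subseteq> E \<Longrightarrow> emeasure M (T \<inter> g -` B) \<le> (\<integral>\<^sup>+x\<in>B. w x \<partial>N)"
    and gE: "g ` T \<subseteq> E" and h: "h \<in> borel_measurable borel"
  shows "(\<integral>\<^sup>+y\<in>T. h (g y) \<partial>M) \<le> (\<integral>\<^sup>+x\<in>E. h x * w x \<partial>N)"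
proof -
  define \<mu> where "\<mu> = distr (restrict_space M T) borel g"
  \<comment> \<open>The push-forward under the identity cuts the sigma-algebra down to the Borel
    sets, so that both measures live on the same sets and can be compared.\<close>
  define \<nu> where "\<nu> = distr (density N (\<lambda>x. w x * indicator E x)) borel (\<lambda>x. x)"
  have idm: "(\<lambda>x. x) \<in> density N (\<lambda>x. w x * indicator E x) \<rightarrow>\<^sub>M borel"
    using E by (auto simp: measurable_def)
  have spT: "space (restrict_space M T) = T" using T by (simp add: space_restrict_space)
  have "emeasure \<mu> B \<le> emeasure \<nu> B" if B: "B \<in> sets borel" for B
  proof -
    have "emeasure \<mu> B = emeasure (restrict_space M T) (g -` B \<inter> T)"
      unfolding \<mu>_def by (simp add: emeasure_distr[OF g B] spT)
    also have "\<dots> = emeasure M (g -` B \<inter> T)"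
      using T by (intro emeasure_restrict_space) auto
    also have "g -` B \<inter> T = T \<inter> g -` (B \<inter> E)" using gE by auto
    also have "emeasure M \<dots> \<le> (\<integral>\<^sup>+x\<in>B \<inter> E. w x \<partial>N)"
      using B E(1) by (intro le) auto
    also have "\<dots> = (\<integral>\<^sup>+x. w x * indicator E x * indicator B x \<partial>N)"
      by (rule nn_integral_cong) (auto simp: indicator_def)
    also have "\<dots> = emeasure (density N (\<lambda>x. w x * indicator E x)) B"
      using B E(2) by (intro emeasure_density[symmetric] w) auto
    also have "\<dots> = emeasure \<nu> B"
      unfolding \<nu>_def using emeasure_distr[OF idm B] E(3) by simp
    finally show ?thesis .
  qed
  then have "\<mu> \<le> \<nu>" by (subst le_measure) (auto simp: \<mu>_def \<nu>_def)
  then have "(\<integral>\<^sup>+x. h x \<partial>\<mu>) \<le> (\<integral>\<^sup>+x. h x \<partial>\<nu>)"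
    by (intro nn_integral_mono_measure) (auto simp: \<mu>_def \<nu>_def)
  moreover have "(\<integral>\<^sup>+x. h x \<partial>\<mu>) = (\<integral>\<^sup>+y\<in>T. h (g y) \<partial>M)"
    unfolding \<mu>_def using h T by (simp add: nn_integral_distr[OF g] nn_integral_restrict_space)
  moreover have "(\<integral>\<^sup>+x. h x \<partial>\<nu>) = (\<integral>\<^sup>+x\<in>E. h x * w x \<partial>N)"
  proof -
    have hN: "h \<in> borel_measurable N" using h E by (auto simp: measurable_def)
    have "(\<integral>\<^sup>+x. h x \<partial>\<nu>) = (\<integral>\<^sup>+x. h x \<partial>density N (\<lambda>x. w x * indicator E x))"
      unfolding \<nu>_def using h by (simp add: nn_integral_distr[OF idm])
    also have "\<dots> = (\<integral>\<^sup>+x. w x * indicator E x * h x \<partial>N)"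
      by (rule nn_integral_density[OF w hN])
    finally show ?thesis by (simp add: mult_ac)
  qed
  ultimately show ?thesis by simp
qed

text \<open>For a fixed radius the condition fails on a union of open sets, one for each
  \<open>y\<close>; so it holds on a relatively closed set, and the radii \<open>1 / (n + 1)\<close>
  exhaust all cases.\<close>

lemma locally_nonneg_borel:
  fixes \<phi> :: "'a::metric_space \<Rightarrow> 'a \<Rightarrow> real"
  assumes D: "open D" and cont: "\<And>y. y \<in> D \<Longrightarrow> continuous_on D (\<lambda>x. \<phi> x y)"
  shows "{x \<in> D. \<exists>r>0. \<forall>y\<in>D. dist x y < r \<longrightarrow> 0 \<le> \<phi> x y} \<in> sets borel"
proof -
  define N where "N r = (\<Union>y\<in>D. {x \<in> D. dist x y < r \<and> \<phi> x y < 0})" for r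
  have "open (N r)" for r
  proof -
    have "open {x \<in> D. dist x y < r \<and> \<phi> x y < 0}" if y: "y \<in> D" for y
    proof -
      have "open (D \<inter> (\<lambda>x. \<phi> x y) -` {..<0})"
        by (rule continuous_open_preimage[OF cont[OF y] D]) simp
      moreover have "{x \<in> D. dist x y < r \<and> \<phi> x y < 0} = ball y r \<inter> (D \<inter> (\<lambda>x. \<phi> x y) -` {..<0})"
        by (auto simp: dist_commute)
      ultimately show ?thesis by auto
    qed
    then show ?thesis unfolding N_def by blast
  qed
  then have meas: "D - N r \<in> sets borel" for r using D by auto
  have "{x \<in> D. \<exists>r>0. \<forall>y\<in>D. dist x y < r \<longrightarrow> 0 \<le> \<phi> x y} = (\<Union>n. D - N (inverse (real (Suc n))))" (is "?L = ?R")
  proof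
    show "?L \<subseteq> ?R"
    proof
      fix x assume x: "x \<in> ?L"
      then obtain r where r: "r > 0" "\<And>y. y \<in> D \<Longrightarrow> dist x y < r \<Longrightarrow> 0 \<le> \<phi> x y" by auto
      obtain n where "inverse (real (Suc n)) < r" using reals_Archimedean r(1) by blast
      then have "x \<notin> N (inverse (real (Suc n)))" using r(2) by (fastforce simp: N_def)
      then show "x \<in> ?R" using x by blast
    qed
    show "?R \<subseteq> ?L"
    proof
      fix x assume "x \<in> ?R"
      then obtain n where n: "x \<in> D" "x \<notin> N (inverse (real (Suc n)))" by blast
      then have "\<forall>y\<in>D. dist x y < inverse (real (Suc n)) \<longrightarrow> 0 \<le> \<phi> x y"
        by (auto simp: N_def not_less[symmetric])
      then show "x \<in> ?L" using n(1) by (auto intro!: exI[of _ "inverse (real (Suc n))"])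
    qed
  qed
  also have "?R \<in> sets borel" by (intro sets.countable_UN) (use meas in auto)
  finally show ?thesis .
qed

text \<open>Two linear maps that both approximate \<open>f\<close> near \<open>x\<close> are close
  in operator norm, so the \<open>A n\<close> form a Cauchy sequence; its limit is the derivative.
  No candidate for the derivative is needed beforehand.\<close>

lemma differentiable_at_of_approximations:
  fixes f :: "'a::real_normed_vector \<Rightarrow> 'b::banach"
  assumes D: "open D" "x \<in> D"
    and app: "\<And>n. \<exists>r>0. \<forall>y\<in>D. dist x y < r \<longrightarrow> norm (f y - f x - blinfun_apply (A n) (y - x)) \<le> norm (y - x) / real (Suc n)"
  shows "f differentiable (at x)"
proof -
  have close: "norm (A m - A n) \<le> 1 / real (Suc m) + 1 / real (Suc n)" for m n
  proof (rule norm_blinfun_bound)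
    fix h :: 'a
    obtain r where r: "r > 0" "\<And>y. y \<in> D \<Longrightarrow> dist x y < r \<Longrightarrow> norm (f y - f x - A m (y - x)) \<le> norm (y - x) / real (Suc m)"
      using app[of m] by blast
    obtain s where s: "s > 0" "\<And>y. y \<in> D \<Longrightarrow> dist x y < s \<Longrightarrow> norm (f y - f x - A n (y - x)) \<le> norm (y - x) / real (Suc n)"
      using app[of n] by blast
    obtain e where e: "e > 0" "ball x e \<subseteq> D" using D openE by blast
    \<comment> \<open>The summand 1 keeps the step size defined for \<open>h = 0\<close>; the factor
      2 puts the test point strictly inside all three neighbourhoods.\<close>
    define d where "d = min e (min r s) / (2 * (norm h + 1))"
    have d: "d > 0" using e r s by (auto simp: d_def intro!: divide_pos_pos add_nonneg_pos)
    have "d * norm h < min e (min r s)"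
    proof -
      have "d * norm h \<le> d * (norm h + 1)" using d by simp
      also have "\<dots> = min e (min r s) / 2"
        using norm_ge_zero[of h] by (simp add: d_def field_simps add_nonneg_eq_0_iff)
      finally show ?thesis using e r s by linarith
    qed
    then have y: "dist x (x + d *\<^sub>R h) < e" "dist x (x + d *\<^sub>R h) < r" "dist x (x + d *\<^sub>R h) < s"
      using d by (auto simp: dist_norm)
    have yD: "x + d *\<^sub>R h \<in> D" using e(2) y(1) by auto
    have "norm ((A m - A n) (d *\<^sub>R h)) \<le> norm (f (x + d *\<^sub>R h) - f x - A m (d *\<^sub>R h)) + norm (f (x + d *\<^sub>R h) - f x - A n (d *\<^sub>R h))"
      using norm_triangle_ineq4[of "f (x + d *\<^sub>R h) - f x - A n (d *\<^sub>R h)" "f (x + d *\<^sub>R h) - f x - A m (d *\<^sub>R h)"]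
      by (simp add: blinfun.diff_left algebra_simps)
    also have "\<dots> \<le> norm (d *\<^sub>R h) / real (Suc m) + norm (d *\<^sub>R h) / real (Suc n)"
      using r(2)[OF yD y(2)] s(2)[OF yD y(3)] by simp
    finally have "d * norm ((A m - A n) h) \<le> d * ((1 / real (Suc m) + 1 / real (Suc n)) * norm h)"
      using d by (simp add: blinfun.scaleR_right algebra_simps del: of_nat_Suc)
    then show "norm ((A m - A n) h) \<le> (1 / real (Suc m) + 1 / real (Suc n)) * norm h"
      using d by simp
  qed simp
  have "Cauchy A"
  proof (rule metric_CauchyI)
    fix e :: real assume "0 < e"
    then obtain N where N: "inverse (real (Suc N)) < e / 2" using reals_Archimedean[of "e / 2"] by auto
    have "dist (A m) (A n) < e" if "m \<ge> N" "n \<ge> N" for m n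
    proof -
      have "1 / real (Suc m) \<le> inverse (real (Suc N))" "1 / real (Suc n) \<le> inverse (real (Suc N))"
        using that by (simp_all add: field_simps)
      then show ?thesis using close[of m n] N by (simp add: dist_norm)
    qed
    then show "\<exists>N. \<forall>m\<ge>N. \<forall>n\<ge>N. dist (A m) (A n) < e" by blast
  qed
  then obtain L where L: "A \<longlonglongrightarrow> L" using Cauchy_convergent convergent_def by metis
  have "(f has_derivative blinfun_apply L) (at x)"
    unfolding has_derivative_at_alt
  proof (intro conjI allI impI)
    show "bounded_linear (blinfun_apply L)" by (rule blinfun.bounded_linear_right)
    fix e :: real assume e: "0 < e"
    obtain N where N: "inverse (real (Suc N)) < e / 2" using reals_Archimedean[of "e / 2"] e by auto
    obtain N' where N': "\<And>n. n \<ge> N' \<Longrightarrow> norm (A n - L) < e / 2"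
      using L e unfolding lim_sequentially dist_norm by (meson half_gt_zero)
    define n where "n = max N N'"
    have n1: "1 / real (Suc n) \<le> e / 2"
    proof -
      have "1 / real (Suc n) \<le> inverse (real (Suc N))" by (simp add: n_def field_simps)
      then show ?thesis using N by linarith
    qed
    obtain r where r: "r > 0" "\<And>y. y \<in> D \<Longrightarrow> dist x y < r \<Longrightarrow> norm (f y - f x - A n (y - x)) \<le> norm (y - x) / real (Suc n)"
      using app[of n] by blast
    obtain \<epsilon> where \<epsilon>: "\<epsilon> > 0" "ball x \<epsilon> \<subseteq> D" using D openE by blast
    have "norm (f y - f x - L (y - x)) \<le> e * norm (y - x)" if "norm (y - x) < min r \<epsilon>" for y
    proof -
      have y: "y \<in> D" "dist x y < r" using that \<epsilon>(2) by (auto simp: dist_norm norm_minus_commute)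
      have "norm (f y - f x - L (y - x)) \<le> norm (f y - f x - A n (y - x)) + norm ((A n - L) (y - x))"
        using norm_triangle_ineq[of "f y - f x - A n (y - x)" "(A n - L) (y - x)"] by (simp add: blinfun.diff_left)
      also have "norm (f y - f x - A n (y - x)) \<le> (1 / real (Suc n)) * norm (y - x)"
        using r(2)[OF y] by simp
      also have "(1 / real (Suc n)) * norm (y - x) \<le> e / 2 * norm (y - x)"
        by (intro mult_right_mono n1) simp
      also have "norm ((A n - L) (y - x)) \<le> norm (A n - L) * norm (y - x)" by (rule norm_blinfun)
      also have "\<dots> \<le> e / 2 * norm (y - x)"
        using N'[of n] by (intro mult_right_mono) (auto simp: n_def)
      finally show ?thesis by (simp add: algebra_simps)
    qed
    then show "\<exists>d>0. \<forall>y. norm (y - x) < d \<longrightarrow> norm (f y - f x - L (y - x)) \<le> e * norm (y - x)"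
      using r(1) \<epsilon>(1) by (intro exI[of _ "min r \<epsilon>"]) auto
  qed
  then show ?thesis by (auto simp: differentiable_def)
qed

text \<open>Differentiability at \<open>x\<close> means that for every \<open>n\<close> some matrix
  from a countable dense set approximates \<open>f\<close> with relative error
  \<open>1 / (n + 1)\<close> near \<open>x\<close>. This is a countable combination of conditions
  covered by \<open>locally_nonneg_borel\<close>.\<close>

lemma differentiability_set_borel:
  fixes f :: "real ^ 'n::finite \<Rightarrow> real ^ 'n"
  assumes D: "open D" and f: "continuous_on D f"
  shows "{x \<in> D. f differentiable (at x)} \<in> sets borel"
proof -
  obtain Q :: "(real ^ 'n ^ 'n) set" where Q: "countable Q" "\<And>U. open U \<Longrightarrow> U \<noteq> {} \<Longrightarrow> \<exists>q\<in>Q. q \<in> U"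
    using countable_dense_setE by blast
  define B where "B M = Blinfun (\<lambda>x. M *v x)" for M :: "real ^ 'n ^ 'n"
  have Bap: "blinfun_apply (B M) x = M *v x" for M x
    unfolding B_def by (simp add: bounded_linear_Blinfun_apply)
  define G where "G M n = {x \<in> D. \<exists>r>0. \<forall>y\<in>D. dist x y < r \<longrightarrow>
      0 \<le> norm (y - x) / real (Suc n) - norm (f y - f x - M *v (y - x))}" for M n
  have "G M n \<in> sets borel" for M n
    unfolding G_def
    by (rule locally_nonneg_borel[OF D])
       (intro continuous_intros f linear_continuous_on_compose[where g="(*v) M"] matrix_vector_mul_linear, simp)
  then have "(\<Inter>n. \<Union>M\<in>Q. G M n) \<in> sets borel"
    using Q(1) by (intro sets.countable_INT'' sets.countable_UN') auto
  moreover have "{x \<in> D. f differentiable (at x)} = (\<Inter>n. \<Union>M\<in>Q. G M n)"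
  proof (intro equalityI subsetI)
    fix x assume x: "x \<in> {x \<in> D. f differentiable (at x)}"
    then obtain A where A: "(f has_derivative A) (at x)" by (auto simp: differentiable_def)
    show "x \<in> (\<Inter>n. \<Union>M\<in>Q. G M n)"
    proof
      fix n
      \<comment> \<open>Half of the permitted error goes to the linear approximation of
        \<open>f\<close>, the other half to replacing its derivative by a matrix in
        \<open>Q\<close>.\<close>
      define e where "e = 1 / (2 * real (Suc n))"
      have e: "e > 0" by (simp add: e_def)
      have "continuous_on UNIV (\<lambda>M. B M)"
      proof -
        have "linear B"
          by (rule linearI) (auto intro!: blinfun_eqI simp: Bap blinfun.add_left blinfun.scaleR_left matrix_vector_mult_add_rdistrib scaleR_matrix_vector_assoc)
        then show ?thesis using linear_continuous_on linear_conv_bounded_linear by blast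
      qed
      then have "open ((\<lambda>M. B M) -` ball (B (matrix A)) e)"
        by (rule open_vimage[OF open_ball])
      moreover have "matrix A \<in> (\<lambda>M. B M) -` ball (B (matrix A)) e" using e by simp
      ultimately obtain M where M: "M \<in> Q" "dist (B (matrix A)) (B M) < e"
        using Q(2) by (metis empty_iff mem_ball vimage_eq)
      have linA: "linear A" using A by (rule has_derivative_linear)
      have AM: "norm (A h - M *v h) \<le> e * norm h" for h
      proof -
        have "norm (A h - M *v h) = norm ((B (matrix A) - B M) h)"
          using linA by (simp add: blinfun.diff_left Bap matrix_works)
        also have "\<dots> \<le> norm (B (matrix A) - B M) * norm h" by (rule norm_blinfun)
        also have "\<dots> \<le> e * norm h" using M(2) by (intro mult_right_mono) (auto simp: dist_norm)
        finally show ?thesis .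
      qed
      obtain d where d: "d > 0" "\<And>y. norm (y - x) < d \<Longrightarrow> norm (f y - f x - A (y - x)) \<le> e * norm (y - x)"
        using A e unfolding has_derivative_at_alt by blast
      have "norm (f y - f x - M *v (y - x)) \<le> norm (y - x) / real (Suc n)" if "dist x y < d" for y
      proof -
        have "norm (f y - f x - M *v (y - x)) \<le> norm (f y - f x - A (y - x)) + norm (A (y - x) - M *v (y - x))"
          by (rule order_trans[OF _ norm_triangle_ineq]) (simp only: diff_add_cancel add_diff_eq order_refl)
        also have "\<dots> \<le> e * norm (y - x) + e * norm (y - x)"
          using d(2)[of y] AM[of "y - x"] that by (simp add: dist_norm norm_minus_commute)
        also have "\<dots> = norm (y - x) / real (Suc n)"
          by (simp add: e_def field_simps del: of_nat_Suc)
        finally show ?thesis .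
      qed
      then show "x \<in> (\<Union>M\<in>Q. G M n)"
        using M(1) d(1) x unfolding G_def by (fastforce simp del: of_nat_Suc)
    qed
  next
    fix x assume "x \<in> (\<Inter>n. \<Union>M\<in>Q. G M n)"
    then have "\<forall>n. \<exists>M. x \<in> G M n" by blast
    then obtain M where M: "\<And>n. x \<in> G (M n) n" by metis
    then have xD: "x \<in> D" by (auto simp: G_def)
    have "f differentiable (at x)"
    proof (rule differentiable_at_of_approximations[OF D xD, where A = "\<lambda>n. B (M n)"])
      fix n show "\<exists>r>0. \<forall>y\<in>D. dist x y < r \<longrightarrow> norm (f y - f x - B (M n) (y - x)) \<le> norm (y - x) / real (Suc n)"
        using M[of n] unfolding G_def Bap by (simp del: of_nat_Suc)
    qed
    then show "x \<in> {x \<in> D. f differentiable (at x)}" using xD by simp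
  qed
  ultimately show ?thesis by simp
qed

section \<open>Decomposition into expanding pieces\<close>

text \<open>For \<open>s \<ge> 0\<close> this condition lies between \<open>s < l(x,f)\<close> and
  \<open>s \<le> l(x,f)\<close>. Avoiding the limit makes the set Borel by
  \<open>locally_nonneg_borel\<close> and provides an explicit radius.\<close>

definition locally_expanding_set :: "'a::metric_space set \<Rightarrow> ('a \<Rightarrow> 'b::metric_space) \<Rightarrow> real \<Rightarrow> 'a set" where
  "locally_expanding_set D f s = {x \<in> D. \<exists>r>0. \<forall>y\<in>D. dist x y < r \<longrightarrow> s * dist x y \<le> dist (f x) (f y)}"

lemma locally_expanding_set_borel:
  assumes "open D" "continuous_on D f"
  shows "locally_expanding_set D f s \<in> sets borel"
  using locally_nonneg_borel[of D "\<lambda>x y. dist (f x) (f y) - s * dist x y"] assms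
  unfolding locally_expanding_set_def by (simp add: continuous_intros)

lemma locally_expanding_set_antimono:
  assumes "s \<le> s'"
  shows "locally_expanding_set D f s' \<subseteq> locally_expanding_set D f s"
proof
  fix x assume "x \<in> locally_expanding_set D f s'"
  then obtain r where r: "x \<in> D" "r > 0" "\<And>y. y \<in> D \<Longrightarrow> dist x y < r \<Longrightarrow> s' * dist x y \<le> dist (f x) (f y)"
    by (auto simp: locally_expanding_set_def)
  have "s * dist x y \<le> dist (f x) (f y)" if "y \<in> D" "dist x y < r" for y
    using r(3)[OF that] assms mult_right_mono[of s s' "dist x y"] by simp
  then show "x \<in> locally_expanding_set D f s"
    using r(1,2) by (auto simp: locally_expanding_set_def)
qed

lemma lower_stretch_pos_imp_expanding:
  assumes x: "x \<in> D" and pos: "0 < lower_stretch D f x"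
  obtains s where "0 < s" "x \<in> locally_expanding_set D f s"
proof -
  obtain c where c: "0 < c" "c < lower_stretch D f x" using pos dense by blast
  then have "c \<noteq> \<infinity>" by auto
  then obtain s where s: "c = ennreal s" "0 < s" using c(1) by (cases c) (auto simp: ennreal_less_zero_iff)
  have "\<forall>\<^sub>F y in at x within D. c < ennreal (norm (f x - f y) / norm (x - y))"
    using c(2) unfolding lower_stretch_def by (rule less_LiminfD)
  then obtain r where r: "r > 0" "\<And>y. y \<in> D \<Longrightarrow> y \<noteq> x \<Longrightarrow> dist y x < r \<Longrightarrow> c < ennreal (norm (f x - f y) / norm (x - y))"
    unfolding eventually_at by blast
  have "s * dist x y \<le> dist (f x) (f y)" if y: "y \<in> D" "dist x y < r" for y
  proof (cases "y = x")
    case False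
    then have "s < norm (f x - f y) / norm (x - y)"
      using r(2)[OF y(1)] y(2) s by (simp add: dist_commute ennreal_less_iff)
    then show ?thesis using False by (simp add: dist_norm field_simps)
  qed simp
  then show thesis using that[OF s(2)] x r(1) by (auto simp: locally_expanding_set_def)
qed

text \<open>\<open>x\<close> is a limit point of the open set \<open>D\<close>, so near it some
  difference quotient would have to be both below and at least \<open>s\<close>. This bounds the
  scales of expansion from above.\<close>

lemma upper_stretch_finite_imp_not_expanding:
  fixes x :: "real ^ 'n::finite"
  assumes D: "open D" "x \<in> D" and fin: "upper_stretch D f x < \<infinity>"
  obtains s where "0 < s" "x \<notin> locally_expanding_set D f s"
proof -
  obtain c where c: "upper_stretch D f x < c" "c < \<infinity>" using fin dense by blast
  then obtain s where s: "c = ennreal s" "0 < s" by (cases c) (auto, metis ennreal_neg linorder_not_less not_less_zero)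
  have ev: "\<forall>\<^sub>F y in at x within D. ennreal (norm (f x - f y) / norm (x - y)) < c"
    using c(1) unfolding upper_stretch_def by (rule Limsup_lessD)
  have "x \<notin> locally_expanding_set D f s"
  proof
    assume "x \<in> locally_expanding_set D f s"
    then obtain r where r: "r > 0" "\<And>y. y \<in> D \<Longrightarrow> dist x y < r \<Longrightarrow> s * dist x y \<le> dist (f x) (f y)"
      by (auto simp: locally_expanding_set_def)
    have "\<forall>\<^sub>F y in at x within D. s \<le> norm (f x - f y) / norm (x - y)"
      unfolding eventually_at
      by (intro exI[of _ r]) (use r in \<open>auto simp: dist_norm norm_minus_commute field_simps\<close>)
    then have "\<forall>\<^sub>F y in at x within D. False"
      using ev by eventually_elim (use s in \<open>auto simp: ennreal_less_iff\<close>)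
    moreover have "at x within D \<noteq> bot"
      unfolding at_within_open[OF D(2,1)] by (rule at_neq_bot)
    ultimately show False by simp
  qed
  then show thesis using that s by blast
qed

lemma min_stretch_le: "min_stretch A * norm h \<le> norm (A h)" if "linear A"
proof (cases "h = 0")
  case True
  then show ?thesis by simp
next
  case False
  have "min_stretch A \<le> norm (A h) / norm h"
    unfolding min_stretch_def
    by (rule cINF_lower) (use False in \<open>auto intro!: bdd_belowI2[of _ 0]\<close>)
  then show ?thesis using False by (simp add: field_simps)
qed

lemma le_min_stretch:
  fixes A :: "real ^ 'n::finite \<Rightarrow> real ^ 'n"
  assumes "\<And>h. s * norm h \<le> norm (A h)"
  shows "s \<le> min_stretch A"
  unfolding min_stretch_def
proof (rule cINF_greatest)
  have "axis undefined 1 \<in> - {0 :: real ^ 'n}" by (simp add: axis_eq_0_iff)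
  then show "- {0 :: real ^ 'n} \<noteq> {}" by blast
qed (use assms in \<open>auto simp: field_simps\<close>)

text \<open>The expansion inequality is tested at a point \<open>x + u h\<close> and divided by
  \<open>u\<close>; what remains of the error of linear approximation is at most
  \<open>e\<close>.\<close>

lemma derivative_expanding:
  fixes f :: "'a::real_normed_vector \<Rightarrow> 'b::real_normed_vector"
  assumes D: "open D" and x: "x \<in> locally_expanding_set D f s" and der: "(f has_derivative A) (at x)"
  shows "s * norm h \<le> norm (A h)"
proof (rule field_le_epsilon)
  fix e :: real assume e: "0 < e"
  have xD: "x \<in> D" using x by (auto simp: locally_expanding_set_def)
  obtain r where r: "r > 0" "\<And>y. y \<in> D \<Longrightarrow> dist x y < r \<Longrightarrow> s * dist x y \<le> dist (f x) (f y)"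
    using x by (auto simp: locally_expanding_set_def)
  define e' where "e' = e / (norm h + 1)"
  have e': "e' > 0" "e' * norm h \<le> e"
  proof -
    show "e' > 0" using e by (simp add: e'_def divide_pos_pos add_nonneg_pos)
    moreover have "e' * (norm h + 1) = e" using norm_ge_zero[of h] by (simp add: e'_def add_nonneg_eq_0_iff)
    ultimately show "e' * norm h \<le> e" by (simp add: algebra_simps)
  qed
  obtain d where d: "d > 0" "\<And>y. norm (y - x) < d \<Longrightarrow> norm (f y - f x - A (y - x)) \<le> e' * norm (y - x)"
    using der e'(1) unfolding has_derivative_at_alt by blast
  obtain \<epsilon> where \<epsilon>: "\<epsilon> > 0" "ball x \<epsilon> \<subseteq> D" using D xD openE by blast
  define u where "u = min r (min d \<epsilon>) / (2 * (norm h + 1))"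
  have u: "u > 0" using r d \<epsilon> by (auto simp: u_def intro!: divide_pos_pos add_nonneg_pos)
  have "u * norm h < min r (min d \<epsilon>)"
  proof -
    have "u * norm h \<le> u * (norm h + 1)" using u by simp
    also have "\<dots> = min r (min d \<epsilon>) / 2"
      using norm_ge_zero[of h] by (simp add: u_def field_simps add_nonneg_eq_0_iff)
    finally show ?thesis using r d \<epsilon> by linarith
  qed
  then have y: "dist x (x + u *\<^sub>R h) < r" "norm ((x + u *\<^sub>R h) - x) < d" "dist x (x + u *\<^sub>R h) < \<epsilon>"
    using u by (auto simp: dist_norm)
  have yD: "x + u *\<^sub>R h \<in> D" using y(3) \<epsilon>(2) by auto
  have "s * (u * norm h) \<le> norm (f (x + u *\<^sub>R h) - f x)"
    using r(2)[OF yD y(1)] u by (simp add: dist_norm norm_minus_commute)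
  also have "\<dots> \<le> norm (A (u *\<^sub>R h)) + norm (f (x + u *\<^sub>R h) - f x - A (u *\<^sub>R h))"
    using norm_triangle_ineq[of "A (u *\<^sub>R h)" "f (x + u *\<^sub>R h) - f x - A (u *\<^sub>R h)"] by simp
  also have "norm (f (x + u *\<^sub>R h) - f x - A (u *\<^sub>R h)) \<le> e' * (u * norm h)"
    using d(2)[OF y(2)] u by simp
  also have "norm (A (u *\<^sub>R h)) = u * norm (A h)"
    using has_derivative_linear[OF der] u by (simp add: linear_scale)
  finally have "u * (s * norm h) \<le> u * (norm (A h) + e' * norm h)"
    by (simp add: algebra_simps)
  then have "s * norm h \<le> norm (A h) + e' * norm h" using u by simp
  then show "s * norm h \<le> norm (A h) + e" using e'(2) by linarith
qed

text \<open>The gap \<open>l - s\<close> absorbs the error of the linear approximation. Read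
  contrapositively, failure of expansion at a scale bounds the minimal stretch of the
  derivative.\<close>

lemma expanding_of_derivative:
  fixes f :: "'a::real_normed_vector \<Rightarrow> 'b::real_normed_vector"
  assumes D: "x \<in> D" and der: "(f has_derivative A) (at x)" and l: "\<And>h. l * norm h \<le> norm (A h)" "s < l"
  shows "x \<in> locally_expanding_set D f s"
proof -
  obtain d where d: "d > 0" "\<And>y. norm (y - x) < d \<Longrightarrow> norm (f y - f x - A (y - x)) \<le> (l - s) * norm (y - x)"
    using der l(2) unfolding has_derivative_at_alt by (meson diff_gt_0_iff_gt)
  have "s * dist x y \<le> dist (f x) (f y)" if "dist x y < d" for y
  proof -
    have "l * norm (y - x) \<le> norm (A (y - x))" by (rule l(1))
    also have "\<dots> \<le> norm (f y - f x) + norm (f y - f x - A (y - x))"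
      using norm_triangle_ineq4[of "f y - f x" "f y - f x - A (y - x)"] by simp
    also have "norm (f y - f x - A (y - x)) \<le> (l - s) * norm (y - x)"
      using d(2)[of y] that by (simp add: dist_norm norm_minus_commute)
    finally show ?thesis by (simp add: dist_norm norm_minus_commute algebra_simps)
  qed
  then show ?thesis using D d(1) by (auto simp: locally_expanding_set_def)
qed

lemma expansion_decomposition:
  fixes f :: "real ^ 'n::finite \<Rightarrow> real ^ 'n"
  assumes D: "open D" and f: "continuous_on D f" and t: "1 < t"
  obtains C E :: "nat \<Rightarrow> (real ^ 'n) set" and c :: "nat \<Rightarrow> real" where
    "\<And>i. 0 < c i" "\<And>i. compact (C i)" "\<And>i. C i \<subseteq> D" "\<And>i. E i \<in> sets borel" "\<And>i. E i \<subseteq> C i" "disjoint_family E"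
    "\<And>i x y. x \<in> C i \<Longrightarrow> y \<in> C i \<Longrightarrow> c i * dist x y \<le> dist (f x) (f y)"
    "\<And>i x A. x \<in> E i \<Longrightarrow> (f has_derivative A) (at x) \<Longrightarrow> c i \<le> min_stretch A \<and> min_stretch A \<le> t * c i"
    "{x \<in> D. 0 < lower_stretch D f x \<and> upper_stretch D f x < \<infinity>} \<subseteq> (\<Union>i. E i)"
proof -
  let ?A = "locally_expanding_set D f"
  obtain Q :: "(real ^ 'n) set" where Q: "countable Q" "\<And>U. open U \<Longrightarrow> U \<noteq> {} \<Longrightarrow> \<exists>q\<in>Q. q \<in> U"
    using countable_dense_setE by blast
  define I where "I = Q \<times> (\<rat> :: real set) \<times> (UNIV :: int set)"
  have I: "countable I" "I \<noteq> {}"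
    using Q(1) Q(2)[of UNIV] countable_rat by (auto simp: I_def)
  \<comment> \<open>A point lies in a piece of scale \<open>s = t powr j\<close> if \<open>j\<close> is the last exponent at which \<open>f\<close> expands locally
    by \<open>t powr j\<close>.\<close>
  define s where "s = (\<lambda>(q :: real ^ 'n, r :: real, j :: int). t powr real_of_int j)"
  \<comment> \<open>Expansion is demanded against every \<open>y\<close> of the ball. So
    \<open>f\<close> expands on \<open>K a\<close> with one constant, and since each of these
    conditions is closed in \<open>x\<close>, the set is compact.\<close>
  define K where "K = (\<lambda>(q, r, j :: int). if cball q r \<subseteq> D then {x \<in> cball q r. \<forall>y\<in>cball q r. t powr real_of_int j * dist x y \<le> dist (f x) (f y)} else {})"
  define E0 where "E0 a = K a \<inter> ?A (s a) - ?A (t * s a)" for a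
  have comp: "compact (K a)" for a
  proof -
    obtain q r j where a: "a = (q, r, j)" using prod_cases3 by blast
    show ?thesis
    proof (cases "cball q r \<subseteq> D")
      case True
      then have fc: "continuous_on (cball q r) f" using f continuous_on_subset by blast
      have "closed {x \<in> cball q r. t powr real_of_int j * dist x y \<le> dist (f x) (f y)}" for y
        by (intro continuous_on_closed_Collect_le continuous_intros fc) auto
      then have "closed (cball q r \<inter> (\<Inter>y\<in>cball q r. {x \<in> cball q r. t powr real_of_int j * dist x y \<le> dist (f x) (f y)}))"
        by (intro closed_Int closed_cball closed_INT) blast
      moreover have "K a = cball q r \<inter> (\<Inter>y\<in>cball q r. {x \<in> cball q r. t powr real_of_int j * dist x y \<le> dist (f x) (f y)})"
        using True by (auto simp: K_def a)
      ultimately show ?thesis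
        by (simp add: compact_eq_bounded_closed bounded_Int)
    qed (simp add: K_def a)
  qed
  have KD: "K a \<subseteq> D" for a by (auto simp: K_def split: prod.splits if_splits)
  have E0b: "E0 a \<in> sets borel" for a
    unfolding E0_def by (intro sets.Diff sets.Int locally_expanding_set_borel[OF D f] borel_compact comp)
  define e where "e = from_nat_into I"
  define E where "E = disjointed (\<lambda>i. E0 (e i))"
  have EE0: "E i \<subseteq> E0 (e i)" for i unfolding E_def by (rule disjointed_subset)
  have UE: "(\<Union>i. E i) = (\<Union>a\<in>I. E0 a)"
    unfolding E_def UN_disjointed_eq e_def using range_from_nat_into[OF I(2,1)] by (metis image_image)
  have spos: "0 < s a" for a using t by (auto simp: s_def split: prod.splits)
  show thesis
  proof (rule that[of "\<lambda>i. s (e i)" "\<lambda>i. K (e i)" E])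
    show "0 < s (e i)" "compact (K (e i))" "K (e i) \<subseteq> D" "E i \<subseteq> K (e i)" for i
      using spos comp KD EE0[of i] by (auto simp: E0_def)
    have "range E \<subseteq> sets borel"
      unfolding E_def by (rule sets.range_disjointed_sets) (rule image_subsetI, rule E0b)
    then show "E i \<in> sets borel" for i by blast
    show "disjoint_family E" unfolding E_def by (rule disjoint_family_disjointed)
    show "s (e i) * dist x y \<le> dist (f x) (f y)" if "x \<in> K (e i)" "y \<in> K (e i)" for i x y
      using that by (auto simp: K_def s_def split: prod.splits if_splits)
    show "s (e i) \<le> min_stretch A \<and> min_stretch A \<le> t * s (e i)" if x: "x \<in> E i" and A: "(f has_derivative A) (at x)" for i x A
    proof
      have x': "x \<in> ?A (s (e i))" "x \<notin> ?A (t * s (e i))" "x \<in> D"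
        using EE0[of i] x KD[of "e i"] by (auto simp: E0_def)
      show "s (e i) \<le> min_stretch A"
        by (rule le_min_stretch) (rule derivative_expanding[OF D x'(1) A])
      show "min_stretch A \<le> t * s (e i)"
        using expanding_of_derivative[OF x'(3) A min_stretch_le[OF has_derivative_linear[OF A]]] x'(2) by force
    qed
    show "{x \<in> D. 0 < lower_stretch D f x \<and> upper_stretch D f x < \<infinity>} \<subseteq> (\<Union>i. E i)"
    proof
      fix x assume "x \<in> {x \<in> D. 0 < lower_stretch D f x \<and> upper_stretch D f x < \<infinity>}"
      then have x: "x \<in> D" "0 < lower_stretch D f x" "upper_stretch D f x < \<infinity>" by auto
      define P where "P j \<longleftrightarrow> x \<in> ?A (t powr real_of_int j)" for j
      obtain u where u: "0 < u" "x \<in> ?A u" using lower_stretch_pos_imp_expanding[OF x(1,2)] .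
      obtain v where v: "0 < v" "x \<notin> ?A v" using upper_stretch_finite_imp_not_expanding[OF D x(1,3)] .
      have "t powr real_of_int \<lfloor>log t u\<rfloor> \<le> t powr log t u" using t by (intro powr_mono) auto
      then have "P \<lfloor>log t u\<rfloor>"
        unfolding P_def using locally_expanding_set_antimono[of "t powr real_of_int \<lfloor>log t u\<rfloor>" u D f] u t by auto
      have notP: "\<not> P j" if "\<lceil>log t v\<rceil> \<le> j" for j
      proof -
        have "t powr log t v \<le> t powr real_of_int j" using t that by (intro powr_mono) (auto simp: ceiling_le_iff)
        then show ?thesis
          unfolding P_def using locally_expanding_set_antimono[of v "t powr real_of_int j" D f] v t by auto
      qed
      \<comment> \<open>\<open>P\<close> holds at the floor of \<open>log t u\<close> and fails from
        the ceiling of \<open>log t v\<close> on, so upward induction must break off at some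
        exponent.\<close>
      have "\<exists>j. P j \<and> \<not> P (j + 1)"
      proof (rule ccontr)
        assume *: "\<nexists>j. P j \<and> \<not> P (j + 1)"
        have "P j" if "\<lfloor>log t u\<rfloor> \<le> j" for j
          using that by (induction j rule: int_ge_induct) (use \<open>P \<lfloor>log t u\<rfloor>\<close> * in auto)
        then show False using notP[of "max \<lfloor>log t u\<rfloor> \<lceil>log t v\<rceil>"] by simp
      qed
      then obtain j where j: "P j" "\<not> P (j + 1)" by blast
      obtain r where r: "r > 0" "\<And>y. y \<in> D \<Longrightarrow> dist x y < r \<Longrightarrow> t powr real_of_int j * dist x y \<le> dist (f x) (f y)"
        using j(1) by (auto simp: P_def locally_expanding_set_def)
      obtain \<epsilon> where \<epsilon>: "\<epsilon> > 0" "ball x \<epsilon> \<subseteq> D" using D x(1) openE by blast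
      \<comment> \<open>All points of a ball of radius \<open>\<rho>\<close> containing
        \<open>x\<close> are within \<open>2 * \<rho>\<close> of \<open>x\<close>; this has to stay
        below \<open>r\<close> and \<open>\<epsilon>\<close>.\<close>
      obtain \<rho> where \<rho>: "\<rho> \<in> \<rat>" "0 < \<rho>" "\<rho> < min r \<epsilon> / 2"
        using Rats_dense_in_real[of 0 "min r \<epsilon> / 2"] r(1) \<epsilon>(1) by auto
      obtain q where q: "q \<in> Q" "q \<in> ball x \<rho>"
        using Q(2)[of "ball x \<rho>"] \<rho>(2) by (metis centre_in_ball empty_iff open_ball)
      have near: "dist x y < r \<and> dist x y < \<epsilon>" if "y \<in> cball q \<rho>" for y
        using that q(2) \<rho>(3) dist_triangle[of x y q] by auto
      have "cball q \<rho> \<subseteq> D" using near \<epsilon>(2) by auto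
      then have "x \<in> K (q, \<rho>, j)"
        using near r(2) q(2) by (auto simp: K_def dist_commute)
      moreover have "t * t powr real_of_int j = t powr real_of_int (j + 1)"
        using t by (simp add: powr_add)
      ultimately have "x \<in> E0 (q, \<rho>, j)"
        using j by (auto simp: E0_def s_def P_def)
      moreover have "(q, \<rho>, j) \<in> I" using q(1) \<rho>(1) by (simp add: I_def)
      ultimately show "x \<in> (\<Union>i. E i)" unfolding UE by blast
    qed
  qed
qed

section \<open>Powers and means in the extended nonnegative reals\<close>

lemma measurable_ennpowr [measurable]:
  assumes [measurable]: "f \<in> borel_measurable M"
  shows "(\<lambda>x. ennpowr (f x) p) \<in> borel_measurable M"
  unfolding ennpowr_def by measurable

lemma ennpowr_ennreal: "0 \<le> x \<Longrightarrow> ennpowr (ennreal x) p = ennreal (x powr p)"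
  by (simp add: ennpowr_def)

lemma ennpowr_top [simp]: "ennpowr top_class.top p = top_class.top"
  by (simp add: ennpowr_def)

lemma ennpowr_0 [simp]: "ennpowr 0 p = 0"
  using ennpowr_ennreal[of 0 p] by simp

lemma ennpowr_mono:
  assumes "0 < p" "x \<le> y"
  shows "ennpowr x p \<le> ennpowr y p"
proof (cases "y = top_class.top")
  case False
  then have "x \<noteq> top_class.top" using assms(2) top.extremum_unique by blast
  then show ?thesis
    using False assms by (cases x; cases y) (auto simp: ennpowr_ennreal intro!: ennreal_leI powr_mono2)
qed simp

lemma ennpowr_ennpowr:
  assumes "0 < p" "0 < q"
  shows "ennpowr (ennpowr x p) q = ennpowr x (p * q)"
  by (cases x) (simp_all add: ennpowr_ennreal powr_powr)

lemma ennpowr_1: "ennpowr x 1 = x"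
  by (cases x) (simp_all add: ennpowr_ennreal)

lemma ennpowr_of_nat:
  assumes "0 < k"
  shows "ennpowr x (real k) = x ^ k"
proof (cases x)
  case (real r)
  then have "r powr real k = r ^ k"
    using assms by (cases "r = 0") (simp_all add: powr_realpow)
  then show ?thesis using real by (simp add: ennpowr_ennreal ennreal_power)
next
  case top
  then show ?thesis using assms by (simp add: power_top_ennreal)
qed

lemma ennpowr_mult:
  assumes "0 < p"
  shows "ennpowr (x * y) p = ennpowr x p * ennpowr y p"
proof (cases "x = top_class.top \<or> y = top_class.top")
  case True
  have *: "ennpowr z p = 0 \<longleftrightarrow> z = 0" for z
    using assms by (cases z) (auto simp: ennpowr_ennreal)
  have top: "ennpowr (\<infinity> * z) p = \<infinity> * ennpowr z p" for z
    using *[of z] by (cases "z = 0") (simp_all add: ennreal_top_mult)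
  show ?thesis
    using True top[of x] top[of y] by (auto simp: mult.commute)
next
  case False
  then show ?thesis
    by (cases x; cases y) (auto simp: ennpowr_ennreal powr_mult simp flip: ennreal_mult)
qed

text \<open>For \<open>p > 0\<close> the power map is an order isomorphism with inverse exponent
  \<open>1 / p\<close>. In this form powers pass through suprema without any continuity
  argument.\<close>

lemma ennpowr_le_iff:
  assumes "0 < p"
  shows "ennpowr x p \<le> y \<longleftrightarrow> x \<le> ennpowr y (1 / p)"
proof
  assume "ennpowr x p \<le> y"
  from ennpowr_mono[OF _ this, of "1 / p"] show "x \<le> ennpowr y (1 / p)"
    using assms by (simp add: ennpowr_ennpowr ennpowr_1)
next
  assume "x \<le> ennpowr y (1 / p)"
  from ennpowr_mono[OF assms this] show "ennpowr x p \<le> y"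
    using assms by (simp add: ennpowr_ennpowr ennpowr_1)
qed

lemma ennpowr_SUP_le:
  assumes "0 < p" "\<And>i. i \<in> I \<Longrightarrow> ennpowr (f i) p \<le> y"
  shows "ennpowr (SUP i\<in>I. f i) p \<le> y"
  using assms by (simp add: ennpowr_le_iff SUP_le_iff)

text \<open>Convexity gives the inequality with the number \<open>N\<close> of terms as divisor.
  Since \<open>N / m \<le> 1\<close> and \<open>q \<ge> 1\<close>, the factor
  \<open>(N / m) powr q\<close> is at most \<open>N / m\<close>, which replaces \<open>N\<close> by
  \<open>m\<close>.\<close>

lemma powr_mean_le:
  fixes a :: "'a \<Rightarrow> real"
  assumes q: "1 \<le> q" and I: "finite I" "card I \<le> m" "0 < m" and a: "\<And>i. i \<in> I \<Longrightarrow> 0 < a i"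
  shows "((\<Sum>i\<in>I. a i) / real m) powr q \<le> (\<Sum>i\<in>I. a i powr q) / real m"
proof (cases "I = {}")
  case False
  define N where "N = card I"
  have N: "0 < N" "N \<le> m" using False I by (auto simp: N_def card_gt_0_iff)
  have "(\<Sum>i\<in>I. (1 / real N) *\<^sub>R a i) powr q \<le> (\<Sum>i\<in>I. (1 / real N) * (a i powr q))"
    by (rule convex_on_sum[OF I(1) False powr_convex[OF q]]) (use N a in \<open>auto simp: N_def\<close>)
  then have mean: "((\<Sum>i\<in>I. a i) / real N) powr q \<le> (\<Sum>i\<in>I. a i powr q) / real N"
    by (simp add: sum_divide_distrib)
  have frac: "(real N / real m) powr q \<le> real N / real m"
    using N q powr_mono'[of 1 q "real N / real m"] by simp
  have "((\<Sum>i\<in>I. a i) / real m) powr q = ((real N / real m) * ((\<Sum>i\<in>I. a i) / real N)) powr q"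
    using N by simp
  also have "\<dots> = (real N / real m) powr q * ((\<Sum>i\<in>I. a i) / real N) powr q"
    by (rule powr_mult)
  also have "\<dots> \<le> (real N / real m) * ((\<Sum>i\<in>I. a i powr q) / real N)"
    by (intro mult_mono frac mean) auto
  also have "\<dots> = (\<Sum>i\<in>I. a i powr q) / real m"
    using N by simp
  finally show ?thesis .
qed simp

lemma ennpowr_mean_le:
  fixes a :: "'a \<Rightarrow> ennreal"
  assumes q: "1 \<le> q" and I: "finite I" "card I \<le> m" "0 < m"
  shows "ennpowr (ennreal (1 / real m) * (\<Sum>i\<in>I. a i)) q \<le> ennreal (1 / real m) * (\<Sum>i\<in>I. ennpowr (a i) q)"
proof (cases "\<exists>i\<in>I. a i = top_class.top")
  case True
  then obtain i where i: "i \<in> I" "a i = \<infinity>" by auto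
  have "(\<Sum>i\<in>I. ennpowr (a i) q) = top_class.top"
    using sum.remove[OF I(1) i(1), of "\<lambda>i. ennpowr (a i) q"] i(2) by simp
  then show ?thesis using I(3) by (simp add: ennreal_mult_top)
next
  case False
  define b where "b i = enn2real (a i)" for i
  have ab: "a i = ennreal (b i)" "0 \<le> b i" if "i \<in> I" for i
    using False that by (auto simp: b_def less_top)
  \<comment> \<open>Zero terms are dropped to meet the positivity hypothesis of
    \<open>powr_mean_le\<close>; this changes neither sum and only lowers the number of
    terms.\<close>
  define J where "J = {i \<in> I. 0 < b i}"
  have J: "finite J" "card J \<le> m" "\<And>i. i \<in> J \<Longrightarrow> 0 < b i"
    using I by (auto simp: J_def intro: order_trans[OF card_mono])
  have s1: "(\<Sum>i\<in>I. b i) = (\<Sum>i\<in>J. b i)"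
    using I(1) ab(2) by (intro sum.mono_neutral_right) (auto simp: J_def less_le)
  have s2: "(\<Sum>i\<in>I. b i powr q) = (\<Sum>i\<in>J. b i powr q)"
    using I(1) ab(2) q by (intro sum.mono_neutral_right) (auto simp: J_def less_le)
  have "ennreal (1 / real m) * (\<Sum>i\<in>I. a i) = ennreal ((\<Sum>i\<in>J. b i) / real m)"
    using ab by (simp add: sum_ennreal s1 sum_nonneg J(3) less_imp_le flip: ennreal_mult)
  then have "ennpowr (ennreal (1 / real m) * (\<Sum>i\<in>I. a i)) q = ennreal (((\<Sum>i\<in>J. b i) / real m) powr q)"
    using J(3) by (simp add: ennpowr_ennreal sum_nonneg less_imp_le)
  also have "\<dots> \<le> ennreal ((\<Sum>i\<in>J. b i powr q) / real m)"
    by (intro ennreal_leI powr_mean_le[OF q J(1,2) I(3) J(3)])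
  also have "\<dots> = ennreal (1 / real m) * (\<Sum>i\<in>I. ennpowr (a i) q)"
    using ab by (simp add: ennpowr_ennreal sum_ennreal s2 sum_nonneg flip: ennreal_mult)
  finally show ?thesis .
qed

section \<open>Integrals over expanding pieces\<close>

lemma expanding_inj_on:
  assumes "0 < c" "\<And>x y. x \<in> C \<Longrightarrow> y \<in> C \<Longrightarrow> c * dist x y \<le> dist (f x) (f y)"
  shows "inj_on f C"
proof (rule inj_onI)
  fix x y assume xy: "x \<in> C" "y \<in> C" "f x = f y"
  then have "c * dist x y \<le> 0" using assms(2)[of x y] by simp
  then show "x = y" using assms(1) by (simp add: mult_le_0_iff)
qed

text \<open>A continuous injection of a compact set is a homeomorphism onto its image, so Borel sets
  go to Borel sets and the inverse is Borel.\<close>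

lemma
  fixes f :: "'a::{t2_space,second_countable_topology} \<Rightarrow> 'b::t2_space"
  assumes C: "compact C" and f: "continuous_on C f" and inj: "inj_on f C" and G: "G \<in> sets borel" "G \<subseteq> C"
  shows image_borel_compact: "f ` G \<in> sets borel"
    and inv_into_borel_measurable: "inv_into C f \<in> borel_measurable (restrict_space borel (f ` G))"
proof -
  have "continuous_on (f ` C) (inv_into C f)"
    using continuous_on_inv[OF f C] inj by (simp add: inv_into_f_f)
  then have meas: "inv_into C f \<in> borel_measurable (restrict_space borel (f ` C))"
    by (rule borel_measurable_continuous_on_restrict)
  have fC: "f ` C \<in> sets borel"
    using compact_continuous_image[OF f C] by (rule borel_compact)
  have "inv_into C f -` G \<inter> space (restrict_space borel (f ` C)) \<in> sets (restrict_space borel (f ` C))"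
    by (rule measurable_sets[OF meas G(1)])
  moreover have "inv_into C f -` G \<inter> space (restrict_space borel (f ` C)) = f ` G"
    using inj G(2) by (auto simp: space_restrict_space inv_into_f_f subset_iff)
  ultimately show fG: "f ` G \<in> sets borel"
    using fC by (simp add: sets_restrict_space_iff)
  have "f ` G \<subseteq> f ` C" using G(2) by blast
  then show "inv_into C f \<in> borel_measurable (restrict_space borel (f ` G))"
    by (rule measurable_restrict_mono[OF meas])
qed

lemma measurable_restrict_space_mono_sets:
  assumes g: "g \<in> restrict_space borel T \<rightarrow>\<^sub>M L" and M: "sets borel \<subseteq> sets M" "space M = UNIV"
  shows "g \<in> restrict_space M T \<rightarrow>\<^sub>M L"
proof (rule measurableI)
  show "g x \<in> space L" if "x \<in> space (restrict_space M T)" for x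
    using that measurable_space[OF g] M(2) by (simp add: space_restrict_space)
  show "g -` A \<inter> space (restrict_space M T) \<in> sets (restrict_space M T)" if "A \<in> sets L" for A
    using measurable_sets[OF g that] M by (auto simp: space_restrict_space sets_restrict_space)
qed

text \<open>\<open>nn_integral_inverse_image_le\<close> with the inverse of \<open>f\<close> in the
  role of \<open>g\<close>: the preimage of \<open>B\<close> under this inverse is the image of
  \<open>B\<close> under \<open>f\<close>, whose measure the Jacobian bounds.\<close>

lemma nn_integral_inv_into_le_Jacobian:
  fixes f :: "real ^ 'n::finite \<Rightarrow> real ^ 'n"
  assumes C: "compact C" and f: "continuous_on C f" and inj: "inj_on f C" and G: "G \<in> sets borel" "G \<subseteq> C"
    and der: "\<And>x. x \<in> G \<Longrightarrow> (f has_derivative f' x) (at x)" and h: "h \<in> borel_measurable borel"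
  shows "(\<integral>\<^sup>+y\<in>f ` G. h (inv_into C f y) \<partial>lebesgue) \<le> (\<integral>\<^sup>+x\<in>G. h x * ennreal \<bar>det (matrix (f' x))\<bar> \<partial>lebesgue)"
proof (rule nn_integral_inverse_image_le)
  note img = image_borel_compact[OF C f inj] and inv = inv_into_borel_measurable[OF C f inj]
  have derS: "(f has_derivative f' x) (at x within S)" if "x \<in> G" for x S
    using der[OF that] by (rule has_derivative_at_withinI)
  show "f ` G \<in> sets lebesgue" "sets borel \<subseteq> sets (lebesgue :: (real ^ 'n) measure)"
    "sets borel \<subseteq> sets (lebesgue :: (real ^ 'n) measure)" "G \<in> sets borel"
    using img[OF G] G by auto
  show "inv_into C f \<in> borel_measurable (restrict_space lebesgue (f ` G))"
    by (rule measurable_restrict_space_mono_sets[OF inv[OF G]]) auto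
  show "(\<lambda>x. ennreal \<bar>det (matrix (f' x))\<bar> * indicator G x) \<in> borel_measurable lebesgue"
    by (rule borel_measurable_abs_det_Jacobian[OF G(1) img[OF G] derS])
  show "inv_into C f ` f ` G \<subseteq> G"
    using inj G(2) by (auto simp: inv_into_f_f subset_iff)
  fix B :: "(real ^ 'n) set" assume B: "B \<in> sets borel" "B \<subseteq> G"
  then have BC: "B \<subseteq> C" using G by blast
  have "f ` G \<inter> inv_into C f -` B = f ` B"
    using inj G(2) B(2) BC by (auto simp: inv_into_f_f subset_iff)
  then show "emeasure lebesgue (f ` G \<inter> inv_into C f -` B) \<le> (\<integral>\<^sup>+x\<in>B. ennreal \<bar>det (matrix (f' x))\<bar> \<partial>lebesgue)"
    using emeasure_differentiable_image_le[OF B(1) img[OF B(1) BC] derS] B(2) by auto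
qed (use h in auto)

lemma space_hausdorff_measure [simp]: "space (hausdorff_measure k) = UNIV"
  by (simp add: hausdorff_measure_def)

lemma borel_measurable_hausdorff_measure:
  assumes k: "0 < k" and f: "f \<in> borel_measurable borel"
  shows "f \<in> borel_measurable (hausdorff_measure k)"
  using f sets_borel_subset_hausdorff_measure[OF k] by (auto simp: measurable_def)

text \<open>Stands in for an area formula. The roles are swapped against the Lebesgue estimate: here
  \<open>f\<close> itself is the map \<open>g\<close> of
  \<open>nn_integral_inverse_image_le\<close>, and expansion bounds the measure of preimages with
  the constant weight \<open>(1 / c) ^ k\<close>.\<close>

lemma hausdorff_nn_integral_expanding:
  fixes f :: "'a::{metric_space,second_countable_topology} \<Rightarrow> 'b::metric_space"
  assumes k: "0 < k" and C: "compact C" and f: "continuous_on C f" and G: "G \<in> sets borel" "G \<subseteq> C"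
    and c: "0 < c" and ex: "\<And>x y. x \<in> C \<Longrightarrow> y \<in> C \<Longrightarrow> c * dist x y \<le> dist (f x) (f y)"
    and h: "h \<in> borel_measurable borel"
  shows "(\<integral>\<^sup>+x\<in>G. h x \<partial>hausdorff_measure k)
    \<le> (\<integral>\<^sup>+y\<in>f ` G. h (inv_into C f y) * ennreal ((1 / c) ^ k) \<partial>hausdorff_measure k)"
proof -
  have inj: "inj_on f C" by (rule expanding_inj_on[OF c ex])
  note img = image_borel_compact[OF C f inj] and inv = inv_into_borel_measurable[OF C f inj]
  note sub = sets_borel_subset_hausdorff_measure[OF k]
  \<comment> \<open>\<open>h\<close> transported to the image side, so that it has the form of a
    Borel function composed with \<open>f\<close>.\<close>
  define h' where "h' y = h (inv_into C f y) * indicator (f ` G) y" for y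
  have h': "h' \<in> borel_measurable borel"
    unfolding h'_def using measurable_compose[OF inv[OF G] h] img[OF G]
    by (subst (asm) borel_measurable_restrict_space_iff_ennreal) auto
  have "(\<integral>\<^sup>+x\<in>G. h x \<partial>hausdorff_measure k) = (\<integral>\<^sup>+x\<in>G. h' (f x) \<partial>hausdorff_measure k)"
    by (rule nn_integral_cong) (use inj G in \<open>auto simp: h'_def indicator_def inv_into_f_f subset_iff\<close>)
  also have "\<dots> \<le> (\<integral>\<^sup>+y\<in>f ` G. h' y * ennreal ((1 / c) ^ k) \<partial>hausdorff_measure k)"
  proof (rule nn_integral_inverse_image_le)
    show "f \<in> borel_measurable (restrict_space (hausdorff_measure k) G)"
      by (rule measurable_restrict_space_mono_sets[OF borel_measurable_continuous_on_restrict])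
        (use continuous_on_subset[OF f G(2)] sub in auto)
    show "(\<lambda>y. ennreal ((1 / c) ^ k) * indicator (f ` G) y) \<in> borel_measurable (hausdorff_measure k)"
      by (rule borel_measurable_hausdorff_measure[OF k]) (use img[OF G] in simp)
    fix B :: "'b set" assume B: "B \<in> sets borel" "B \<subseteq> f ` G"
    define A where "A = G \<inter> f -` B"
    have fA: "f ` A = B" using B(2) by (auto simp: A_def)
    have "A \<subseteq> C" "A \<in> sets (hausdorff_measure k)"
    proof -
      have "f -` B \<inter> space (restrict_space borel G) \<in> sets (restrict_space borel G)"
        by (rule measurable_sets[OF borel_measurable_continuous_on_restrict[OF continuous_on_subset[OF f G(2)]] B(1)])
      then have "A \<in> sets borel"
        using G(1) by (simp add: sets_restrict_space_iff space_restrict_space A_def Int_commute)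
      then show "A \<in> sets (hausdorff_measure k)" using sub by blast
    qed (use G in \<open>auto simp: A_def\<close>)
    have "emeasure (hausdorff_measure k) A = hausdorff_outer_measure k A"
      by (rule emeasure_hausdorff_measure[OF k]) fact
    also have "\<dots> = ennreal ((1 / c) ^ k) * (ennreal (c ^ k) * hausdorff_outer_measure k A)"
      using c by (simp add: power_one_over flip: mult.assoc ennreal_mult)
    also have "\<dots> \<le> ennreal ((1 / c) ^ k) * hausdorff_outer_measure k (f ` A)"
      by (intro mult_left_mono hausdorff_outer_measure_expanding[OF c ex]) (use \<open>A \<subseteq> C\<close> in auto)
    also have "hausdorff_outer_measure k (f ` A) = emeasure (hausdorff_measure k) B"
      unfolding fA by (rule emeasure_hausdorff_measure[OF k, symmetric]) (use B sub in blast)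
    also have "ennreal ((1 / c) ^ k) * emeasure (hausdorff_measure k) B = (\<integral>\<^sup>+y\<in>B. ennreal ((1 / c) ^ k) \<partial>hausdorff_measure k)"
      by (rule nn_integral_cmult_indicator[symmetric]) (use B sub in blast)
    finally show "emeasure (hausdorff_measure k) (G \<inter> f -` B) \<le> (\<integral>\<^sup>+y\<in>B. ennreal ((1 / c) ^ k) \<partial>hausdorff_measure k)"
      unfolding A_def .
  qed (use G img[OF G] sub h' in auto)
  also have "\<dots> = (\<integral>\<^sup>+y\<in>f ` G. h (inv_into C f y) * ennreal ((1 / c) ^ k) \<partial>hausdorff_measure k)"
    by (rule nn_integral_cong) (auto simp: h'_def indicator_def)
  finally show ?thesis .
qed

text \<open>The counting step over one point \<open>y\<close>: \<open>x i\<close> is its preimage in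
  piece \<open>i\<close> with weight \<open>a i\<close>, the \<open>\<alpha> j\<close> are the lifts
  and \<open>Z\<close> is the fibre of the given surface. Summation is regrouped by parameters
  \<open>z\<close>; at each of them \<open>m\<close> lifts reach at most \<open>m\<close> of the
  points \<open>x i\<close>, and by \<open>one\<close> each point is reached at most once.\<close>

lemma lift_multiplicity_sum_le:
  fixes a :: "nat \<Rightarrow> ennreal" and x :: "nat \<Rightarrow> 'x" and \<alpha> :: "nat \<Rightarrow> 'z \<Rightarrow> 'x"
  assumes m: "0 < m" and inj: "inj_on x {i. a i \<noteq> 0}"
    and sub: "\<And>i j z. \<lbrakk>a i \<noteq> 0; j \<in> {1..m}; z \<in> \<omega> j; \<alpha> j z = x i\<rbrakk> \<Longrightarrow> z \<in> Z"
    and one: "\<And>i z. \<lbrakk>a i \<noteq> 0; z \<in> Z\<rbrakk> \<Longrightarrow> card {j \<in> {1..m}. z \<in> \<omega> j \<and> \<alpha> j z = x i} \<le> 1"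
  shows "(\<Sum>j\<in>{1..m}. suminf (\<lambda>i. a i * emeasure (count_space UNIV) {z \<in> \<omega> j. \<alpha> j z = x i}))
    \<le> (SUP I\<in>{I. finite I \<and> card I \<le> m}. \<Sum>i\<in>I. a i) * emeasure (count_space UNIV) Z"
    (is "?L \<le> ?S * _")
proof (cases "finite Z")
  case False
  \<comment> \<open>For infinite \<open>Z\<close> the right side is infinite unless all weights
    vanish.\<close>
  show ?thesis
  proof (cases "\<forall>i. a i = 0")
    case False
    then obtain i where "a i \<noteq> 0" by blast
    moreover have "a i \<le> ?S" by (rule SUP_upper2[of "{i}"]) (use m in auto)
    ultimately have "?S \<noteq> 0" by auto
    then show ?thesis using \<open>infinite Z\<close> by (simp add: ennreal_mult_top)
  qed simp
next
  case True
  define e where "e j i z = (if z \<in> \<omega> j \<and> \<alpha> j z = x i then a i else 0)" for j i z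
  have cnt: "a i * emeasure (count_space UNIV) {z \<in> \<omega> j. \<alpha> j z = x i} = (\<Sum>z\<in>Z. e j i z)" if j: "j \<in> {1..m}" for i j
  proof (cases "a i = 0")
    case False
    have sZ: "{z \<in> \<omega> j. \<alpha> j z = x i} \<subseteq> Z" using sub[OF False j] by blast
    then have "finite {z \<in> \<omega> j. \<alpha> j z = x i}" using True finite_subset by blast
    moreover have "(\<Sum>z\<in>Z. e j i z) = (\<Sum>z\<in>{z \<in> \<omega> j. \<alpha> j z = x i}. a i)"
      unfolding e_def using True sZ by (intro sum.mono_neutral_cong_right) auto
    ultimately show ?thesis by (simp add: mult.commute)
  next
    case True
    then have "e j i z = 0" for z by (simp add: e_def)
    then show ?thesis using True by simp
  qed
  have "?L = (\<Sum>j\<in>{1..m}. suminf (\<lambda>i. \<Sum>z\<in>Z. e j i z))"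
    using cnt by simp
  also have "\<dots> = (\<Sum>j\<in>{1..m}. \<Sum>z\<in>Z. suminf (\<lambda>i. e j i z))"
    by (intro sum.cong refl suminf_sum) auto
  also have "\<dots> = (\<Sum>z\<in>Z. \<Sum>j\<in>{1..m}. suminf (\<lambda>i. e j i z))"
    by (rule sum.swap)
  also have "\<dots> = (\<Sum>z\<in>Z. suminf (\<lambda>i. \<Sum>j\<in>{1..m}. e j i z))"
    by (intro sum.cong refl suminf_sum[symmetric]) auto
  also have "\<dots> \<le> (\<Sum>z\<in>Z. ?S)"
  proof (rule sum_mono)
    fix z assume z: "z \<in> Z"
    \<comment> \<open>The indices of the points reached at parameter \<open>z\<close>. Choosing for
      each a lift that reaches it is injective, because a lift has only one value at
      \<open>z\<close> and \<open>x\<close> is injective; hence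
      \<open>card I \<le> m\<close>.\<close>
    define I where "I = {i. a i \<noteq> 0 \<and> (\<exists>j\<in>{1..m}. z \<in> \<omega> j \<and> \<alpha> j z = x i)}"
    define w where "w i = (SOME j. j \<in> {1..m} \<and> z \<in> \<omega> j \<and> \<alpha> j z = x i)" for i
    have w: "w i \<in> {1..m} \<and> z \<in> \<omega> (w i) \<and> \<alpha> (w i) z = x i" if "i \<in> I" for i
      unfolding w_def by (rule someI_ex) (use that in \<open>auto simp: I_def\<close>)
    have "inj_on w I"
    proof (rule inj_onI)
      fix i i' assume ii: "i \<in> I" "i' \<in> I" "w i = w i'"
      then have "x i = x i'" using w[of i] w[of i'] by metis
      then show "i = i'" using inj_onD[OF inj] ii by (auto simp: I_def)
    qed
    moreover have "w ` I \<subseteq> {1..m}" using w by blast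
    ultimately have I: "finite I" "card I \<le> m"
      using inj_on_finite[of w I "{1..m}"] card_inj_on_le[of w I "{1..m}"] by auto
    have "(\<Sum>j\<in>{1..m}. e j i z) = 0" if "i \<notin> I" for i
      using that by (auto simp: e_def I_def intro!: sum.neutral)
    then have "suminf (\<lambda>i. \<Sum>j\<in>{1..m}. e j i z) = (\<Sum>i\<in>I. \<Sum>j\<in>{1..m}. e j i z)"
      by (rule suminf_finite[OF I(1)])
    also have "\<dots> \<le> (\<Sum>i\<in>I. a i)"
    proof (rule sum_mono)
      fix i assume i: "i \<in> I"
      have "(\<Sum>j\<in>{1..m}. e j i z) = (\<Sum>j\<in>{j \<in> {1..m}. z \<in> \<omega> j \<and> \<alpha> j z = x i}. a i)"
        unfolding e_def by (intro sum.mono_neutral_cong_right) auto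
      also have "\<dots> = of_nat (card {j \<in> {1..m}. z \<in> \<omega> j \<and> \<alpha> j z = x i}) * a i" by simp
      also have "\<dots> \<le> of_nat 1 * a i"
        using one[of i z] i z by (intro mult_right_mono of_nat_mono) (auto simp: I_def)
      finally show "(\<Sum>j\<in>{1..m}. e j i z) \<le> a i" by simp
    qed
    also have "\<dots> \<le> ?S" by (rule SUP_upper) (use I in auto)
    finally show "suminf (\<lambda>i. \<Sum>j\<in>{1..m}. e j i z) \<le> ?S" .
  qed
  also have "\<dots> = ?S * emeasure (count_space UNIV) Z"
    using True by (simp add: mult.commute)
  finally show ?thesis .
qed

section \<open>The modulus inequality\<close>

lemma det_matrix_nonzero_of_inj:
  fixes A :: "real ^ 'n::finite \<Rightarrow> real ^ 'n"
  assumes "linear A" "inj A"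
  shows "det (matrix A) \<noteq> 0"
  using assms by (simp add: det_nz_iff_inj)

lemma inj_of_min_stretch_pos:
  fixes A :: "real ^ 'n::finite \<Rightarrow> real ^ 'n"
  assumes lin: "linear A" and pos: "0 < min_stretch A"
  shows "inj A"
  unfolding linear_injective_0[OF lin]
proof (intro allI impI)
  fix h assume "A h = 0"
  then have "min_stretch A * norm h \<le> 0" using min_stretch_le[OF lin, of h] by simp
  then show "h = 0" using pos by (simp add: mult_le_0_iff)
qed

text \<open>\<open>min_stretch A \<le> t * c\<close> turns \<open>(1 / c) powr p\<close> into at
  most \<open>t powr p / min_stretch A powr p\<close>. The bound from below by \<open>c > 0\<close>
  makes the derivative invertible, so the first case of \<open>inner_dilatation\<close>
  applies.\<close>

lemma inner_dilatation_lower_bound: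
  fixes f :: "real ^ 'n::finite \<Rightarrow> real ^ 'n"
  assumes p: "0 < p" and t: "0 < t" and c: "0 < c" and diff: "f differentiable (at x)"
    and A: "A = frechet_derivative f (at x)" and le: "c \<le> min_stretch A" "min_stretch A \<le> t * c"
  shows "ennpowr (ennreal (1 / c) * r) p * ennreal \<bar>det (matrix A)\<bar>
    \<le> ennreal (t powr p) * (inner_dilatation p f x * ennpowr r p)"
proof -
  have der: "(f has_derivative A) (at x)" unfolding A using diff by (simp add: frechet_derivative_works)
  have lin: "linear A" using der by (rule has_derivative_linear)
  have l: "0 < min_stretch A" using c le by linarith
  have "det (matrix A) \<noteq> 0"
    by (rule det_matrix_nonzero_of_inj[OF lin inj_of_min_stretch_pos[OF lin l]])
  then have K: "inner_dilatation p f x = ennreal (\<bar>det (matrix A)\<bar> / min_stretch A powr p)"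
    using diff by (simp add: inner_dilatation_def jacobian_def flip: A)
  have "(1 / c) powr p * \<bar>det (matrix A)\<bar> \<le> t powr p * (\<bar>det (matrix A)\<bar> / min_stretch A powr p)"
  proof -
    have "min_stretch A powr p \<le> (t * c) powr p"
      using le(2) l p by (intro powr_mono2) auto
    then have "(1 / c) powr p \<le> t powr p / min_stretch A powr p"
      using c t l by (simp add: powr_mult powr_divide field_simps)
    then show ?thesis using mult_right_mono[of _ _ "\<bar>det (matrix A)\<bar>"] by fastforce
  qed
  then have *: "ennreal ((1 / c) powr p) * ennreal \<bar>det (matrix A)\<bar> \<le> ennreal (t powr p) * inner_dilatation p f x"
    unfolding K using l by (simp add: ennreal_leI flip: ennreal_mult)
  have "ennpowr (ennreal (1 / c) * r) p * ennreal \<bar>det (matrix A)\<bar>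
      = (ennreal ((1 / c) powr p) * ennreal \<bar>det (matrix A)\<bar>) * ennpowr r p"
    using c by (simp add: ennpowr_mult[OF p] ennpowr_ennreal mult_ac)
  also have "\<dots> \<le> (ennreal (t powr p) * inner_dilatation p f x) * ennpowr r p"
    by (intro mult_right_mono *) simp
  finally show ?thesis by (simp add: mult_ac)
qed

text \<open>The \<open>A\<close>-property concerns liftings with the same domain as the lifted
  surface, so a partial lift is treated as a lifting of the restriction of \<open>\<beta>\<close> to
  its own domain.\<close>

lemma surface_in_restrict:
  assumes S: "surface_in A (\<omega>, \<beta>)" and S': "surface_in D (\<omega>', \<alpha>)"
    and sub: "\<omega>' \<subseteq> \<omega>" and lift: "\<And>z. z \<in> \<omega>' \<Longrightarrow> \<beta> z = f (\<alpha> z)"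
  shows "surface_in (f ` D) (\<omega>', \<beta>)"
  unfolding surface_in_def fst_conv snd_conv
proof (intro conjI)
  show "openin (Alexandroff_compactification euclidean) \<omega>'"
    using S' by (simp add: surface_in_def)
  show "continuous_map (subtopology (Alexandroff_compactification euclidean) \<omega>') euclidean \<beta>"
    using S sub by (auto simp: surface_in_def intro: continuous_map_from_subtopology_mono)
  show "\<beta> ` \<omega>' \<subseteq> f ` D"
    using S' lift by (auto simp: surface_in_def)
qed

lemma multiplicity_fun_mono:
  assumes "\<omega>' \<subseteq> \<omega>"
  shows "multiplicity_fun (\<omega>', \<beta>) y \<le> multiplicity_fun (\<omega>, \<beta>) y"
  unfolding multiplicity_fun_def by (rule emeasure_mono) (use assms in auto)

text \<open>If \<open>\<beta>\<close> has no area in \<open>F\<close>, then \<open>F\<close> meets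
  its image in a Hausdorff null set. The part of the lift in \<open>N\<close> is mapped into this
  null set, and the \<open>A\<close>-property \<open>P\<close> pulls it back to a null set.\<close>

lemma lift_exceptional_null:
  fixes S :: "('k::finite, 'n::finite) surface"
  assumes beta: "surface_in A (\<omega>, \<beta> :: (real ^ 'k) option \<Rightarrow> real ^ 'n)"
    and F: "F \<in> sets borel" and F0: "(\<integral>\<^sup>+y\<in>F. multiplicity_fun (\<omega>, \<beta>) y \<partial>hausdorff_measure CARD('k)) = 0"
    and P: "\<And>S. lifting D f S (\<omega>', \<beta>) \<Longrightarrow>
         (\<forall>B \<subseteq> snd S ` fst S. area_null (\<omega>', \<beta>) (f ` B) \<longrightarrow> area_null S B)"
    and lift: "lifting D f (\<omega>', \<alpha>) (\<omega>', \<beta>)" and sub: "\<omega>' \<subseteq> \<omega>"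
    and N: "f ` N \<subseteq> F"
  shows "N \<inter> \<alpha> ` \<omega>' \<in> null_sets (hausdorff_measure CARD('k))"
proof -
  let ?H = "hausdorff_measure CARD('k) :: (real ^ 'n) measure"
  have k: "0 < CARD('k)" by simp
  note bor = sets_borel_subset_hausdorff_measure[OF k, where ?'a = "real ^ 'n"]
  have FB: "F \<inter> \<beta> ` \<omega> \<in> null_sets ?H"
  proof -
    have "F \<inter> \<beta> ` \<omega> \<in> sets ?H"
      using F surface_image_borel[OF beta] bor by auto
    moreover have "emeasure ?H (F \<inter> \<beta> ` \<omega>) = 0"
    proof -
      have "emeasure ?H (F \<inter> \<beta> ` \<omega>) = (\<integral>\<^sup>+y. indicator (F \<inter> \<beta> ` \<omega>) y \<partial>?H)"
        using \<open>F \<inter> \<beta> ` \<omega> \<in> sets ?H\<close> by simp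
      also have "\<dots> \<le> (\<integral>\<^sup>+y\<in>F. multiplicity_fun (\<omega>, \<beta>) y \<partial>?H)"
        by (rule nn_integral_mono) (use one_le_multiplicity_fun[of _ "(\<omega>, \<beta>)"] in \<open>auto simp: indicator_def\<close>)
      finally show ?thesis using F0 by simp
    qed
    ultimately show ?thesis by (simp add: null_sets_def)
  qed
  have lift': "\<beta> z = f (\<alpha> z)" if "z \<in> \<omega>'" for z using lift that by (simp add: lifting_def)
  let ?B = "N \<inter> \<alpha> ` \<omega>'"
  have fB: "f ` ?B \<subseteq> F \<inter> \<beta> ` \<omega>"
  proof
    fix y assume "y \<in> f ` ?B"
    then obtain z where z: "z \<in> \<omega>'" "\<alpha> z \<in> N" "y = f (\<alpha> z)" by auto
    then have "y \<in> F" "y = \<beta> z" "z \<in> \<omega>" using N lift' sub by auto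
    then show "y \<in> F \<inter> \<beta> ` \<omega>" by blast
  qed
  have fB': "f ` ?B \<subseteq> \<beta> ` \<omega>'"
  proof
    fix y assume "y \<in> f ` ?B"
    then obtain z where z: "z \<in> \<omega>'" "y = f (\<alpha> z)" by auto
    then show "y \<in> \<beta> ` \<omega>'" using lift'[of z] by (metis imageI)
  qed
  have "area_null (\<omega>', \<beta>) (f ` ?B)"
    using area_null_iff[of "f ` ?B" "(\<omega>', \<beta>)"] fB' null_sets_hausdorff_subset[OF k FB fB] by simp
  then have "area_null (\<omega>', \<alpha>) ?B"
    using P[OF lift] by auto
  then show ?thesis
    using area_null_iff[of ?B "(\<omega>', \<alpha>)"] by simp
qed

lemma mult_indicator_inv_into_borel:
  fixes f :: "'a::{t2_space,second_countable_topology} \<Rightarrow> 'b::t2_space" and h :: "'a \<Rightarrow> ennreal"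
  assumes "compact C" "continuous_on C f" "inj_on f C" "G \<in> sets borel" "G \<subseteq> C" "h \<in> borel_measurable borel"
  shows "(\<lambda>y. h (inv_into C f y) * indicator (f ` G) y) \<in> borel_measurable borel"
  using measurable_compose[OF inv_into_borel_measurable[OF assms(1-5)] assms(6)] image_borel_compact[OF assms(1-5)]
  by (subst (asm) borel_measurable_restrict_space_iff_ennreal) auto

text \<open>Off \<open>N\<close> and the zero set of \<open>\<rho>\<close> the pieces cover, so the
  area integral is at most the sum over them. Moving each term to the image costs
  \<open>(1 / c i) ^ k\<close>, which is absorbed into the power of \<open>\<rho>\<close>; the
  multiplicity remains that of the lift.\<close>

lemma surface_integral_le_pieces:
  fixes f :: "real ^ 'n::finite \<Rightarrow> real ^ 'n" and \<alpha> :: "('k::finite, 'n) surface"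
  assumes C: "\<And>i::nat. compact (C i)" and f: "\<And>i. continuous_on (C i) f"
    and G: "\<And>i. G i \<in> sets borel" "\<And>i. G i \<subseteq> C i" and c: "\<And>i. 0 < c i"
    and ex: "\<And>i x y. x \<in> C i \<Longrightarrow> y \<in> C i \<Longrightarrow> c i * dist x y \<le> dist (f x) (f y)"
    and \<alpha>: "surface_in D \<alpha>" and \<rho>: "\<rho> \<in> borel_measurable borel"
    and null: "N \<inter> snd \<alpha> ` fst \<alpha> \<in> null_sets (hausdorff_measure CARD('k))"
    and cover: "\<And>x. x \<in> D \<Longrightarrow> \<rho> x \<noteq> 0 \<Longrightarrow> x \<notin> N \<Longrightarrow> x \<in> (\<Union>i. G i)"
  shows "surface_integral \<alpha> (\<lambda>y. \<rho> y ^ CARD('k)) \<le>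
     suminf (\<lambda>i. \<integral>\<^sup>+y. (ennreal (1 / c i) * \<rho> (inv_into (C i) f y)) ^ CARD('k) * indicator (f ` G i) y *
        multiplicity_fun \<alpha> (inv_into (C i) f y) \<partial>hausdorff_measure CARD('k))"
proof -
  let ?k = "CARD('k)" and ?H = "hausdorff_measure CARD('k) :: (real ^ 'n) measure"
  have k: "0 < ?k" by simp
  define h where "h x = \<rho> x ^ ?k * multiplicity_fun \<alpha> x" for x
  have N[measurable]: "multiplicity_fun \<alpha> \<in> borel_measurable borel" by (rule borel_measurable_multiplicity_fun[OF \<alpha>])
  have h: "h \<in> borel_measurable borel" unfolding h_def using \<rho> by measurable
  have hH: "(\<lambda>x. h x * indicator (G i) x) \<in> borel_measurable ?H" for i
    by (rule borel_measurable_hausdorff_measure[OF k]) (use h G(1)[of i] in measurable)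
  have "surface_integral \<alpha> (\<lambda>y. \<rho> y ^ ?k) = (\<integral>\<^sup>+x. h x \<partial>?H)"
    by (simp add: surface_integral_def h_def)
  also have "\<dots> \<le> (\<integral>\<^sup>+x. suminf (\<lambda>i. h x * indicator (G i) x) \<partial>?H)"
  proof (rule nn_integral_mono_AE)
    have "AE x in ?H. x \<notin> N \<inter> snd \<alpha> ` fst \<alpha>" using null by (rule AE_not_in)
    then show "AE x in ?H. h x \<le> suminf (\<lambda>i. h x * indicator (G i) x)"
    proof eventually_elim
      case (elim x)
      show ?case
      proof (cases "h x = 0")
        case False
        then have "\<rho> x \<noteq> 0" "x \<in> snd \<alpha> ` fst \<alpha>"
          using k multiplicity_fun_eq_0_iff[of \<alpha> x] by (auto simp: h_def)
        moreover then have "x \<in> D" using \<alpha> by (auto simp: surface_in_def)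
        ultimately have "x \<in> (\<Union>i. G i)" using cover elim by blast
        then obtain i where "x \<in> G i" by blast
        then have "h x = (\<Sum>i\<in>{i}. h x * indicator (G i) x)" by simp
        also have "\<dots> \<le> suminf (\<lambda>i. h x * indicator (G i) x)"
          by (rule sum_le_suminf) auto
        finally show ?thesis .
      qed simp
    qed
  qed
  also have "\<dots> = suminf (\<lambda>i. \<integral>\<^sup>+x\<in>G i. h x \<partial>?H)"
    by (rule nn_integral_suminf) (rule hH)
  also have "\<dots> \<le> suminf (\<lambda>i. \<integral>\<^sup>+y\<in>f ` G i. h (inv_into (C i) f y) * ennreal ((1 / c i) ^ ?k) \<partial>?H)"
    by (intro suminf_le hausdorff_nn_integral_expanding k C f G c ex h) auto
  also have "\<dots> = suminf (\<lambda>i. \<integral>\<^sup>+y. (ennreal (1 / c i) * \<rho> (inv_into (C i) f y)) ^ ?k * indicator (f ` G i) y *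
        multiplicity_fun \<alpha> (inv_into (C i) f y) \<partial>?H)"
  proof (intro arg_cong[where f=suminf] ext nn_integral_cong)
    fix i y
    have "ennreal ((1 / c i) ^ ?k) = ennreal (1 / c i) ^ ?k"
      using c[of i] by (simp add: ennreal_power)
    then show "h (inv_into (C i) f y) * ennreal ((1 / c i) ^ ?k) * indicator (f ` G i) y =
      (ennreal (1 / c i) * \<rho> (inv_into (C i) f y)) ^ ?k * indicator (f ` G i) y * multiplicity_fun \<alpha> (inv_into (C i) f y)"
      by (simp add: h_def power_mult_distrib mult_ac)
  qed
  finally show ?thesis .
qed

text \<open>Each piece is moved back to the domain by the Jacobian estimate; disjointness leaves at
  most one nonzero term at every point, and there \<open>inner_dilatation_lower_bound\<close>
  applies.\<close>

lemma nn_integral_pieces_le: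
  fixes f :: "real ^ 'n::finite \<Rightarrow> real ^ 'n"
  assumes C: "\<And>i::nat. compact (C i)" and f: "\<And>i. continuous_on (C i) f"
    and G: "\<And>i. G i \<in> sets borel" "\<And>i. G i \<subseteq> C i" "disjoint_family G" "\<And>i. G i \<subseteq> D" and c: "\<And>i. 0 < c i"
    and inj: "\<And>i. inj_on f (C i)" and p: "0 < p" and t: "0 < t"
    and diff: "\<And>i x. x \<in> G i \<Longrightarrow> f differentiable (at x)"
    and ms: "\<And>i x. x \<in> G i \<Longrightarrow> c i \<le> min_stretch (frechet_derivative f (at x)) \<and> min_stretch (frechet_derivative f (at x)) \<le> t * c i"
    and \<rho>[measurable]: "\<rho> \<in> borel_measurable borel"
  shows "suminf (\<lambda>i. \<integral>\<^sup>+y\<in>f ` G i. ennpowr (ennreal (1 / c i) * \<rho> (inv_into (C i) f y)) p \<partial>lebesgue)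
    \<le> ennreal (t powr p) * (\<integral>\<^sup>+x\<in>D. inner_dilatation p f x * ennpowr (\<rho> x) p \<partial>lebesgue)"
    (is "?L \<le> _ * ?X")
proof -
  define h where "h i x = ennpowr (ennreal (1 / c i) * \<rho> x) p" for i x
  have h[measurable]: "h i \<in> borel_measurable borel" for i unfolding h_def by measurable
  define J where "J x = ennreal \<bar>det (matrix (frechet_derivative f (at x)))\<bar>" for x
  have der: "(f has_derivative frechet_derivative f (at x)) (at x)" if "x \<in> G i" for i x
    using diff[OF that] by (simp add: frechet_derivative_works)
  have JG: "(\<lambda>x. J x * indicator (G i) x) \<in> borel_measurable lebesgue" for i
    unfolding J_def
    by (rule borel_measurable_abs_det_Jacobian[OF G(1) image_borel_compact[OF C f inj G(1,2)]])
       (rule has_derivative_at_withinI[OF der])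
  have hJ: "(\<lambda>x. h i x * (J x * indicator (G i) x)) \<in> borel_measurable lebesgue" for i
    by (intro borel_measurable_times_ennreal JG) (use measurable_completion[of "h i" lborel borel] in simp)
  have "?L \<le> suminf (\<lambda>i. \<integral>\<^sup>+x. h i x * (J x * indicator (G i) x) \<partial>lebesgue)"
  proof (rule suminf_le)
    fix i
    have "(\<integral>\<^sup>+y\<in>f ` G i. h i (inv_into (C i) f y) \<partial>lebesgue) \<le> (\<integral>\<^sup>+x\<in>G i. h i x * J x \<partial>lebesgue)"
      unfolding J_def by (rule nn_integral_inv_into_le_Jacobian[OF C f inj G(1,2) der h])
    then show "(\<integral>\<^sup>+y\<in>f ` G i. ennpowr (ennreal (1 / c i) * \<rho> (inv_into (C i) f y)) p \<partial>lebesgue)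
       \<le> (\<integral>\<^sup>+x. h i x * (J x * indicator (G i) x) \<partial>lebesgue)"
      by (simp add: h_def mult.assoc)
  qed auto
  also have "\<dots> = (\<integral>\<^sup>+x. suminf (\<lambda>i. h i x * (J x * indicator (G i) x)) \<partial>lebesgue)"
    by (rule nn_integral_suminf[symmetric]) (rule hJ)
  \<comment> \<open>The constant is extracted from the measurable sum, because measurability of the
    integrand with \<open>inner_dilatation\<close> is not established; afterwards plain monotonicity
    suffices.\<close>
  also have "\<dots> = (\<integral>\<^sup>+x. ennreal (t powr p) * (ennreal (1 / t powr p) * suminf (\<lambda>i. h i x * (J x * indicator (G i) x))) \<partial>lebesgue)"
    using t by (simp flip: mult.assoc ennreal_mult)
  also have "\<dots> = ennreal (t powr p) * (\<integral>\<^sup>+x. ennreal (1 / t powr p) * suminf (\<lambda>i. h i x * (J x * indicator (G i) x)) \<partial>lebesgue)"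
    by (rule nn_integral_cmult) (intro borel_measurable_times_ennreal borel_measurable_suminf_order hJ, simp)
  also have "\<dots> \<le> ennreal (t powr p) * ?X"
  proof (intro mult_left_mono nn_integral_mono)
    fix x
    show "ennreal (1 / t powr p) * suminf (\<lambda>i. h i x * (J x * indicator (G i) x))
      \<le> inner_dilatation p f x * ennpowr (\<rho> x) p * indicator D x"
    proof (cases "\<exists>i. x \<in> G i")
      case True
      then obtain i where i: "x \<in> G i" by blast
      have "h j x * (J x * indicator (G j) x) = 0" if "j \<notin> {i}" for j
      proof -
        have "G i \<inter> G j = {}" using G(3) that by (auto simp: disjoint_family_on_def)
        then show ?thesis using i by (auto simp: indicator_def)
      qed
      then have "suminf (\<lambda>i. h i x * (J x * indicator (G i) x)) = (\<Sum>i\<in>{i}. h i x * (J x * indicator (G i) x))"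
        by (intro suminf_finite) auto
      also have "\<dots> = h i x * J x" using i by simp
      also have "\<dots> \<le> ennreal (t powr p) * (inner_dilatation p f x * ennpowr (\<rho> x) p)"
        unfolding h_def J_def
        by (rule inner_dilatation_lower_bound[OF p t c diff[OF i] refl]) (use ms[OF i] in auto)
      finally have "ennreal (1 / t powr p) * suminf (\<lambda>i. h i x * (J x * indicator (G i) x))
         \<le> ennreal (1 / t powr p) * (ennreal (t powr p) * (inner_dilatation p f x * ennpowr (\<rho> x) p))"
        by (rule mult_left_mono) simp
      also have "\<dots> = inner_dilatation p f x * ennpowr (\<rho> x) p"
        using t by (simp flip: mult.assoc ennreal_mult)
      finally show ?thesis using i G(4) by (auto simp: indicator_def)
    next
      case False
      then have "suminf (\<lambda>i. h i x * (J x * indicator (G i) x)) = suminf (\<lambda>i. 0)"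
        by (intro suminf_cong) auto
      then show ?thesis by simp
    qed
  qed simp
  finally show ?thesis .
qed

lemma modulus_exceptionalE:
  assumes "modulus p (\<Gamma> :: ('k::finite, 'n::finite) surface set) = 0" "0 < e"
  obtains \<eta> where "\<eta> \<in> adm \<Gamma>" "(\<integral>\<^sup>+x. ennpowr (\<eta> x) p \<partial>lebesgue) < e"
proof -
  have "modulus p \<Gamma> < e" using assms by simp
  then show thesis using that unfolding modulus_def INF_less_iff by blast
qed

text \<open>The inequality up to the factor \<open>t powr p\<close>, which is the price for knowing
  the minimal stretch on each piece only within a factor \<open>t\<close>.\<close>

lemma modulus_lift_le_factor:
  fixes f :: "real ^ 'n \<Rightarrow> real ^ 'n::finite"
    and D :: "(real ^ 'n) set"
    and \<Gamma> \<Gamma>' :: "('k::finite, 'n) surface set"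
  assumes p: "real CARD('k) \<le> p"
    and D: "open D" and f: "continuous_on D f"
    and disc: "\<forall>y. discrete {x \<in> D. f x = y}"
    and fmd: "finite_metric_distortion D f"
    and A2: "A2_property TYPE('k) p D f"
    and \<Gamma>: "\<forall>S \<in> \<Gamma>. surface_in D S"
    and \<Gamma>': "\<forall>S \<in> \<Gamma>'. surface_in (f ` D) S"
    and m: "0 < m"
    and lifts: "\<forall>(\<omega>, \<beta>) \<in> \<Gamma>'. \<exists>\<omega>s \<alpha>s.
           (\<forall>j \<in> {1..m}. (\<omega>s j, \<alpha>s j) \<in> \<Gamma> \<and> \<omega>s j \<subseteq> \<omega> \<and> (\<forall>z \<in> \<omega>s j. \<beta> z = f (\<alpha>s j z))) \<and>
           (\<forall>x \<in> D. \<forall>z \<in> \<omega>.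
              int (card {j \<in> {1..m}. z \<in> \<omega>s j \<and> \<alpha>s j z = x}) \<le> local_index D f x)"
    and \<rho>: "\<rho> \<in> adm \<Gamma>" and t: "1 < t"
  shows "modulus p \<Gamma>' \<le> ennreal (t powr p) *
     (ennreal (1 / real m) * (\<integral>\<^sup>+ x \<in> D. inner_dilatation p f x * ennpowr (\<rho> x) p \<partial>lebesgue))"
proof -
  let ?k = "CARD('k)"
  let ?H = "hausdorff_measure ?k :: (real ^ 'n) measure"
  define X where "X = (\<integral>\<^sup>+ x \<in> D. inner_dilatation p f x * ennpowr (\<rho> x) p \<partial>lebesgue)"
  have k: "0 < ?k" by simp
  have k1: "1 \<le> real ?k" by (metis One_nat_def Suc_leI k of_nat_1 of_nat_mono)
  have p0: "0 < p" using p k1 by linarith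
  have \<rho>b[measurable]: "\<rho> \<in> borel_measurable borel" using \<rho> by (simp add: adm_def)

  \<comment> \<open>Expanding pieces and the points they miss\<close>
  obtain C E c where c: "\<And>i::nat. 0 < c i" and C: "\<And>i. compact (C i)" "\<And>i. C i \<subseteq> D"
    and E: "\<And>i. E i \<in> sets borel" "\<And>i. E i \<subseteq> C i" "disjoint_family E"
    and ex: "\<And>i x y. x \<in> C i \<Longrightarrow> y \<in> C i \<Longrightarrow> c i * dist x y \<le> dist (f x) (f y)"
    and ms: "\<And>i x A. x \<in> E i \<Longrightarrow> (f has_derivative A) (at x) \<Longrightarrow> c i \<le> min_stretch A \<and> min_stretch A \<le> t * c i"
    and cov: "{x \<in> D. 0 < lower_stretch D f x \<and> upper_stretch D f x < \<infinity>} \<subseteq> (\<Union>i. E i)"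
    by (rule expansion_decomposition[OF D f t]) (rule that; assumption)
  have fC: "continuous_on (C i) f" for i using f C(2) continuous_on_subset by blast
  have injC: "inj_on f (C i)" for i by (rule expanding_inj_on[OF c ex])
  define Df where "Df = {x \<in> D. f differentiable (at x)}"
  have Df: "Df \<in> sets borel" unfolding Df_def by (rule differentiability_set_borel[OF D f])
  define G where "G i = E i \<inter> Df" for i
  have G: "G i \<in> sets borel" "G i \<subseteq> C i" "G i \<subseteq> D" for i
    using E Df by (auto simp: G_def Df_def)
  have Gdis: "disjoint_family G" using E(3) by (auto simp: G_def disjoint_family_on_def)
  have Gdiff: "f differentiable (at x)" if "x \<in> G i" for i x using that by (auto simp: G_def Df_def)
  have Gms: "c i \<le> min_stretch (frechet_derivative f (at x)) \<and> min_stretch (frechet_derivative f (at x)) \<le> t * c i"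
    if "x \<in> G i" for i x
    by (rule ms) (use that Gdiff[OF that] in \<open>auto simp: G_def frechet_derivative_works\<close>)
  have index: "local_index D f x \<le> 1" if x: "x \<in> G i" for i x
  proof -
    have d: "(f has_derivative frechet_derivative f (at x)) (at x)"
      using Gdiff[OF x] by (simp add: frechet_derivative_works)
    have "inj (frechet_derivative f (at x))"
      by (rule inj_of_min_stretch_pos[OF has_derivative_linear[OF d]])
         (use Gms[OF x] c[of i] in linarith)
    then show ?thesis
      using local_index_differentiable_le_1[OF D _ f _ d] disc G(3)[of i] x by blast
  qed
  \<comment> \<open>The points of the pieces that are lost in passing to \<open>G\<close> although
    \<open>\<rho>\<close> does not vanish there.\<close>
  define T where "T = {x \<in> (\<Union>i. E i). x \<notin> Df \<and> \<rho> x \<noteq> 0}"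
  have T: "T \<in> sets borel" "T \<subseteq> D"
  proof -
    have "T = ((\<Union>i. E i) - Df) \<inter> (\<rho> -` (- {0}) \<inter> space borel)" by (auto simp: T_def)
    moreover have "\<rho> -` (- {0}) \<inter> space borel \<in> sets borel" by (rule measurable_sets[OF \<rho>b]) auto
    ultimately show "T \<in> sets borel" using E(1) Df by auto
    show "T \<subseteq> D" using E(2) C(2) by (fastforce simp: T_def)
  qed
  show ?thesis
  proof (cases "X = \<infinity>")
    case True
    then show ?thesis using t m unfolding X_def[symmetric] by (simp add: ennreal_mult_top)
  next
    case Xfin: False
    \<comment> \<open>This replaces Stepanov's theorem: the inner dilatation is infinite where \<open>f\<close> is not differentiable,
      so finiteness of \<open>X\<close> forces \<open>\<rho>\<close> to vanish almost everywhere there.\<close>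
    have "T \<in> null_sets lebesgue"
    proof -
      have "\<infinity> * emeasure lebesgue T = (\<integral>\<^sup>+x. \<infinity> * indicator T x \<partial>lebesgue)"
        using T(1) by (subst nn_integral_cmult_indicator) auto
      also have "\<dots> \<le> X"
        unfolding X_def
      proof (rule nn_integral_mono)
        fix x
        show "\<infinity> * indicator T x \<le> inner_dilatation p f x * ennpowr (\<rho> x) p * indicator D x"
        proof (cases "x \<in> T")
          case xT: True
          then have "\<not> f differentiable (at x)" "\<rho> x \<noteq> 0" "x \<in> D"
            using T(2) by (auto simp: T_def Df_def)
          moreover have "ennpowr (\<rho> x) p \<noteq> 0"
            using \<open>\<rho> x \<noteq> 0\<close> ennpowr_le_iff[OF p0, of "\<rho> x" 0] by simp
          ultimately show ?thesis using xT by (simp add: inner_dilatation_def ennreal_top_mult)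
        qed simp
      qed
      finally have "emeasure lebesgue T = 0"
        using Xfin by (cases "emeasure lebesgue T = 0") (auto simp: ennreal_top_mult top_unique)
      then show ?thesis using T(1) by (simp add: null_sets_def)
    qed
    moreover have "D - (\<Union>i. E i) \<in> null_sets lebesgue"
    proof -
      have "AE x in lebesgue. x \<notin> D - (\<Union>i. E i)"
      proof -
        have "AE x in lebesgue. x \<in> D \<longrightarrow> 0 < lower_stretch D f x \<and> lower_stretch D f x \<le> upper_stretch D f x \<and> upper_stretch D f x < \<infinity>"
          using fmd by (simp add: finite_metric_distortion_def)
        then show ?thesis by eventually_elim (use cov in blast)
      qed
      moreover have "D - (\<Union>i. E i) \<in> sets lebesgue" using D E(1) by auto
      ultimately show ?thesis using AE_iff_null_sets by blast
    qed
    ultimately have N0null: "(D - (\<Union>i. E i)) \<union> T \<in> null_sets lebesgue" by auto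
    define N0 where "N0 = (D - (\<Union>i. E i)) \<union> T"
    have "N0 \<subseteq> D" "N0 \<in> null_sets lebesgue" using N0null T(2) by (auto simp: N0_def)
    then have "f ` N0 \<in> null_sets lebesgue"
      using fmd by (simp add: finite_metric_distortion_def)
    \<comment> \<open>The image of \<open>N0\<close> is only known to be Lebesgue null. A Borel null
      set around it can carry a Borel density and be integrated against Hausdorff measure.\<close>
    then obtain F where F: "F \<in> null_sets lborel" "f ` N0 \<subseteq> F"
      using null_sets_completion_iff2[of "f ` N0" lborel] by auto
    have Fb: "F \<in> sets borel" using F(1) by auto
    have cover: "x \<in> (\<Union>i. G i)" if "x \<in> D" "\<rho> x \<noteq> 0" "x \<notin> N0" for x
      using that by (auto simp: N0_def T_def G_def)

    \<comment> \<open>The density on the image side and its integral\<close>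
    define g where "g i = inv_into (C i) f" for i
    define a where "a i y = (ennreal (1 / c i) * \<rho> (g i y)) ^ ?k * indicator (f ` G i) y" for i y
    define \<sigma> where "\<sigma> y = (SUP I\<in>{I. finite I \<and> card I \<le> m}. \<Sum>i\<in>I. a i y)" for y
    \<comment> \<open>As the \<open>G i\<close> are disjoint, the points \<open>g i y\<close> run through the preimages of \<open>y\<close> in their union, so this is
      the average of \<open>(\<rho> / c i) ^ k\<close> over the \<open>m\<close> most favourable of them.\<close>
    define \<rho>' where "\<rho>' y = ennpowr (ennreal (1 / real m) * \<sigma> y) (1 / real ?k)" for y
    have a[measurable]: "a i \<in> borel_measurable borel" for i
      unfolding a_def g_def by (rule mult_indicator_inv_into_borel[OF C(1) fC injC G(1,2)]) measurable
    have \<sigma>[measurable]: "\<sigma> \<in> borel_measurable borel"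
      unfolding \<sigma>_def
    proof (rule borel_measurable_SUP)
      show "countable {I :: nat set. finite I \<and> card I \<le> m}"
        by (rule countable_subset[OF _ countable_Collect_finite]) auto
    qed measurable
    have \<rho>'[measurable]: "\<rho>' \<in> borel_measurable borel" unfolding \<rho>'_def by measurable
    have \<rho>'k: "\<rho>' y ^ ?k = ennreal (1 / real m) * \<sigma> y" for y
      using ennpowr_ennpowr[of "1 / real ?k" "real ?k" "ennreal (1 / real m) * \<sigma> y"]
      by (simp add: \<rho>'_def ennpowr_1 flip: ennpowr_of_nat[OF k])
    have gG: "g i y \<in> G i \<and> f (g i y) = y" if "y \<in> f ` G i" for i y
      using that injC[of i] G(2)[of i] by (auto simp: g_def inv_into_f_f subset_iff)
    have int\<rho>': "(\<integral>\<^sup>+y. ennpowr (\<rho>' y) p \<partial>lebesgue) \<le> ennreal (t powr p) * (ennreal (1 / real m) * X)"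
    proof -
      \<comment> \<open>As \<open>\<rho>'\<close> is a \<open>k\<close>-th root of a mean, its
        \<open>p\<close>-th power is the power of that mean with exponent \<open>q = p / k\<close>;
        convexity needs \<open>q \<ge> 1\<close>, that is \<open>p \<ge> k\<close>.\<close>
      define q where "q = p / real ?k"
      have q: "1 \<le> q" using p k1 by (simp add: q_def)
      define b where "b i y = ennpowr (ennreal (1 / c i) * \<rho> (g i y)) p * indicator (f ` G i) y" for i y
      have ab: "ennpowr (a i y) q = b i y" for i y
        using k1 p0 by (auto simp: a_def b_def q_def indicator_def ennpowr_ennpowr simp flip: ennpowr_of_nat[OF k])
      have b[measurable]: "b i \<in> borel_measurable borel" for i
        unfolding b_def g_def by (rule mult_indicator_inv_into_borel[OF C(1) fC injC G(1,2)]) measurable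
      have bL: "b i \<in> borel_measurable lebesgue" for i
        using measurable_completion[of "b i" lborel borel] by simp
      have "ennpowr (\<rho>' y) p \<le> ennreal (1 / real m) * suminf (\<lambda>i. b i y)" for y
      proof -
        have "ennpowr (\<rho>' y) p = ennpowr (ennreal (1 / real m) * \<sigma> y) q"
          unfolding \<rho>'_def using p0 k1 by (subst ennpowr_ennpowr) (auto simp: q_def)
        also have "ennreal (1 / real m) * \<sigma> y = (SUP I\<in>{I. finite I \<and> card I \<le> m}. ennreal (1 / real m) * (\<Sum>i\<in>I. a i y))"
          unfolding \<sigma>_def by (rule SUP_mult_left_ennreal)
        also have "ennpowr \<dots> q \<le> ennreal (1 / real m) * suminf (\<lambda>i. b i y)"
        proof (rule ennpowr_SUP_le)
          fix I :: "nat set" assume I: "I \<in> {I. finite I \<and> card I \<le> m}"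
          have "ennpowr (ennreal (1 / real m) * (\<Sum>i\<in>I. a i y)) q \<le> ennreal (1 / real m) * (\<Sum>i\<in>I. ennpowr (a i y) q)"
            by (rule ennpowr_mean_le[OF q _ _ m]) (use I in auto)
          also have "\<dots> \<le> ennreal (1 / real m) * suminf (\<lambda>i. b i y)"
            unfolding ab by (intro mult_left_mono sum_le_suminf) (use I in auto)
          finally show "ennpowr (ennreal (1 / real m) * (\<Sum>i\<in>I. a i y)) q \<le> ennreal (1 / real m) * suminf (\<lambda>i. b i y)" .
        qed (use q in linarith)
        finally show ?thesis .
      qed
      then have "(\<integral>\<^sup>+y. ennpowr (\<rho>' y) p \<partial>lebesgue) \<le> (\<integral>\<^sup>+y. ennreal (1 / real m) * suminf (\<lambda>i. b i y) \<partial>lebesgue)"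
        by (rule nn_integral_mono)
      also have "\<dots> = ennreal (1 / real m) * suminf (\<lambda>i. \<integral>\<^sup>+y. b i y \<partial>lebesgue)"
        using bL by (subst nn_integral_cmult) (auto simp: nn_integral_suminf)
      also have "suminf (\<lambda>i. \<integral>\<^sup>+y. b i y \<partial>lebesgue) \<le> ennreal (t powr p) * X"
        unfolding b_def g_def X_def
        by (rule nn_integral_pieces_le[OF C(1) fC G(1,2) Gdis G(3) c injC p0 _ Gdiff Gms \<rho>b]) (use t in auto)
      finally show ?thesis by (simp add: mult_left_mono mult.left_commute)
    qed

    \<comment> \<open>Admissibility, with exceptional surfaces included\<close>
    define P where "P S' \<longleftrightarrow> (\<forall>S. lifting D f S S' \<longrightarrow>
         (\<forall>B \<subseteq> snd S ` fst S. area_null S' (f ` B) \<longrightarrow> area_null S B))" for S' :: "('k, 'n) surface"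
    define \<Gamma>0 where "\<Gamma>0 = {S :: ('k, 'n) surface. surface_in (f ` D) S \<and> \<not> P S}"
    have \<Gamma>0: "modulus p \<Gamma>0 = 0"
      using A2 unfolding A2_property_def p_ae_surface_in_def \<Gamma>0_def P_def .
    show ?thesis
      unfolding X_def[symmetric]
    proof (rule ennreal_le_epsilon)
      fix e :: real assume "0 < e"
      obtain \<eta> where \<eta>: "\<eta> \<in> adm \<Gamma>0" "(\<integral>\<^sup>+x. ennpowr (\<eta> x) p \<partial>lebesgue) < ennreal e"
        using modulus_exceptionalE[OF \<Gamma>0, of "ennreal e"] \<open>0 < e\<close> by auto
      have \<eta>b[measurable]: "\<eta> \<in> borel_measurable borel" using \<eta>(1) by (simp add: adm_def)
      \<comment> \<open>Each of the three terms settles one of the cases \<open>generic\<close>,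
        \<open>exceptional\<close> and \<open>positive\<close> below. The last one costs nothing
        since \<open>F\<close> is a Lebesgue null set, and \<open>\<eta>\<close> costs less than
        \<open>e\<close>.\<close>
      define r where "r y = max (\<rho>' y) (max (\<eta> y) (\<infinity> * indicator F y))" for y
      have r[measurable]: "r \<in> borel_measurable borel" unfolding r_def using Fb by measurable
      have r_ge: "\<rho>' y \<le> r y" "\<eta> y \<le> r y" "\<infinity> * indicator F y \<le> r y" for y
        by (simp_all add: r_def le_max_iff_disj)
      have admissible: "1 \<le> surface_integral S (\<lambda>y. r y ^ ?k)" if S: "S \<in> \<Gamma>'" for S
      proof -
        obtain \<omega> \<beta> where S_eq: "S = (\<omega>, \<beta>)" by fastforce
        have surf: "surface_in (f ` D) (\<omega>, \<beta>)" using \<Gamma>' S S_eq by blast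
        have N[measurable]: "multiplicity_fun (\<omega>, \<beta>) \<in> borel_measurable borel"
          by (rule borel_measurable_multiplicity_fun[OF surf])
        obtain \<omega>s \<alpha>s where
          L: "\<forall>j \<in> {1..m}. (\<omega>s j, \<alpha>s j) \<in> \<Gamma> \<and> \<omega>s j \<subseteq> \<omega> \<and> (\<forall>z \<in> \<omega>s j. \<beta> z = f (\<alpha>s j z))"
          and L': "\<forall>x \<in> D. \<forall>z \<in> \<omega>. int (card {j \<in> {1..m}. z \<in> \<omega>s j \<and> \<alpha>s j z = x}) \<le> local_index D f x"
          using bspec[OF lifts S] unfolding S_eq prod.case by (elim exE conjE) (rule that)
        have lift: "(\<omega>s j, \<alpha>s j) \<in> \<Gamma>" "\<omega>s j \<subseteq> \<omega>" if "j \<in> {1..m}" for j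
          using bspec[OF L that] by simp_all
        have lift3: "\<beta> z = f (\<alpha>s j z)" if "j \<in> {1..m}" "z \<in> \<omega>s j" for j z
          using bspec[OF L that(1)] that(2) by simp
        have mult: "int (card {j \<in> {1..m}. z \<in> \<omega>s j \<and> \<alpha>s j z = x}) \<le> local_index D f x" if "x \<in> D" "z \<in> \<omega>" for x z
          using bspec[OF bspec[OF L' that(1)] that(2)] .
        consider (positive) "(\<integral>\<^sup>+y\<in>F. multiplicity_fun (\<omega>, \<beta>) y \<partial>?H) \<noteq> 0"
          | (exceptional) j where "j \<in> {1..m}" "(\<omega>s j, \<beta>) \<in> \<Gamma>0"
          | (generic) "(\<integral>\<^sup>+y\<in>F. multiplicity_fun (\<omega>, \<beta>) y \<partial>?H) = 0" "\<And>j. j \<in> {1..m} \<Longrightarrow> (\<omega>s j, \<beta>) \<notin> \<Gamma>0"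
          by blast
        then show ?thesis
        proof cases
          case positive
          have "\<infinity> = \<infinity> * (\<integral>\<^sup>+y\<in>F. multiplicity_fun (\<omega>, \<beta>) y \<partial>?H)"
            using positive by (simp add: ennreal_top_mult)
          also have "\<dots> = (\<integral>\<^sup>+y. \<infinity> * (multiplicity_fun (\<omega>, \<beta>) y * indicator F y) \<partial>?H)"
            by (rule nn_integral_cmult[symmetric], rule borel_measurable_hausdorff_measure[OF k]) (use Fb in measurable)
          also have "\<dots> \<le> surface_integral S (\<lambda>y. r y ^ ?k)"
            unfolding surface_integral_def S_eq
          proof (rule nn_integral_mono)
            fix y
            show "\<infinity> * (multiplicity_fun (\<omega>, \<beta>) y * indicator F y) \<le> r y ^ ?k * multiplicity_fun (\<omega>, \<beta>) y"
            proof (cases "y \<in> F")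
              case True
              then have "r y = \<infinity>" using r_ge(3)[of y] by (simp add: top_unique)
              then have "r y ^ ?k = \<infinity>" using k by (simp add: power_top_ennreal)
              then show ?thesis using True by simp
            qed simp
          qed
          finally show ?thesis by (metis infinity_ennreal_def top_greatest order_trans)
        next
          case exceptional
          \<comment> \<open>One exceptional restriction of \<open>\<beta>\<close> is enough:
            enlarging its domain only raises the multiplicity.\<close>
          have "1 \<le> surface_integral (\<omega>s j, \<beta>) (\<lambda>y. \<eta> y ^ ?k)"
            using \<eta>(1) exceptional(2) by (simp add: adm_def)
          also have "\<dots> \<le> surface_integral S (\<lambda>y. r y ^ ?k)"
            unfolding surface_integral_def S_eq
            by (intro nn_integral_mono mult_mono power_mono r_ge multiplicity_fun_mono lift(2) exceptional(1)) auto
          finally show ?thesis .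
        next
          case generic
          define e where "e j i y = a i y * multiplicity_fun (\<omega>s j, \<alpha>s j) (g i y)" for j i y
          have \<alpha>surf: "surface_in D (\<omega>s j, \<alpha>s j)" if "j \<in> {1..m}" for j
            using \<Gamma> lift(1)[OF that] by blast
          have eb: "e j i \<in> borel_measurable ?H" if j: "j \<in> {1..m}" for j i
          proof (rule borel_measurable_hausdorff_measure[OF k])
            have [measurable]: "multiplicity_fun (\<omega>s j, \<alpha>s j) \<in> borel_measurable borel"
              by (rule borel_measurable_multiplicity_fun[OF \<alpha>surf[OF j]])
            have "(\<lambda>y. (ennreal (1 / c i) * \<rho> (g i y)) ^ ?k * multiplicity_fun (\<omega>s j, \<alpha>s j) (g i y) * indicator (f ` G i) y)
                \<in> borel_measurable borel"
              unfolding g_def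
              by (rule mult_indicator_inv_into_borel[OF C(1) fC injC G(1,2), of "\<lambda>x. (ennreal (1 / c i) * \<rho> x) ^ ?k * multiplicity_fun (\<omega>s j, \<alpha>s j) x"]) measurable
            then show "e j i \<in> borel_measurable borel"
              unfolding e_def a_def by (simp add: mult_ac)
          qed
          have one: "1 \<le> suminf (\<lambda>i. \<integral>\<^sup>+y. e j i y \<partial>?H)" if j: "j \<in> {1..m}" for j
          proof -
            have surf': "surface_in (f ` D) (\<omega>s j, \<beta>)"
              by (rule surface_in_restrict[OF surf \<alpha>surf[OF j] lift(2)[OF j]]) (rule lift3[OF j])
            have "P (\<omega>s j, \<beta>)" using generic(2)[OF j] surf' by (simp add: \<Gamma>0_def)
            then have null: "N0 \<inter> \<alpha>s j ` \<omega>s j \<in> null_sets ?H"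
              unfolding P_def
              by (intro lift_exceptional_null[OF surf Fb generic(1) _ _ lift(2)[OF j] F(2)])
                 (use \<alpha>surf[OF j] lift3[OF j] in \<open>auto simp: lifting_def\<close>)
            have "1 \<le> surface_integral (\<omega>s j, \<alpha>s j) (\<lambda>y. \<rho> y ^ ?k)"
              using \<rho> lift(1)[OF j] by (simp add: adm_def)
            also have "\<dots> \<le> suminf (\<lambda>i. \<integral>\<^sup>+y. e j i y \<partial>?H)"
              unfolding e_def a_def g_def
              by (rule surface_integral_le_pieces[where C=C and G=G and N=N0, OF C(1) fC G(1,2) c ex \<alpha>surf[OF j] \<rho>b _ cover]) (use null in auto)
            finally show ?thesis .
          qed
          \<comment> \<open>The lifts are added up before the pointwise estimate:
            \<open>\<sigma>\<close> bounds all of them jointly, and their total of at least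
            \<open>m\<close> cancels the factor \<open>1 / m\<close> in
            \<open>\<rho>'\<close>.\<close>
          have "of_nat m = (\<Sum>j\<in>{1..m}. 1 :: ennreal)" by simp
          also have "\<dots> \<le> (\<Sum>j\<in>{1..m}. suminf (\<lambda>i. \<integral>\<^sup>+y. e j i y \<partial>?H))"
            by (rule sum_mono) (rule one)
          also have "\<dots> = (\<Sum>j\<in>{1..m}. \<integral>\<^sup>+y. suminf (\<lambda>i. e j i y) \<partial>?H)"
            by (intro sum.cong refl nn_integral_suminf[symmetric] eb)
          also have "\<dots> = (\<integral>\<^sup>+y. (\<Sum>j\<in>{1..m}. suminf (\<lambda>i. e j i y)) \<partial>?H)"
            by (intro nn_integral_sum[symmetric] borel_measurable_suminf_order eb)
          also have "\<dots> \<le> (\<integral>\<^sup>+y. \<sigma> y * multiplicity_fun (\<omega>, \<beta>) y \<partial>?H)"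
          proof (rule nn_integral_mono)
            fix y
            have aG: "y \<in> f ` G i" if "a i y \<noteq> 0" for i
              using that by (auto simp: a_def indicator_def split: if_splits)
            show "(\<Sum>j\<in>{1..m}. suminf (\<lambda>i. e j i y)) \<le> \<sigma> y * multiplicity_fun (\<omega>, \<beta>) y"
              unfolding e_def \<sigma>_def multiplicity_fun_def fst_conv snd_conv
            proof (rule lift_multiplicity_sum_le[OF m])
              show "inj_on (\<lambda>i. g i y) {i. a i y \<noteq> 0}"
              proof (rule inj_onI)
                fix i i' assume ii: "i \<in> {i. a i y \<noteq> 0}" "i' \<in> {i. a i y \<noteq> 0}" "g i y = g i' y"
                have "g i y \<in> G i" "g i' y \<in> G i'" using gG[OF aG[of i]] gG[OF aG[of i']] ii(1,2) by simp_all
                then have "g i y \<in> G i \<inter> G i'" using ii(3) by simp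
                then show "i = i'" using Gdis by (auto simp: disjoint_family_on_def)
              qed
              show "z \<in> {z \<in> \<omega>. \<beta> z = y}" if "a i y \<noteq> 0" "j \<in> {1..m}" "z \<in> \<omega>s j" "\<alpha>s j z = g i y" for i j z
                using lift(2)[OF that(2)] lift3[OF that(2,3)] that gG[OF aG[OF that(1)]] by auto
              show "card {j \<in> {1..m}. z \<in> \<omega>s j \<and> \<alpha>s j z = g i y} \<le> 1" if "a i y \<noteq> 0" "z \<in> {z \<in> \<omega>. \<beta> z = y}" for i z
              proof -
                have gi: "g i y \<in> G i" using gG aG that(1) by blast
                then have "g i y \<in> D" using G(3) by blast
                then show ?thesis using mult[of "g i y" z] that(2) index[OF gi] by simp
              qed
            qed
          qed
          finally have m_le: "of_nat m \<le> (\<integral>\<^sup>+y. \<sigma> y * multiplicity_fun (\<omega>, \<beta>) y \<partial>?H)" .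
          have "1 = ennreal (1 / real m) * of_nat m"
            using m by (simp add: ennreal_of_nat_eq_real_of_nat flip: ennreal_mult)
          also have "\<dots> \<le> ennreal (1 / real m) * (\<integral>\<^sup>+y. \<sigma> y * multiplicity_fun (\<omega>, \<beta>) y \<partial>?H)"
            by (intro mult_left_mono m_le) simp
          also have "\<dots> = (\<integral>\<^sup>+y. ennreal (1 / real m) * (\<sigma> y * multiplicity_fun (\<omega>, \<beta>) y) \<partial>?H)"
            by (rule nn_integral_cmult[symmetric], rule borel_measurable_hausdorff_measure[OF k]) measurable
          also have "\<dots> \<le> surface_integral S (\<lambda>y. r y ^ ?k)"
            unfolding surface_integral_def S_eq
          proof (rule nn_integral_mono)
            fix y
            have "ennreal (1 / real m) * (\<sigma> y * multiplicity_fun (\<omega>, \<beta>) y) = \<rho>' y ^ ?k * multiplicity_fun (\<omega>, \<beta>) y"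
              by (simp add: \<rho>'k mult.assoc)
            also have "\<dots> \<le> r y ^ ?k * multiplicity_fun (\<omega>, \<beta>) y"
              by (intro mult_right_mono power_mono r_ge) auto
            finally show "ennreal (1 / real m) * (\<sigma> y * multiplicity_fun (\<omega>, \<beta>) y) \<le> r y ^ ?k * multiplicity_fun (\<omega>, \<beta>) y" .
          qed
          finally show ?thesis .
        qed
      qed

      \<comment> \<open>Estimate of the modulus\<close>
      then have "r \<in> adm \<Gamma>'" by (simp add: adm_def)
      then have "modulus p \<Gamma>' \<le> (\<integral>\<^sup>+y. ennpowr (r y) p \<partial>lebesgue)"
        unfolding modulus_def by (rule INF_lower)
      also have "\<dots> \<le> (\<integral>\<^sup>+y. ennpowr (\<rho>' y) p + (ennpowr (\<eta> y) p + \<infinity> * indicator F y) \<partial>lebesgue)"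
      proof (rule nn_integral_mono)
        fix y
        have "ennpowr (r y) p \<le> max (ennpowr (\<rho>' y) p) (max (ennpowr (\<eta> y) p) (\<infinity> * indicator F y))"
          by (cases "y \<in> F") (auto simp: r_def max_def ennpowr_mono[OF p0] not_le[symmetric] intro: order_trans)
        also have "\<dots> \<le> ennpowr (\<rho>' y) p + (ennpowr (\<eta> y) p + \<infinity> * indicator F y)"
          by (intro max.boundedI) (auto simp: add_increasing add_increasing2)
        finally show "ennpowr (r y) p \<le> ennpowr (\<rho>' y) p + (ennpowr (\<eta> y) p + \<infinity> * indicator F y)" .
      qed
      also have "\<dots> = (\<integral>\<^sup>+y. ennpowr (\<rho>' y) p \<partial>lebesgue) + ((\<integral>\<^sup>+y. ennpowr (\<eta> y) p \<partial>lebesgue) + (\<integral>\<^sup>+y. \<infinity> * indicator F y \<partial>lebesgue))"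
      proof -
        have L: "h \<in> borel_measurable lebesgue" if "h \<in> borel_measurable borel" for h :: "real ^ 'n \<Rightarrow> ennreal"
          using measurable_completion[of h lborel borel] that by simp
        have m1: "(\<lambda>y. ennpowr (\<rho>' y) p) \<in> borel_measurable lebesgue"
          and m2: "(\<lambda>y. ennpowr (\<eta> y) p) \<in> borel_measurable lebesgue"
          and m3: "(\<lambda>y. \<infinity> * indicator F y :: ennreal) \<in> borel_measurable lebesgue"
          by (intro L; use Fb in measurable)+
        show ?thesis
          by (simp only: nn_integral_add[OF m1 borel_measurable_add[OF m2 m3]] nn_integral_add[OF m2 m3])
      qed
      also have "(\<integral>\<^sup>+y. \<infinity> * indicator F y \<partial>lebesgue) = (0::ennreal)"
        using F(1) Fb by (subst nn_integral_cmult_indicator) (auto simp: null_sets_def)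
      also have "(\<integral>\<^sup>+y. ennpowr (\<rho>' y) p \<partial>lebesgue) + ((\<integral>\<^sup>+y. ennpowr (\<eta> y) p \<partial>lebesgue) + 0)
          \<le> ennreal (t powr p) * (ennreal (1 / real m) * X) + ennreal e"
        using int\<rho>' \<eta>(2) by (intro add_mono) (auto simp: less_imp_le)
      finally show "modulus p \<Gamma>' \<le> ennreal (t powr p) * (ennreal (1 / real m) * X) + ennreal e" .
    qed
  qed
qed

theorem theorem2p1:
  fixes f :: "real ^ 'n \<Rightarrow> real ^ 'n::finite"
    and D :: "(real ^ 'n) set"
    and p :: real
    and m :: nat
    and \<Gamma> \<Gamma>' :: "('k::finite, 'n) surface set"
  assumes "2 \<le> CARD('n)"
    and "1 \<le> CARD('k)" and "CARD('k) \<le> CARD('n) - 1"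
    and "real CARD('k) \<le> p"
    and "open D" and "connected D" and "D \<noteq> {}"
    and "continuous_on D f"
    and "orientation_preserving_map D f"
    and "\<forall>U \<subseteq> D. open U \<longrightarrow> open (f ` U)"
    and "\<forall>y. discrete {x \<in> D. f x = y}"
    and "finite_metric_distortion D f"
    and "A2_property TYPE('k) p D f"
    and "\<forall>S \<in> \<Gamma>. surface_in D S"
    and "\<forall>S \<in> \<Gamma>'. surface_in (f ` D) S"
    and "0 < m"
    and "\<forall>(\<omega>, \<beta>) \<in> \<Gamma>'. \<exists>\<omega>s \<alpha>s.
           (\<forall>j \<in> {1..m}. (\<omega>s j, \<alpha>s j) \<in> \<Gamma> \<and> \<omega>s j \<subseteq> \<omega> \<and> (\<forall>z \<in> \<omega>s j. \<beta> z = f (\<alpha>s j z))) \<and>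
           (\<forall>x \<in> D. \<forall>z \<in> \<omega>.
              int (card {j \<in> {1..m}. z \<in> \<omega>s j \<and> \<alpha>s j z = x}) \<le> local_index D f x)"
  shows "\<forall>\<rho> \<in> adm \<Gamma>.
           modulus p \<Gamma>' \<le>
             ennreal (1 / real m) *
               (\<integral>\<^sup>+ x \<in> D. inner_dilatation p f x * ennpowr (\<rho> x) p \<partial>lebesgue)"
proof
  fix \<rho> assume \<rho>: "\<rho> \<in> adm \<Gamma>"
  define Y where "Y = ennreal (1 / real m) * (\<integral>\<^sup>+ x \<in> D. inner_dilatation p f x * ennpowr (\<rho> x) p \<partial>lebesgue)"
  \<comment> \<open>The pieces depend on \<open>t\<close> but \<open>Y\<close> does not, so
    \<open>t\<close> may tend to 1 from above.\<close>
  have bound: "modulus p \<Gamma>' \<le> ennreal (t powr p) * Y" if "1 < t" for t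
    unfolding Y_def by (rule modulus_lift_le_factor[OF assms(4,5,8,11-17) \<rho> that])
  have "modulus p \<Gamma>' \<le> Y"
  proof (cases "Y = \<infinity>")
    case False
    have "((\<lambda>t. t powr p) \<longlongrightarrow> 1 powr p) (at_right 1)"
      by (intro tendsto_intros) auto
    then have "((\<lambda>t. ennreal (t powr p) * Y) \<longlongrightarrow> ennreal 1 * Y) (at_right 1)"
      using False by (intro tendsto_mult_ennreal tendsto_ennrealI tendsto_const) auto
    moreover have "\<forall>\<^sub>F t in at_right 1. modulus p \<Gamma>' \<le> ennreal (t powr p) * Y"
      using eventually_at_right_less[of "1::real"] by eventually_elim (rule bound)
    ultimately have "modulus p \<Gamma>' \<le> ennreal 1 * Y"
      by (intro tendsto_lowerbound) auto
    then show ?thesis by simp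
  qed simp
  then show "modulus p \<Gamma>' \<le> ennreal (1 / real m) * (\<integral>\<^sup>+ x \<in> D. inner_dilatation p f x * ennpowr (\<rho> x) p \<partial>lebesgue)"
    unfolding Y_def .
qed

end
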